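(* Let $L/K$ be a finite separable extension of local fields which is totally ramified, with notation $N,A,G,A_1,G_1,\mathcal{S},\mathrm{Frob}$ as in the context. Then the following are equivalent: (1) $L/K$ is exceptional; (2) $\{A_1\}$ (the one-element subset of $\mathcal{S}$ consisting of the trivial coset) is the only subset of $\mathcal{S}$ that is both an $A_1$-orbit and a $G_1$-orbit; (3) the diagonal of $\mathcal{S}\times\mathcal{S}$ is the only subset of $\mathcal{S}\times\mathcal{S}$ that is both an $A$-orbit and a $G$-orbit (for the diagonal actions); (4) $\mathrm{Frob}(N/L)\cap\mathrm{Frob}(N/\sigma(L))=\emptyset$ for every $\sigma\in A\setminus A_1$; (5) $\mathrm{Frob}(N/K)=\bigcup_{\sigma\in A}\mathrm{Frob}(N/\sigma(L))$; (6) every $\sigma\in A$ with $A=\langle G,\sigma\rangle$ has a unique fixed point in $\mathcal{S}$; (7) every $\sigma\in A$ with $A=\langle G,\sigma\rangle$ has at most one fixed point in $\mathcal{S}$; (8) every $\sigma\in A$ with $A=\langle G,\sigma\rangle$ has at least one fixed point in $\mathcal{S}$; (9) every $\sigma\in\mathrm{Frob}(N/K)$ has a unique fixed point in $\mathcal{S}$; (10) every $\sigma\in\mathrm{Frob}(N/K)$ has at most one fixed point in $\mathcal{S}$; (11) every $\sigma\in\mathrm{Frob}(N/K)$ has at least one fixed point in $\mathcal{S}$; (12) every $\sigma\in A_1$ with $A_1=\langle G_1,\sigma\rangle$ has a unique fixed point in $\mathcal{S}$; (13) every $\sigma\in A_1$ with $A_1=\langle G_1,\sigma\rangle$ has at most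 one fixed point in $\mathcal{S}$; (14) every $\sigma\in\mathrm{Frob}(N/L)$ has a unique fixed point in $\mathcal{S}$; (15) every $\sigma\in\mathrm{Frob}(N/L)$ has at most one fixed point in $\mathcal{S}$.
   Context: A local field is a field complete with respect to a discrete valuation with finite residue field. For a finite separable extension $L/K$ of local fields with Galois closure $N$, $L/K$ is exceptional if (a) $L/K$ is totally ramified, and (b) for every $\sigma\in\mathrm{Gal}(N/K)\setminus\mathrm{Gal}(N/L)$ the compositum $L.\sigma(L)$ is not totally ramified over $K$. Notation: for an intermediate field $M$ of $N/K$, $\bar M$ denotes its residue field and $M'$ the maximal unramified extension of $M$ inside $N$. Let $A=\mathrm{Gal}(N/K)$, $G=\mathrm{Gal}(N/K')$, $A_1=\mathrm{Gal}(N/L)$, $G_1=\mathrm{Gal}(N/L')$. Let $\rho\colon\mathrm{Gal}(N/K)\to\mathrm{Gal}(\bar N/\bar K)$ be the canonical surjection (so $G=\ker\rho$), let $\bar K=\mathbb{F}_q$, and let $\theta\in\mathrm{Gal}(\bar N/\bar K)$ be the $q$-th power map. For an intermediate field $M$ of $N/K$, set $\mathrm{Frob}(N/M)=\rho^{-1}(\theta)\cap\mathrm{Gal}(N/M)$. Let $\mathcal{S}=A/A_1$ be the set of left cosets of $A_1$ in $A$ with $A$ acting by left multiplication; a fixed point of $\sigma$ is a coset $\tau A_1$ with $\sigma\tau A_1=\tau A_1$. The notation $A=\langle G,\sigma\rangle$ means $A$ is generated by $G$ and $\sigma$. *)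

theory Defs
  imports
    "HOL-Algebra.Bij"
    "HOL-Algebra.Left_Coset"
    "HOL-Algebra.Group_Action"
    "HOL-Algebra.Generated_Groups"
    "HOL-Algebra.Generated_Fields"
    "HOL-Algebra.Finite_Extensions"
begin

text \<open>
  All fields under consideration are subfields of one ambient field (in the end, the Galois
  closure); an intermediate field is represented by its carrier set.
\<close>


subsection \<open>Field extensions\<close>

definition (in ring) normal_extension :: "'a set \<Rightarrow> 'a set \<Rightarrow> bool"
  where "normal_extension K E \<longleftrightarrow>
    (\<forall>x\<in>E. (algebraic over K) x \<and> ring.splitted (R\<lparr>carrier := E\<rparr>) (Irr K x))"

text \<open>
  Separability means that the minimal polynomials of the elements of \<open>E\<close> have no multiple roots in
  a splitting field. The splitting is required to take place in the ambient field, so this agrees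
  with the usual notion as soon as the ambient field contains a normal closure of \<open>E\<close> over \<open>K\<close>.
\<close>

definition (in ring) separable_extension :: "'a set \<Rightarrow> 'a set \<Rightarrow> bool"
  where "separable_extension K E \<longleftrightarrow>
    (\<forall>x\<in>E. (algebraic over K) x \<and> splitted (Irr K x) \<and>
      (\<forall>a\<in>carrier R. alg_mult (Irr K x) a \<le> 1))"

text \<open>
  The ambient field is the smallest normal extension of \<open>K\<close> containing \<open>L\<close>. For separable \<open>L\<close> over
  \<open>K\<close> this is the Galois closure.
\<close>

definition (in ring) is_galois_closure :: "'a set \<Rightarrow> 'a set \<Rightarrow> bool"
  where "is_galois_closure K L \<longleftrightarrow>
    normal_extension K (carrier R) \<and>
    (\<forall>E. subfield E R \<longrightarrow> K \<subseteq> E \<longrightarrow> L \<subseteq> E \<longrightarrow> normal_extension K E \<longrightarrow> E = carrier R)"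

text \<open>
  \<open>Gal(N/M)\<close>. As for \<^const>\<open>AutoGroup\<close>, automorphisms are extensional functions, so that
  distinct elements differ on the carrier.
\<close>

definition galois_group :: "('a, 'b) ring_scheme \<Rightarrow> 'a set \<Rightarrow> ('a \<Rightarrow> 'a) monoid"
  where "galois_group N M = BijGroup (carrier N)
    \<lparr>carrier := {\<sigma> \<in> ring_iso N N \<inter> Bij (carrier N). \<forall>x\<in>M. \<sigma> x = x}\<rparr>"

definition compositum :: "('a, 'b) ring_scheme \<Rightarrow> 'a set \<Rightarrow> 'a set \<Rightarrow> 'a set"
  where "compositum N E F = generate_field N (E \<union> F)"


subsection \<open>Discrete valuations and local fields\<close>

text \<open>
  The value of \<open>v\<close> at \<open>\<zero>\<close> is irrelevant; it stands for infinity. The value group is only required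
  to be a nonzero subgroup of the integers: without a normalization, the restriction of a discrete
  valuation to a subfield over which the field is finite is again a discrete valuation, and
  ``the valuation on \<open>E\<close> extends the one on \<open>K\<close>'' simply says that \<open>v\<close> is the same function.
  A complete discrete valuation extends uniquely to a finite extension, so a single \<open>v\<close> on the
  ambient field provides the valuation of every intermediate field.
\<close>

locale discretely_valued_field = field R for R (structure) +
  fixes v :: "'a \<Rightarrow> int"
  assumes val_mult: "\<lbrakk> x \<in> carrier R - {\<zero>}; y \<in> carrier R - {\<zero>} \<rbrakk> \<Longrightarrow> v (x \<otimes> y) = v x + v y"
    and val_add: "\<lbrakk> x \<in> carrier R - {\<zero>}; y \<in> carrier R - {\<zero>}; x \<oplus> y \<noteq> \<zero> \<rbrakk>
      \<Longrightarrow> v (x \<oplus> y) \<ge> min (v x) (v y)"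
    and val_nontrivial: "\<exists>x\<in>carrier R - {\<zero>}. v x \<noteq> 0"

definition val_ring :: "('a, 'b) ring_scheme \<Rightarrow> ('a \<Rightarrow> int) \<Rightarrow> 'a set"
  where "val_ring R v = {x \<in> carrier R. x = \<zero>\<^bsub>R\<^esub> \<or> v x \<ge> 0}"

definition val_ideal :: "('a, 'b) ring_scheme \<Rightarrow> ('a \<Rightarrow> int) \<Rightarrow> 'a set"
  where "val_ideal R v = {x \<in> carrier R. x = \<zero>\<^bsub>R\<^esub> \<or> v x > 0}"

definition residue_field :: "('a, 'b) ring_scheme \<Rightarrow> ('a \<Rightarrow> int) \<Rightarrow> 'a set ring"
  where "residue_field R v = (R\<lparr>carrier := val_ring R v\<rparr>) Quot (val_ideal R v)"

definition val_close :: "('a, 'b) ring_scheme \<Rightarrow> ('a \<Rightarrow> int) \<Rightarrow> int \<Rightarrow> 'a \<Rightarrow> 'a \<Rightarrow> bool"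
  where "val_close R v n x y \<longleftrightarrow> x \<ominus>\<^bsub>R\<^esub> y = \<zero>\<^bsub>R\<^esub> \<or> v (x \<ominus>\<^bsub>R\<^esub> y) \<ge> n"

definition val_complete :: "('a, 'b) ring_scheme \<Rightarrow> ('a \<Rightarrow> int) \<Rightarrow> bool"
  where "val_complete R v \<longleftrightarrow>
    (\<forall>s :: nat \<Rightarrow> 'a. range s \<subseteq> carrier R \<longrightarrow>
      (\<forall>n. \<exists>k. \<forall>i\<ge>k. \<forall>j\<ge>k. val_close R v n (s i) (s j)) \<longrightarrow>
      (\<exists>l\<in>carrier R. \<forall>n. \<exists>k. \<forall>i\<ge>k. val_close R v n (s i) l))"

locale local_field = discretely_valued_field R v for R (structure) and v +
  assumes complete: "val_complete R v"
    and finite_residue_field: "finite (carrier (residue_field R v))"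


subsection \<open>Ramification\<close>

text \<open>
  The residue field of an intermediate field \<open>M\<close>, identified with its canonical image in the residue
  field of \<open>N\<close>: the classes of the integral elements of \<open>M\<close>.
\<close>

definition residue_subfield :: "('a, 'b) ring_scheme \<Rightarrow> ('a \<Rightarrow> int) \<Rightarrow> 'a set \<Rightarrow> 'a set set"
  where "residue_subfield N v M = (\<lambda>x. val_ideal N v +>\<^bsub>N\<^esub> x) ` (M \<inter> val_ring N v)"

definition residue_degree ::
    "('a, 'b) ring_scheme \<Rightarrow> ('a \<Rightarrow> int) \<Rightarrow> 'a set \<Rightarrow> 'a set \<Rightarrow> nat"
  where "residue_degree N v M E =
    (ring.dim (residue_field N v) over residue_subfield N v M) (residue_subfield N v E)"

text \<open>
  Total ramification means residue degree one; for finite extensions of local fields this is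
  equivalent to the ramification index being the degree.
\<close>

definition totally_ramified ::
    "('a, 'b) ring_scheme \<Rightarrow> ('a \<Rightarrow> int) \<Rightarrow> 'a set \<Rightarrow> 'a set \<Rightarrow> bool"
  where "totally_ramified N v M E \<longleftrightarrow> residue_degree N v M E = 1"

text \<open>Residue field extensions of local fields are automatically separable.\<close>

definition unramified ::
    "('a, 'b) ring_scheme \<Rightarrow> ('a \<Rightarrow> int) \<Rightarrow> 'a set \<Rightarrow> 'a set \<Rightarrow> bool"
  where "unramified N v M E \<longleftrightarrow> residue_degree N v M E = (ring.dim N over M) E"

text \<open>The maximal unramified extension of \<open>M\<close> inside \<open>N\<close>: the composite of all unramified ones.\<close>

definition max_unramified :: "('a, 'b) ring_scheme \<Rightarrow> ('a \<Rightarrow> int) \<Rightarrow> 'a set \<Rightarrow> 'a set"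
  where "max_unramified N v M =
    generate_field N (\<Union>{E. subfield E N \<and> M \<subseteq> E \<and> unramified N v M E})"

definition exceptional ::
    "('a, 'b) ring_scheme \<Rightarrow> ('a \<Rightarrow> int) \<Rightarrow> 'a set \<Rightarrow> 'a set \<Rightarrow> bool"
  where "exceptional N v K L \<longleftrightarrow>
    totally_ramified N v K L \<and>
    (\<forall>\<sigma> \<in> carrier (galois_group N K) - carrier (galois_group N L).
      \<not> totally_ramified N v K (compositum N L (\<sigma> ` L)))"


subsection \<open>Frobenius elements\<close>

text \<open>
  The canonical map \<open>\<rho>\<close> from \<open>Gal(N/K)\<close> to the automorphisms of the residue field of \<open>N\<close>. Since
  \<open>\<sigma>\<close> preserves the valuation ring and its maximal ideal \<open>\<mm>\<close>, the image of the
  coset \<open>\<mm> + x\<close> under \<open>\<sigma>\<close> is the coset \<open>\<mm> + \<sigma> x\<close>.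
\<close>

definition residue_map ::
    "('a, 'b) ring_scheme \<Rightarrow> ('a \<Rightarrow> int) \<Rightarrow> ('a \<Rightarrow> 'a) \<Rightarrow> ('a set \<Rightarrow> 'a set)"
  where "residue_map N v \<sigma> = (\<lambda>c \<in> carrier (residue_field N v). \<sigma> ` c)"

text \<open>The \<open>q\<close>-th power map \<open>\<theta>\<close>, where \<open>q\<close> is the cardinality of the residue field of \<open>K\<close>.\<close>

definition residue_frobenius ::
    "('a, 'b) ring_scheme \<Rightarrow> ('a \<Rightarrow> int) \<Rightarrow> 'a set \<Rightarrow> ('a set \<Rightarrow> 'a set)"
  where "residue_frobenius N v K =
    (\<lambda>c \<in> carrier (residue_field N v).
      c [^]\<^bsub>residue_field N v\<^esub> card (residue_subfield N v K))"

text \<open>\<open>Frob(N/M)\<close>; it depends on the base field \<open>K\<close> through \<open>q\<close>, also when \<open>M\<close> is larger than \<open>K\<close>.\<close>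

definition frob_set ::
    "('a, 'b) ring_scheme \<Rightarrow> ('a \<Rightarrow> int) \<Rightarrow> 'a set \<Rightarrow> 'a set \<Rightarrow> ('a \<Rightarrow> 'a) set"
  where "frob_set N v K M =
    {\<sigma> \<in> carrier (galois_group N K). residue_map N v \<sigma> = residue_frobenius N v K}
      \<inter> carrier (galois_group N M)"

end

theory Submission
  imports Defs
begin

text \<open>The inertia group \<open>I\<close> of \<open>N/K\<close> is \<open>Gal(N/K')\<close>. Every intermediate field \<open>M\<close> admits a Frobenius element: if
the residue of \<open>a\<close> generates the residue field of \<open>N\<close>, then the reduced polynomial of the conjugates
of \<open>a\<close> over \<open>M\<close> has coefficients in the residue field of \<open>M\<close>, hence the Frobenius conjugate of the
residue of \<open>a\<close> is the residue of some conjugate of \<open>a\<close>. So \<open>A/I\<close> is cyclic and, because \<open>L/K\<close> is totally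
ramified, generated by an element of \<open>A\<^sub>1\<close>. What remains concerns finite permutation groups: \<open>I\<close> is
transitive on \<open>\<S>\<close>, so the mean number of fixed points over a coset of \<open>I\<close> is exactly 1, and
therefore "at most one", "at least one" and "exactly one" fixed point throughout a coset are equivalent.\<close>

section \<open>Joint orbits and fixed points on cosets\<close>

text \<open>Disjointness of the sets Frob(N/L) and Frob(N/\<sigma>(L)) is the one condition tied
  directly to \<open>exceptional\<close>; every condition is then compared with
  \<open>frob_unique\<close>. The mean is 1 because a coset \<open>c\<close> in \<open>S\<close> is
  fixed by exactly \<open>card (I \<inter> c)\<close> elements of any coset of \<open>I\<close>, and
  the sets \<open>I \<inter> c\<close> partition \<open>I\<close>. On the field side the obstacle is
  that \<open>v\<close> is merely a valuation on the ambient field, not known to be Galois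
  invariant. Invariance comes from completeness of \<open>K\<close>: an automorphism is a bounded
  linear map over \<open>K\<close>, and a bound with a constant loss, applied to all powers of an
  element, leaves no loss. Frobenius elements take the place of Hensel's lemma, also when the Galois
  group over the maximal unramified extension is identified with the inertia group: there group
  orders, field degrees and residue degrees are compared. These degrees rest on a primitive element,
  which exists because a nontrivially valued field is infinite.\<close>

no_notation (input) subset_mset (infix \<open><#\<close> 50)

lemma (in group) inv_mult_cancel:
  assumes "x \<in> carrier G" "y \<in> carrier G"
  shows "inv x \<otimes> (x \<otimes> y) = y" "x \<otimes> (inv x \<otimes> y) = y"
  using assms by (simp_all add: m_assoc[symmetric])

text \<open>Brings a group word to right-nested form and cancels adjacent inverse pairs; this
  settles the identities between conjugates in the coset computations.\<close>

lemmas (in group) word_simps = m_assoc inv_mult_group inv_mult_cancel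

lemma (in group) subgroup_nat_pow_closed:
  assumes "subgroup H G" "x \<in> H"
  shows "x [^] (n::nat) \<in> H"
  using assms by (induction n) (simp_all add: subgroup.one_closed subgroup.m_closed)

lemma (in group) normal_conj_closed:
  assumes "I \<lhd> G" "i \<in> I" "g \<in> carrier G"
  shows "inv g \<otimes> i \<otimes> g \<in> I"
  using normal.inv_op_closed1[OF assms(1,3,2)] .

text \<open>Modulo \<open>I\<close> the elements \<open>s\<close> and \<open>s \<otimes> j\<close>
  coincide, hence so do their powers. In the induction the accumulated factor from \<open>I\<close>
  is moved past \<open>s\<close> by conjugation.\<close>

lemma (in group) normal_pow_mult:
  assumes I: "I \<lhd> G" and s: "s \<in> carrier G" and j: "j \<in> I"
  shows "\<exists>i\<in>I. (s \<otimes> j) [^] (n::nat) = s [^] n \<otimes> i"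
proof (induction n)
  case 0
  show ?case using subgroup.one_closed[OF normal_imp_subgroup[OF I]] by (intro bexI[of _ \<one>]) auto
next
  case (Suc n)
  have sub: "subgroup I G" using I by (rule normal_imp_subgroup)
  obtain i where i: "i \<in> I" "(s \<otimes> j) [^] n = s [^] n \<otimes> i" using Suc by blast
  have c: "i \<in> carrier G" "j \<in> carrier G" using i j subgroup.mem_carrier[OF sub] by auto
  have "(s \<otimes> j) [^] Suc n = s [^] n \<otimes> i \<otimes> (s \<otimes> j)" using i by simp
  also have "\<dots> = s [^] Suc n \<otimes> ((inv s \<otimes> i \<otimes> s) \<otimes> j)"
    using c s by (simp add: word_simps)
  finally show ?case
    using normal_conj_closed[OF I i(1) s] j sub by (metis subgroup.m_closed)
qed

text \<open>The quotient of \<open>G\<close> by \<open>J\<close> is cyclic, generated by the class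
  of \<open>b\<close>. The action is left abstract because two are needed: \<open>H\<close> with
  \<open>I \<inter> H\<close> on \<open>S\<close>, and \<open>A\<close> with \<open>I\<close> on
  \<open>S \<times> S\<close>.\<close>

locale joint_orbits = group G for G (structure) +
  fixes J b E \<alpha>
  assumes normal: "J \<lhd> G"
    and b: "b \<in> carrier G"
    and cyclic: "\<And>g. g \<in> carrier G \<Longrightarrow> \<exists>n::nat. \<exists>j\<in>J. g = b [^] n \<otimes> j"
    and act_closed: "\<And>g x. g \<in> carrier G \<Longrightarrow> x \<in> E \<Longrightarrow> \<alpha> g x \<in> E"
    and act_mult: "\<And>g h x. g \<in> carrier G \<Longrightarrow> h \<in> carrier G \<Longrightarrow> x \<in> E \<Longrightarrow> \<alpha> (g \<otimes> h) x = \<alpha> g (\<alpha> h x)"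
    and act_one: "\<And>x. x \<in> E \<Longrightarrow> \<alpha> \<one> x = x"
begin

lemma J_sub: "subgroup J G" using normal by (rule normal_imp_subgroup)

lemma orbit_translate:
  assumes "x \<in> E" "g \<in> carrier G"
  shows "orbit G \<alpha> (\<alpha> g x) = orbit G \<alpha> x"
proof
  show "orbit G \<alpha> (\<alpha> g x) \<subseteq> orbit G \<alpha> x"
    unfolding orbit_def using assms by (auto simp: act_mult[symmetric])
  show "orbit G \<alpha> x \<subseteq> orbit G \<alpha> (\<alpha> g x)"
  proof
    fix y assume "y \<in> orbit G \<alpha> x"
    then obtain h where h: "h \<in> carrier G" "y = \<alpha> h x" unfolding orbit_def by auto
    have "y = \<alpha> (h \<otimes> inv g) (\<alpha> g x)"
      using h assms by (simp add: act_mult[symmetric] m_assoc)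
    then show "y \<in> orbit G \<alpha> (\<alpha> g x)" unfolding orbit_def using h assms by auto
  qed
qed

lemma act_pow_fixed:
  assumes "s \<in> carrier G" "x \<in> E" "\<alpha> s x = x"
  shows "\<alpha> (s [^] (n::nat)) x = x"
  using assms by (induction n) (auto simp: act_one act_mult)

text \<open>A \<open>G\<close>-orbit is a \<open>J\<close>-orbit exactly when the stabilizer of one
  of its points maps onto the quotient of \<open>G\<close> by \<open>J\<close>. That quotient is
  generated by the class of \<open>b\<close>, so this says that the stabilizer meets the coset
  \<open>b <# J\<close>.\<close>

lemma joint_orbits_eq:
  "orbits G E \<alpha> \<inter> orbits (G\<lparr>carrier := J\<rparr>) E \<alpha> =
    {orbit G \<alpha> x | x. x \<in> E \<and> (\<exists>s \<in> b <# J. \<alpha> s x = x)}"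
proof (intro subset_antisym subsetI)
  fix O' assume "O' \<in> orbits G E \<alpha> \<inter> orbits (G\<lparr>carrier := J\<rparr>) E \<alpha>"
  then obtain x y where x: "x \<in> E" "O' = orbit G \<alpha> x"
    and y: "y \<in> E" "O' = orbit (G\<lparr>carrier := J\<rparr>) \<alpha> y"
    unfolding orbits_def by auto
  have "y \<in> O'"
    unfolding y(2) orbit_def using act_one[OF y(1)] subgroup.one_closed[OF J_sub] by force
  then obtain g where g: "g \<in> carrier G" "y = \<alpha> g x" unfolding x(2) orbit_def by auto
  then have O: "O' = orbit G \<alpha> y" using orbit_translate x by simp
  \<comment> \<open>The orbit is a \<open>J\<close>-orbit too, so \<open>b\<close> moves
    \<open>y\<close> as some \<open>j\<close> in \<open>J\<close> does. Hence
    \<open>inv j \<otimes> b\<close> fixes \<open>y\<close>, and normality puts it into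
    \<open>b <# J\<close>.\<close>
  then have "\<alpha> b y \<in> O'" using b unfolding orbit_def by auto
  then obtain j where j: "j \<in> J" "\<alpha> b y = \<alpha> j y" unfolding y(2) orbit_def by auto
  have jc: "j \<in> carrier G" using j subgroup.mem_carrier[OF J_sub] by auto
  let ?s = "inv j \<otimes> b"
  have "\<alpha> ?s y = \<alpha> (inv j) (\<alpha> j y)" using j jc b y by (simp add: act_mult)
  also have "\<dots> = y" using jc y by (simp add: act_mult[symmetric] act_one)
  finally have "\<alpha> ?s y = y" .
  moreover have "?s = b \<otimes> (inv b \<otimes> inv j \<otimes> b)"
    using b jc by (simp add: m_assoc[symmetric])
  then have "?s \<in> b <# J"
    using normal_conj_closed[OF normal _ b] subgroup.m_inv_closed[OF J_sub j(1)]
    unfolding l_coset_def by auto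
  ultimately show "O' \<in> {orbit G \<alpha> x | x. x \<in> E \<and> (\<exists>s \<in> b <# J. \<alpha> s x = x)}"
    using O y by blast
next
  fix O' assume "O' \<in> {orbit G \<alpha> x | x. x \<in> E \<and> (\<exists>s \<in> b <# J. \<alpha> s x = x)}"
  then obtain x j where x: "x \<in> E" "O' = orbit G \<alpha> x" and j: "j \<in> J" "\<alpha> (b \<otimes> j) x = x"
    unfolding l_coset_def by auto
  have jc: "j \<in> carrier G" using j subgroup.mem_carrier[OF J_sub] by auto
  have "orbit G \<alpha> x \<subseteq> orbit (G\<lparr>carrier := J\<rparr>) \<alpha> x"
  proof
    fix z assume "z \<in> orbit G \<alpha> x"
    then obtain g where g: "g \<in> carrier G" "z = \<alpha> g x" unfolding orbit_def by auto
    obtain n i where i: "i \<in> J" "g = b [^] (n::nat) \<otimes> i" using cyclic[OF g(1)] by auto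
    obtain i' where i': "i' \<in> J" "(b \<otimes> j) [^] n = b [^] n \<otimes> i'"
      using normal_pow_mult[OF normal b j(1)] by blast
    have c: "i \<in> carrier G" "i' \<in> carrier G" using i i' subgroup.mem_carrier[OF J_sub] by auto
    \<comment> \<open>\<open>?p\<close> fixes \<open>x\<close> and lies in the same coset of
      \<open>J\<close> as \<open>g\<close>. Conjugating the remaining factor \<open>?k\<close> to
      the left of \<open>?p\<close> shows that \<open>g\<close> moves \<open>x\<close> like an
      element of \<open>J\<close>.\<close>
    let ?k = "inv i' \<otimes> i" and ?p = "(b \<otimes> j) [^] n"
    have k: "?k \<in> J" using i i' J_sub by (simp add: subgroup.m_closed subgroup.m_inv_closed)
    have p: "?p \<in> carrier G" using b jc by simp
    have "g = ?p \<otimes> ?k"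
      unfolding i(2) i'(2) using c b by (simp add: word_simps)
    also have "\<dots> = (?p \<otimes> ?k \<otimes> inv ?p) \<otimes> ?p" using c p by (simp add: m_assoc)
    finally have "z = \<alpha> (?p \<otimes> ?k \<otimes> inv ?p) (\<alpha> ?p x)"
      using g c p x by (simp add: act_mult)
    also have "\<alpha> ?p x = x" using act_pow_fixed[of "b \<otimes> j"] b jc x j by simp
    finally show "z \<in> orbit (G\<lparr>carrier := J\<rparr>) \<alpha> x"
      using normal.inv_op_closed2[OF normal p k] unfolding orbit_def by auto
  qed
  moreover have "orbit (G\<lparr>carrier := J\<rparr>) \<alpha> x \<subseteq> orbit G \<alpha> x"
    unfolding orbit_def using subgroup.mem_carrier[OF J_sub] by force
  ultimately have "O' = orbit (G\<lparr>carrier := J\<rparr>) \<alpha> x" using x by blast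
  then show "O' \<in> orbits G E \<alpha> \<inter> orbits (G\<lparr>carrier := J\<rparr>) E \<alpha>"
    unfolding orbits_def using x by auto
qed

end

text \<open>A finite group that is cyclic modulo a normal subgroup \<open>I\<close>, with a generator modulo \<open>I\<close>
  lying in the subgroup \<open>H\<close>; in the application \<open>I\<close> is the inertia group.\<close>

locale cyclic_mod_normal = group A for A (structure) +
  fixes I H \<phi>
  assumes finite_carrier: "finite (carrier A)"
    and I: "I \<lhd> A"
    and H: "subgroup H A"
    and \<phi>: "\<phi> \<in> H"
    and cyclic: "\<And>a. a \<in> carrier A \<Longrightarrow> \<exists>n::nat. \<exists>i\<in>I. a = \<phi> [^] n \<otimes> i"
begin

abbreviation "S \<equiv> lcosets H"
abbreviation "F \<equiv> \<phi> <# I"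
abbreviation "Fix \<equiv> invariants S (l_coset A)"

lemma I_sub: "subgroup I A" using I by (rule normal_imp_subgroup)

lemma \<phi>_carrier: "\<phi> \<in> carrier A" using \<phi> subgroup.mem_carrier[OF H] by auto

lemma I_carrier: "i \<in> I \<Longrightarrow> i \<in> carrier A" using subgroup.mem_carrier[OF I_sub] by auto

lemma H_carrier: "h \<in> H \<Longrightarrow> h \<in> carrier A" using subgroup.mem_carrier[OF H] by auto

lemma S_sub: "c \<in> S \<Longrightarrow> c \<subseteq> carrier A"
  using subgroup.lcosets_carrier[OF H group_axioms] by auto

lemma S_E: assumes "c \<in> S" obtains t where "t \<in> carrier A" "c = t <# H"
  using assms unfolding LCOSETS_def by auto

lemma S_I: "t \<in> carrier A \<Longrightarrow> t <# H \<in> S" unfolding LCOSETS_def by auto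

lemma S_closed: "g \<in> carrier A \<Longrightarrow> c \<in> S \<Longrightarrow> g <# c \<in> S"
  by (elim S_E) (auto simp: lcos_m_assoc subgroup.subset[OF H] intro: S_I)

lemma coset_eq_iff:
  assumes "s \<in> carrier A" "t \<in> carrier A"
  shows "s <# H = t <# H \<longleftrightarrow> inv t \<otimes> s \<in> H"
proof
  assume "s <# H = t <# H"
  then have "s \<in> t <# H" using lcos_self[OF assms(1) H] by simp
  then show "inv t \<otimes> s \<in> H" using subgroup.lcos_module_imp[OF H group_axioms assms(2)] by simp
next
  assume "inv t \<otimes> s \<in> H"
  then have "s \<in> t <# H" using subgroup.lcos_module_rev[OF H group_axioms assms(2,1)] by simp
  then show "s <# H = t <# H" using l_repr_independence[OF _ assms(2) H] by simp
qed

lemma fix_iff: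
  assumes "s \<in> carrier A" "t \<in> carrier A"
  shows "s <# (t <# H) = t <# H \<longleftrightarrow> inv t \<otimes> s \<otimes> t \<in> H"
  using assms coset_eq_iff[of "s \<otimes> t" t] by (simp add: lcos_m_assoc subgroup.subset[OF H] m_assoc)

lemma H_in_S: "H \<in> S"
  using S_I[OF one_closed] lcos_mult_one[OF subgroup.subset[OF H]] by simp

lemma H_fixes: "h \<in> H \<Longrightarrow> h <# H = H"
  using coset_join3[OF H_carrier H] by auto

text \<open>The quotient of \<open>A\<close> by \<open>I\<close> is cyclic, hence abelian, so
  conjugation preserves each coset of \<open>I\<close>. The computation carries this out on
  representatives.\<close>

lemma coset_conj:
  assumes "s \<in> carrier A" "a \<in> carrier A"
  shows "inv a \<otimes> s \<otimes> a \<in> s <# I"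
proof -
  obtain n i where i: "i \<in> I" "s = \<phi> [^] (n::nat) \<otimes> i" using cyclic assms by blast
  obtain m j where j: "j \<in> I" "a = \<phi> [^] (m::nat) \<otimes> j" using cyclic assms by blast
  have c: "i \<in> carrier A" "j \<in> carrier A" using i j I_carrier by auto
  let ?p = "\<phi> [^] n" and ?q = "\<phi> [^] m"
  have pq: "?p \<in> carrier A" "?q \<in> carrier A" using \<phi>_carrier by auto
  have comm: "?q \<otimes> ?p = ?p \<otimes> ?q" using \<phi>_carrier by (simp add: nat_pow_mult add.commute)
  let ?u = "inv j \<otimes> (inv ?q \<otimes> i \<otimes> ?q) \<otimes> j"
  have u: "?u \<in> I"
    using normal_conj_closed[OF I normal_conj_closed[OF I i(1) pq(2)] c(2)] .
  have comm': "inv ?q \<otimes> ?p = ?p \<otimes> inv ?q"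
    using comm pq by (metis inv_closed inv_solve_left inv_solve_right m_assoc m_closed)
  have "inv ?q \<otimes> (?p \<otimes> x) = ?p \<otimes> (inv ?q \<otimes> x)" if "x \<in> carrier A" for x
    using comm' that pq by (simp add: m_assoc[symmetric])
  then have "inv a \<otimes> s \<otimes> a = inv j \<otimes> ?p \<otimes> (inv ?q \<otimes> i \<otimes> ?q) \<otimes> j"
    unfolding i(2) j(2) using c pq by (simp add: word_simps)
  also have "\<dots> = ?p \<otimes> ((inv ?p \<otimes> inv j \<otimes> ?p) \<otimes> (inv ?q \<otimes> i \<otimes> ?q) \<otimes> j)"
    using c pq by (simp add: word_simps)
  also have "\<dots> = s \<otimes> (inv i \<otimes> ((inv ?p \<otimes> inv j \<otimes> ?p) \<otimes> (inv ?q \<otimes> i \<otimes> ?q) \<otimes> j))"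
    unfolding i(2) using c pq by (simp add: word_simps)
  finally have "inv a \<otimes> s \<otimes> a =
    s \<otimes> (inv i \<otimes> ((inv ?p \<otimes> inv j \<otimes> ?p) \<otimes> (inv ?q \<otimes> i \<otimes> ?q) \<otimes> j))" .
  moreover have "inv i \<otimes> ((inv ?p \<otimes> inv j \<otimes> ?p) \<otimes> (inv ?q \<otimes> i \<otimes> ?q) \<otimes> j) \<in> I"
    using i j pq
    by (intro subgroup.m_closed[OF I_sub] subgroup.m_inv_closed[OF I_sub] normal_conj_closed[OF I])
  ultimately show ?thesis unfolding l_coset_def by blast
qed

text \<open>Powers of \<open>\<phi>\<close> represent all cosets of \<open>I\<close> and lie in
  \<open>H\<close>; in other words, \<open>A\<close> is the product of \<open>H\<close> and
  \<open>I\<close>.\<close>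

lemma coset_meets_H:
  assumes "s \<in> carrier A"
  obtains h where "h \<in> H" "h \<in> s <# I"
proof -
  obtain n i where i: "i \<in> I" "s = \<phi> [^] (n::nat) \<otimes> i" using cyclic assms by blast
  have "\<phi> [^] n \<in> H" using subgroup_nat_pow_closed[OF H \<phi>] .
  moreover have "\<phi> [^] n = s \<otimes> inv i" using i \<phi>_carrier I_carrier by (simp add: m_assoc)
  then have "\<phi> [^] n \<in> s <# I" using i I_sub by (auto simp: l_coset_def subgroup.m_inv_closed)
  ultimately show ?thesis using that by blast
qed

text \<open>Transitivity of \<open>I\<close> on \<open>S\<close>, from the product decomposition of
  \<open>A\<close>. Choosing \<open>h\<close> in the coset of \<open>inv t\<close> gives
  \<open>i = t \<otimes> h\<close>, with the factor from \<open>I\<close> on the correct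
  side.\<close>

lemma S_I_E:
  assumes "c \<in> S" obtains i where "i \<in> I" "c = i <# H"
proof -
  obtain t where t: "t \<in> carrier A" "c = t <# H" using assms by (elim S_E)
  obtain h where h: "h \<in> H" "h \<in> inv t <# I" using coset_meets_H[of "inv t"] t by auto
  obtain i where i: "i \<in> I" "h = inv t \<otimes> i" using h unfolding l_coset_def by auto
  have "i <# H = t <# H" using coset_eq_iff[of i t] i t h I_carrier by simp
  then show ?thesis using that i t by simp
qed

text \<open>For \<open>c = i <# H\<close>, an element fixes \<open>c\<close> exactly when its
  conjugate by \<open>i\<close> lies in \<open>H\<close>, and that conjugate stays in the same coset
  of \<open>I\<close>. So the stabilizer within \<open>s <# I\<close> has the size of
  \<open>H \<inter> (s <# I)\<close>, a translate of \<open>I \<inter> H\<close>, and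
  \<open>I \<inter> c\<close> is another such translate.\<close>

lemma card_stab_coset:
  assumes s: "s \<in> carrier A" and c: "c \<in> S"
  shows "card {x \<in> s <# I. x <# c = c} = card (I \<inter> c)"
proof -
  obtain i where i: "i \<in> I" "c = i <# H" using S_I_E[OF c] .
  obtain h where h: "h \<in> H" "h \<in> s <# I" using coset_meets_H[OF s] .
  have ic: "i \<in> carrier A" using i I_carrier by auto
  have hc: "h \<in> carrier A" using h H_carrier by auto
  have coset: "s <# I = h <# I" using l_repr_independence[OF h(2) s I_sub] .
  \<comment> \<open>As \<open>y\<close> runs through \<open>I \<inter> c\<close>,
    \<open>inv i \<otimes> y\<close> runs through \<open>I \<inter> H\<close> and its product with
    \<open>h\<close> through \<open>H \<inter> (s <# I)\<close>; conjugation by \<open>i\<close>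
    carries this onto the stabilizer of \<open>c\<close>.\<close>
  let ?f = "\<lambda>y. i \<otimes> h \<otimes> inv i \<otimes> y \<otimes> inv i"
  have "{x \<in> s <# I. x <# c = c} = ?f ` (I \<inter> c)"
  proof (intro subset_antisym subsetI)
    fix x assume "x \<in> {x \<in> s <# I. x <# c = c}"
    then have x: "x \<in> h <# I" "x <# (i <# H) = i <# H" using i coset by auto
    have xc: "x \<in> carrier A" using x(1) hc I_carrier unfolding l_coset_def by auto
    have 1: "inv i \<otimes> x \<otimes> i \<in> H" using x(2) fix_iff[OF xc ic] by simp
    let ?y = "i \<otimes> (inv h \<otimes> (inv i \<otimes> x \<otimes> i))"
    have "inv i \<otimes> x \<otimes> i \<in> x <# I" using coset_conj[OF xc ic] .
    moreover have "x <# I = h <# I" using l_repr_independence[OF x(1) hc I_sub] by simp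
    ultimately have "inv h \<otimes> (inv i \<otimes> x \<otimes> i) \<in> I"
      using subgroup.lcos_module_imp[OF I_sub group_axioms hc] by simp
    then have "?y \<in> I" using i I_sub subgroup.m_closed by metis
    moreover have "?y \<in> c" unfolding i(2) l_coset_def
      using 1 h H by (auto intro: subgroup.m_closed subgroup.m_inv_closed)
    moreover have "x = ?f ?y" using xc ic hc by (simp add: word_simps)
    ultimately show "x \<in> ?f ` (I \<inter> c)" by blast
  next
    fix x assume "x \<in> ?f ` (I \<inter> c)"
    then obtain y where y: "y \<in> I" "y \<in> c" "x = ?f y" by auto
    have yc: "y \<in> carrier A" using y I_carrier by auto
    have xc: "x \<in> carrier A" using y(3) yc ic hc by simp
    have 1: "inv i \<otimes> y \<in> H"
      using y(2) i subgroup.lcos_module_imp[OF H group_axioms ic] by simp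
    have "inv i \<otimes> x \<otimes> i = h \<otimes> (inv i \<otimes> y)"
      unfolding y(3) using ic hc yc by (simp add: word_simps)
    then have "x <# c = c" using 1 h H fix_iff[OF xc ic] i by (simp add: subgroup.m_closed)
    moreover have "x = h \<otimes> ((inv h \<otimes> i \<otimes> h) \<otimes> inv i \<otimes> y \<otimes> inv i)"
      unfolding y(3) using ic hc yc by (simp add: word_simps)
    then have "x \<in> h <# I"
      unfolding l_coset_def using normal_conj_closed[OF I i(1) hc] i y
      by (auto intro!: subgroup.m_closed[OF I_sub] subgroup.m_inv_closed[OF I_sub])
    ultimately show "x \<in> {x \<in> s <# I. x <# c = c}" using coset by simp
  qed
  moreover have "inj_on ?f (I \<inter> c)"
    using ic hc I_carrier by (intro inj_onI) (auto simp: m_assoc)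
  ultimately show ?thesis by (simp add: card_image)
qed

lemma finite_S: "finite S"
  unfolding LCOSETS_def using finite_carrier by auto

text \<open>The pairs of an element of the coset and a point it fixes are counted twice, as in
  Burnside's lemma but over a single coset of \<open>I\<close>.\<close>

lemma sum_card_Fix:
  assumes "s \<in> carrier A"
  shows "(\<Sum>x \<in> s <# I. card (Fix x)) = card (s <# I)"
proof -
  have fin: "finite (s <# I)" "finite I"
    using finite_carrier I_carrier assms by (auto simp: l_coset_def intro: finite_subset)
  have inj: "inj_on ((\<otimes>) s) I" using I_carrier assms by (auto intro: inj_onI)
  have im: "s <# I = (\<otimes>) s ` I" by (auto simp: l_coset_def)
  have "(\<Sum>x \<in> s <# I. card (Fix x)) = (\<Sum>x \<in> s <# I. \<Sum>c\<in>S. if x <# c = c then 1 else 0)"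
    unfolding invariants_def using finite_S
    by (intro sum.cong refl) (simp add: sum.If_cases Int_def)
  also have "\<dots> = (\<Sum>c\<in>S. \<Sum>x \<in> s <# I. if x <# c = c then 1 else 0)"
    by (rule sum.swap)
  also have "\<dots> = (\<Sum>c\<in>S. card (I \<inter> c))"
    using fin card_stab_coset[OF assms, symmetric]
    by (intro sum.cong refl) (simp add: sum.If_cases Int_def)
  also have "\<dots> = card (\<Union>c\<in>S. I \<inter> c)"
    using lcos_disjoint[OF H] finite_S fin by (intro card_UN_disjoint[symmetric]) auto
  also have "(\<Union>c\<in>S. I \<inter> c) = I"
    using lcosets_part_G[OF H] I_carrier by blast
  finally show ?thesis using inj im by (simp add: card_image)
qed

text \<open>Natural numbers of mean 1 that are all at least 1, or all at most 1, are all equal to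
  1.\<close>

lemma coset_fixed_points:
  assumes "s \<in> carrier A"
  shows "(\<forall>x \<in> s <# I. \<exists>c. c \<in> Fix x) \<longleftrightarrow> (\<forall>x \<in> s <# I. \<exists>\<^sub>\<le>\<^sub>1c. c \<in> Fix x)"
proof -
  have fin: "finite (s <# I)"
    using finite_carrier I_carrier assms by (auto simp: l_coset_def intro: finite_subset)
  have finF: "finite (Fix x)" for x unfolding invariants_def using finite_S by auto
  have ex: "(\<exists>c. c \<in> Fix x) \<longleftrightarrow> 1 \<le> card (Fix x)" for x
    using finF[of x] by (auto simp: Suc_le_eq card_gt_0_iff)
  have uq: "(\<exists>\<^sub>\<le>\<^sub>1c. c \<in> Fix x) \<longleftrightarrow> card (Fix x) \<le> 1" for x
    unfolding Uniq_def using card_le_Suc0_iff_eq[OF finF[of x]] by auto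
  have sum: "(\<Sum>x \<in> s <# I. card (Fix x)) = (\<Sum>x \<in> s <# I. 1)"
    using sum_card_Fix[OF assms] by simp
  have "card (Fix x) = 1" if "\<forall>x \<in> s <# I. 1 \<le> card (Fix x)" "x \<in> s <# I" for x
    using sum_mono_inv[of "\<lambda>_. 1" "s <# I" "\<lambda>x. card (Fix x)" x] that sum fin by simp
  moreover have "card (Fix x) = 1" if "\<forall>x \<in> s <# I. card (Fix x) \<le> 1" "x \<in> s <# I" for x
    using sum_mono_inv[of "\<lambda>x. card (Fix x)" "s <# I" "\<lambda>_. 1" x] that sum fin by simp
  ultimately show ?thesis unfolding ex uq by (metis order_refl)
qed

section \<open>Generators modulo \<open>I\<close> and the equivalent forms of uniqueness over the
  Frobenius coset\<close>

definition "generates s \<longleftrightarrow> carrier A = generate A (I \<union> {s})"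

lemma F_carrier: "s \<in> F \<Longrightarrow> s \<in> carrier A"
  unfolding l_coset_def using \<phi>_carrier I_carrier by auto

lemma mem_coset_carrier: "s \<in> carrier A \<Longrightarrow> x \<in> s <# I \<Longrightarrow> x \<in> carrier A"
  unfolding l_coset_def using I_carrier by auto

text \<open>Both sides say that the class of \<open>s\<close> generates the quotient by
  \<open>I\<close>: that quotient is generated by the class of \<open>\<phi>\<close>, and being
  finite it needs only natural exponents.\<close>

lemma generates_iff:
  assumes s: "s \<in> carrier A"
  shows "generates s \<longleftrightarrow> (\<exists>n::nat. s [^] n \<in> F)"
proof
  assume "generates s"
  then have "\<phi> \<in> generate A (I \<union> {s})" using \<phi>_carrier unfolding generates_def by simp
  moreover have zero: "s [^] (0::nat) <# I = I"
    using lcos_mult_one[OF subgroup.subset[OF I_sub]] by simp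
  have "x \<in> carrier A \<and> (\<exists>n::nat. x \<in> s [^] n <# I)" if "x \<in> generate A (I \<union> {s})" for x
    using that
  proof (induction rule: generate.induct)
    case one
    then show ?case using subgroup.one_closed[OF I_sub] zero one_closed by blast
  next
    case (incl h)
    show ?case
    proof (cases "h = s")
      case True
      then show ?thesis using s lcos_self[OF s I_sub] by (auto intro!: exI[of _ "1::nat"])
    next
      case False
      then show ?thesis using incl I_carrier zero by blast
    qed
  next
    case (inv h)
    have h: "h \<in> carrier A" using inv I_carrier s by auto
    show ?case
    proof (cases "h = s")
      case True
      \<comment> \<open>Finiteness of \<open>A\<close> turns the inverse of \<open>s\<close> into a
        power with natural exponent.\<close>
      have "s [^] (ord s - 1) \<otimes> s = \<one>"
        using ord_ge_1[OF finite_carrier s] pow_ord_eq_1[OF s]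
        by (metis Suc_diff_le diff_Suc_1 nat_pow_Suc One_nat_def)
      then have "inv s = s [^] (ord s - 1)" using s by (metis inv_equality nat_pow_closed)
      moreover have "s [^] (ord s - 1) \<in> s [^] (ord s - 1) <# I" using s lcos_self[OF _ I_sub] by simp
      ultimately show ?thesis using True h by (metis inv_closed)
    next
      case False
      then have "inv h \<in> I" using inv subgroup.m_inv_closed[OF I_sub] by auto
      then show ?thesis using I_carrier zero by blast
    qed
  next
    case (eng x y)
    then obtain n m i j where "i \<in> I" "j \<in> I" and xy: "x = s [^] (n::nat) \<otimes> i" "y = s [^] (m::nat) \<otimes> j"
      unfolding l_coset_def by blast
    let ?q = "s [^] m"
    have c: "i \<in> carrier A" "j \<in> carrier A" "?q \<in> carrier A" using \<open>i \<in> I\<close> \<open>j \<in> I\<close> I_carrier s by auto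
    have "x \<otimes> y = (s [^] n \<otimes> ?q) \<otimes> ((inv ?q \<otimes> i \<otimes> ?q) \<otimes> j)"
      unfolding xy using c s by (simp add: word_simps)
    also have "s [^] n \<otimes> ?q = s [^] (n + m)" using s by (simp add: nat_pow_mult)
    finally have "x \<otimes> y \<in> s [^] (n + m) <# I"
      unfolding l_coset_def using normal_conj_closed[OF I \<open>i \<in> I\<close> c(3)] \<open>j \<in> I\<close> subgroup.m_closed[OF I_sub] by auto
    then show ?case using eng by auto
  qed
  ultimately obtain n :: nat where "\<phi> \<in> s [^] n <# I" by blast
  then have "s [^] n \<in> F" using l_coset_swap[OF _ _ I_sub] s by simp
  then show "\<exists>n::nat. s [^] n \<in> F" by blast
next
  assume "\<exists>n::nat. s [^] n \<in> F"
  then obtain n :: nat where n: "s [^] n \<in> F" ..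
  let ?G = "generate A (I \<union> {s})"
  have sub: "subgroup ?G A" using I_carrier s by (intro generate_is_subgroup) auto
  have incl: "I \<subseteq> ?G" "s \<in> ?G" by (auto intro: generate.incl)
  have pow: "x [^] (k::nat) \<in> ?G" if "x \<in> ?G" for x k
    using subgroup_nat_pow_closed[OF sub that] .
  obtain i where i: "i \<in> I" "s [^] n = \<phi> \<otimes> i" using n unfolding l_coset_def by auto
  then have "\<phi> = s [^] n \<otimes> inv i" using s I_carrier \<phi>_carrier by (simp add: m_assoc)
  moreover have "s [^] n \<otimes> inv i \<in> ?G"
    using pow[OF incl(2)] i incl(1)
    by (intro subgroup.m_closed[OF sub] subgroup.m_inv_closed[OF sub]) blast+
  ultimately have "\<phi> \<in> ?G" by simp
  then have "a \<in> ?G" if "a \<in> carrier A" for a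
    using cyclic[OF that] incl(1) pow subgroup.m_closed[OF sub] by blast
  then show "generates s" unfolding generates_def using subgroup.subset[OF sub] by blast
qed

lemma F_generates: "s \<in> F \<Longrightarrow> generates s"
  using generates_iff[OF F_carrier] F_carrier nat_pow_eone by metis

lemma pow_fixes:
  assumes "s \<in> carrier A" "c \<in> Fix s"
  shows "c \<in> Fix (s [^] (n::nat))"
proof (induction n)
  case 0
  then show ?case using assms S_sub lcos_mult_one unfolding invariants_def by auto
next
  case (Suc n)
  have "c \<in> S" "s <# c = c" "s [^] n <# c = c" using assms Suc unfolding invariants_def by auto
  then show ?case
    using assms lcos_m_assoc[OF S_sub, of c "s [^] n" s] unfolding invariants_def by simp
qed

text \<open>The hub of the equivalences. "At most one" is the primary form because it descends from
  a power of \<open>s\<close> to \<open>s\<close>: whatever \<open>s\<close> fixes, its powers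
  fix.\<close>

definition "frob_unique \<longleftrightarrow> (\<forall>s \<in> F. \<exists>\<^sub>\<le>\<^sub>1c. c \<in> Fix s)"

text \<open>Generating modulo \<open>I\<close> depends only on the coset of \<open>I\<close>; the
  fixed point count can therefore be applied to the whole coset of any generator, not only to
  \<open>F\<close>.\<close>

lemma generator_coset:
  assumes "generates s" "s \<in> carrier A" "x \<in> s <# I"
  shows "generates x"
proof -
  obtain i where i: "i \<in> I" "x = s \<otimes> i" using assms unfolding l_coset_def by auto
  obtain n :: nat where "s [^] n \<in> F" using assms generates_iff by blast
  then obtain k where k: "k \<in> I" "s [^] n = \<phi> \<otimes> k" unfolding l_coset_def by auto
  obtain j where j: "j \<in> I" "x [^] n = s [^] n \<otimes> j" using normal_pow_mult[OF I assms(2) i(1)] i by blast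
  have "x [^] n = \<phi> \<otimes> (k \<otimes> j)" unfolding j(2) k(2) using k j I_carrier \<phi>_carrier by (simp add: m_assoc)
  then have "x [^] n \<in> F" using k j subgroup.m_closed[OF I_sub] unfolding l_coset_def by auto
  then show ?thesis using generates_iff[OF mem_coset_carrier[OF assms(2,3)]] by blast
qed

lemma frob_unique_generates:
  "frob_unique \<longleftrightarrow> (\<forall>s \<in> carrier A. generates s \<longrightarrow> (\<exists>\<^sub>\<le>\<^sub>1c. c \<in> Fix s))"
proof
  assume fu: frob_unique
  show "\<forall>s \<in> carrier A. generates s \<longrightarrow> (\<exists>\<^sub>\<le>\<^sub>1c. c \<in> Fix s)"
  proof (intro ballI impI)
    fix s assume s: "s \<in> carrier A" "generates s"
    then obtain n :: nat where "s [^] n \<in> F" using generates_iff by blast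
    then have "\<exists>\<^sub>\<le>\<^sub>1c. c \<in> Fix (s [^] n)" using fu unfolding frob_unique_def by blast
    then show "\<exists>\<^sub>\<le>\<^sub>1c. c \<in> Fix s" using pow_fixes[OF s(1)] unfolding Uniq_def by blast
  qed
qed (auto simp: frob_unique_def F_carrier F_generates)

lemma frob_unique_ex: "frob_unique \<longleftrightarrow> (\<forall>s \<in> F. \<exists>c. c \<in> Fix s)"
  unfolding frob_unique_def using coset_fixed_points[OF \<phi>_carrier] by simp

lemma frob_unique_ex1: "frob_unique \<longleftrightarrow> (\<forall>s \<in> F. \<exists>!c. c \<in> Fix s)"
  using frob_unique_ex frob_unique_def unfolding Uniq_def by (metis)

text \<open>Existence of a fixed point does not pass from a power of \<open>s\<close> back to
  \<open>s\<close>. Uniqueness does, and it holds on all of \<open>s <# I\<close>; the count over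
  that coset then yields existence.\<close>

lemma frob_unique_generates_ex:
  "frob_unique \<longleftrightarrow> (\<forall>s \<in> carrier A. generates s \<longrightarrow> (\<exists>c. c \<in> Fix s))"
proof
  assume frob_unique
  then have "\<exists>\<^sub>\<le>\<^sub>1c. c \<in> Fix x" if "s \<in> carrier A" "generates s" "x \<in> s <# I" for s x
    using that frob_unique_generates generator_coset mem_coset_carrier by blast
  then show "\<forall>s \<in> carrier A. generates s \<longrightarrow> (\<exists>c. c \<in> Fix s)"
    using coset_fixed_points lcos_self[OF _ I_sub] by blast
qed (auto simp: frob_unique_ex F_carrier F_generates)

lemma frob_unique_generates_ex1:
  "frob_unique \<longleftrightarrow> (\<forall>s \<in> carrier A. generates s \<longrightarrow> (\<exists>!c. c \<in> Fix s))"
  using frob_unique_generates frob_unique_generates_ex unfolding Uniq_def by metis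

text \<open>If \<open>s\<close> in \<open>F\<close> fixes two cosets, conjugation moves the first to
  \<open>H\<close> and \<open>s\<close> to an element of \<open>H\<close>, which is still in
  \<open>F\<close> because conjugation preserves cosets of \<open>I\<close>.\<close>

lemma frob_unique_H:
  "frob_unique \<longleftrightarrow> (\<forall>s \<in> F \<inter> H. \<forall>c \<in> Fix s. c = H)"
proof
  show "\<forall>s \<in> F \<inter> H. \<forall>c \<in> Fix s. c = H" if frob_unique
    using that H_in_S H_fixes unfolding frob_unique_def Uniq_def invariants_def by blast
  assume *: "\<forall>s \<in> F \<inter> H. \<forall>c \<in> Fix s. c = H"
  show frob_unique unfolding frob_unique_def Uniq_def
  proof (intro ballI allI impI)
    fix s c d assume s: "s \<in> F" and c: "c \<in> Fix s" and d: "d \<in> Fix s"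
    obtain t where t: "t \<in> carrier A" "c = t <# H" using c S_E unfolding invariants_def by blast
    obtain u where u: "u \<in> carrier A" "d = u <# H" using d S_E unfolding invariants_def by blast
    have sc: "s \<in> carrier A" using s F_carrier by auto
    let ?s = "inv t \<otimes> s \<otimes> t"
    have 1: "?s \<in> H" using fix_iff[OF sc t(1)] c t unfolding invariants_def by simp
    have "?s \<in> s <# I" using coset_conj[OF sc t(1)] .
    then have 2: "?s \<in> F" using l_repr_independence[OF s \<phi>_carrier I_sub] by simp
    have dS: "d \<in> S" "s <# d = d" using d unfolding invariants_def by auto
    have "?s <# (inv t <# d) = (?s \<otimes> inv t) <# d"
      using sc t lcos_m_assoc[OF S_sub[OF dS(1)]] by simp
    also have "?s \<otimes> inv t = inv t \<otimes> s" using sc t by (simp add: m_assoc)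
    also have "\<dots> <# d = inv t <# d" using dS lcos_m_assoc[OF S_sub[OF dS(1)], of "inv t" s] sc t by simp
    finally have "inv t <# d \<in> Fix ?s"
      unfolding invariants_def using S_closed[OF _ dS(1), of "inv t"] t by simp
    then have "inv t <# d = H" using * 1 2 by blast
    then have "t <# (inv t <# d) = c" using t by simp
    then show "c = d" using lcos_m_assoc[OF S_sub[OF dS(1)], of t "inv t"] t
        lcos_mult_one[OF S_sub[OF dS(1)]] by simp
  qed
qed

lemma H_in_Fix: "s \<in> H \<Longrightarrow> H \<in> Fix s"
  using H_in_S H_fixes unfolding invariants_def by simp

text \<open>The trivial coset is fixed by every element of \<open>H\<close>, so existence is
  automatic there and "at most one" and "exactly one" coincide.\<close>

lemma Fix_H_iff:
  assumes "s \<in> H"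
  shows "(\<exists>\<^sub>\<le>\<^sub>1c. c \<in> Fix s) \<longleftrightarrow> (\<forall>c \<in> Fix s. c = H)"
    and "(\<exists>!c. c \<in> Fix s) \<longleftrightarrow> (\<forall>c \<in> Fix s. c = H)"
  unfolding Uniq_def using H_in_Fix[OF assms] by metis+

lemma frob_unique_H_uniq: "frob_unique \<longleftrightarrow> (\<forall>s \<in> F \<inter> H. \<exists>\<^sub>\<le>\<^sub>1c. c \<in> Fix s)"
  and frob_unique_H_ex1: "frob_unique \<longleftrightarrow> (\<forall>s \<in> F \<inter> H. \<exists>!c. c \<in> Fix s)"
  unfolding frob_unique_H by (simp_all add: Fix_H_iff)

text \<open>\<open>H\<close> modulo \<open>I \<inter> H\<close> embeds into the cyclic quotient of
  \<open>A\<close> by \<open>I\<close>, whose generator is already represented by \<open>s\<close>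
  in \<open>H\<close>.\<close>

lemma cyclic_H:
  assumes "s \<in> F \<inter> H" "h \<in> H"
  shows "\<exists>n::nat. \<exists>i \<in> I \<inter> H. h = s [^] n \<otimes> i"
proof -
  have h: "h \<in> carrier A" and sc: "s \<in> carrier A" using assms H_carrier by auto
  obtain n i where i: "i \<in> I" "h = \<phi> [^] (n::nat) \<otimes> i" using cyclic h by blast
  obtain k where k: "k \<in> I" "s = \<phi> \<otimes> k" using assms unfolding l_coset_def by auto
  obtain j where j: "j \<in> I" "s [^] n = \<phi> [^] n \<otimes> j" using normal_pow_mult[OF I \<phi>_carrier k(1)] k by blast
  have c: "i \<in> carrier A" "j \<in> carrier A" using i j I_carrier by auto
  have eq: "h = s [^] n \<otimes> (inv j \<otimes> i)"
    unfolding i(2) j(2) using c \<phi>_carrier by (simp add: word_simps)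
  have "s [^] n \<in> H" using subgroup_nat_pow_closed[OF H] assms by blast
  moreover have "inv j \<otimes> i = inv (s [^] n) \<otimes> h" unfolding eq using c sc by (simp add: m_assoc[symmetric])
  ultimately have "inv j \<otimes> i \<in> H" using assms H by (simp add: subgroup.m_closed subgroup.m_inv_closed)
  moreover have "inv j \<otimes> i \<in> I" using i j I_sub by (simp add: subgroup.m_closed subgroup.m_inv_closed)
  ultimately show ?thesis using eq by blast
qed

lemma F_Int_H: "s \<in> F \<inter> H \<Longrightarrow> F \<inter> H = s <# (I \<inter> H)"
proof (intro subset_antisym subsetI)
  fix x assume s: "s \<in> F \<inter> H" and x: "x \<in> F \<inter> H"
  then have c: "s \<in> carrier A" "x \<in> carrier A" using H_carrier by auto
  have "s <# I = F" using l_repr_independence[of s \<phi> I] s \<phi>_carrier I_sub by simp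
  then have "inv s \<otimes> x \<in> I" using x subgroup.lcos_module_imp[OF I_sub group_axioms c(1)] by simp
  moreover have "inv s \<otimes> x \<in> H" using s x H by (simp add: subgroup.m_closed subgroup.m_inv_closed)
  moreover have "x = s \<otimes> (inv s \<otimes> x)" using c by (simp add: m_assoc[symmetric])
  ultimately show "x \<in> s <# (I \<inter> H)" unfolding l_coset_def by blast
next
  fix x assume s: "s \<in> F \<inter> H" and x: "x \<in> s <# (I \<inter> H)"
  have "s <# I = F" using l_repr_independence[of s \<phi> I] s \<phi>_carrier I_sub by simp
  then show "x \<in> F \<inter> H" using s x subgroup.m_closed[OF H] unfolding l_coset_def by auto
qed

lemma \<phi>_F: "\<phi> \<in> F \<inter> H" using \<phi> lcos_self[OF \<phi>_carrier I_sub] by simp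

text \<open>Generation is formed inside \<open>A\<close>, so that it can be compared with
  \<open>generates\<close>; for a subgroup containing the generators the ambient group makes no
  difference.\<close>

definition "generates_H s \<longleftrightarrow> H = generate A ((I \<inter> H) \<union> {s})"

lemma F_generates_H:
  assumes "s \<in> F \<inter> H" shows "generates_H s"
proof -
  let ?G = "generate A ((I \<inter> H) \<union> {s})"
  have sub: "subgroup ?G A" using H_carrier assms by (intro generate_is_subgroup) auto
  have incl: "I \<inter> H \<subseteq> ?G" "s \<in> ?G" by (auto intro: generate.incl)
  have pow: "s [^] (k::nat) \<in> ?G" for k
    using subgroup_nat_pow_closed[OF sub incl(2)] .
  have "h \<in> ?G" if "h \<in> H" for h
    using cyclic_H[OF assms that] incl pow subgroup.m_closed[OF sub] by blast
  moreover have "?G \<subseteq> H" using generate_subgroup_incl[OF _ H] assms by auto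
  ultimately show ?thesis unfolding generates_H_def by blast
qed

text \<open>\<open>\<phi>\<close> lies in \<open>H\<close>, hence in the subgroup generated by
  \<open>I\<close> and \<open>s\<close>, and \<open>\<phi>\<close> together with \<open>I\<close>
  generates \<open>A\<close>.\<close>

lemma generates_H_generates:
  assumes "s \<in> H" "generates_H s" shows "generates s"
proof -
  have sub: "subgroup (generate A (I \<union> {s})) A"
    using I_carrier H_carrier assms by (intro generate_is_subgroup) auto
  have "\<phi> \<in> generate A ((I \<inter> H) \<union> {s})" using \<phi> assms unfolding generates_H_def by simp
  moreover have "generate A ((I \<inter> H) \<union> {s}) \<subseteq> generate A (I \<union> {s})"
    by (rule mono_generate) auto
  ultimately have p: "\<phi> \<in> generate A (I \<union> {s})" by blast
  have pow: "\<phi> [^] (k::nat) \<in> generate A (I \<union> {s})" for k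
    using subgroup_nat_pow_closed[OF sub p] .
  have "a \<in> generate A (I \<union> {s})" if "a \<in> carrier A" for a
    using cyclic[OF that] pow subgroup.m_closed[OF sub] generate.incl[of _ "I \<union> {s}" A] by blast
  then show ?thesis unfolding generates_def using subgroup.subset[OF sub] by blast
qed

lemma frob_unique_generates_H:
  "frob_unique \<longleftrightarrow> (\<forall>s \<in> H. generates_H s \<longrightarrow> (\<exists>\<^sub>\<le>\<^sub>1c. c \<in> Fix s))"
proof
  show "\<forall>s \<in> H. generates_H s \<longrightarrow> (\<exists>\<^sub>\<le>\<^sub>1c. c \<in> Fix s)" if frob_unique
    using that generates_H_generates H_carrier unfolding frob_unique_generates by blast
qed (auto simp: frob_unique_H_uniq F_generates_H)

lemma frob_unique_generates_H_ex1:
  "frob_unique \<longleftrightarrow> (\<forall>s \<in> H. generates_H s \<longrightarrow> (\<exists>!c. c \<in> Fix s))"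
  unfolding frob_unique_generates_H by (simp add: Fix_H_iff)

text \<open>A coset \<open>t <# H\<close> fixed by \<open>s\<close> and different from
  \<open>H\<close> is a \<open>t\<close> outside \<open>H\<close> with
  \<open>inv t \<otimes> s \<otimes> t\<close> in \<open>H\<close>. In the application the set on
  the right is the Frobenius set of the field conjugate to L under \<open>t\<close>.\<close>

lemma frob_unique_disjoint:
  "frob_unique \<longleftrightarrow> (\<forall>t \<in> carrier A - H. (F \<inter> H) \<inter> (F \<inter> {s. inv t \<otimes> s \<otimes> t \<in> H}) = {})"
proof -
  have "(\<forall>c \<in> Fix s. c = H) \<longleftrightarrow> (\<forall>t \<in> carrier A - H. inv t \<otimes> s \<otimes> t \<notin> H)" if "s \<in> F \<inter> H" for s
  proof -
    have sc: "s \<in> carrier A" using that H_carrier by auto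
    have H1: "t <# H = H \<longleftrightarrow> t \<in> H" if "t \<in> carrier A" for t
      using lcos_self[OF that H] H_fixes by auto
    have "(\<forall>c \<in> Fix s. c = H) \<longleftrightarrow> (\<forall>t \<in> carrier A. s <# (t <# H) = t <# H \<longrightarrow> t <# H = H)"
      unfolding invariants_def LCOSETS_def by auto
    also have "\<dots> \<longleftrightarrow> (\<forall>t \<in> carrier A. inv t \<otimes> s \<otimes> t \<in> H \<longrightarrow> t \<in> H)"
      using fix_iff[OF sc] H1 by simp
    finally show ?thesis by auto
  qed
  then show ?thesis unfolding frob_unique_H by blast
qed

lemma frob_unique_cover:
  "frob_unique \<longleftrightarrow> F = (\<Union>t \<in> carrier A. F \<inter> {s. inv t \<otimes> s \<otimes> t \<in> H})"
proof -
  have "(\<exists>c. c \<in> Fix s) \<longleftrightarrow> (\<exists>t \<in> carrier A. inv t \<otimes> s \<otimes> t \<in> H)" if "s \<in> F" for s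
  proof -
    have "(\<exists>c. c \<in> Fix s) \<longleftrightarrow> (\<exists>t \<in> carrier A. s <# (t <# H) = t <# H)"
      unfolding invariants_def LCOSETS_def by auto
    then show ?thesis using fix_iff[OF F_carrier[OF that]] by simp
  qed
  then show ?thesis unfolding frob_unique_ex by blast
qed

text \<open>By \<open>joint_orbits_eq\<close> the joint orbits are the \<open>H\<close>-orbits of
  points fixed by some element of \<open>F \<inter> H\<close>. The orbit of the trivial coset is
  always among them, since \<open>\<phi>\<close> fixes it; any further fixed point lies in its own
  orbit and makes it differ from \<open>{H}\<close>.\<close>

lemma frob_unique_orbits:
  "frob_unique \<longleftrightarrow> orbits (A\<lparr>carrier := H\<rparr>) S (l_coset A) \<inter> orbits (A\<lparr>carrier := I \<inter> H\<rparr>) S (l_coset A) = {{H}}"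
proof -
  interpret AH: group "A\<lparr>carrier := H\<rparr>" using subgroup_imp_group[OF H] .
  have pow: "s [^]\<^bsub>A\<lparr>carrier := H\<rparr>\<^esub> (n::nat) = s [^] n" for s n
    by (simp add: nat_pow_def)
  interpret J: joint_orbits "A\<lparr>carrier := H\<rparr>" "I \<inter> H" \<phi> S "(l_coset A)"
  proof (intro joint_orbits.intro joint_orbits_axioms.intro, goal_cases)
    case 2 show ?case
      using normal_restrict_supergroup normal_Int_subgroup[OF H I] by (simp add: Int_commute)
  next
    case 4 then show ?case using cyclic_H[OF \<phi>_F] by (simp add: pow)
  next
    case 6 then show ?case using H_carrier lcos_m_assoc[OF S_sub] by auto
  qed (use AH.group_axioms \<phi> S_closed H_carrier lcos_mult_one[OF S_sub] in auto)
  have "orbits (A\<lparr>carrier := H\<rparr>) S (l_coset A) \<inter> orbits (A\<lparr>carrier := I \<inter> H\<rparr>) S (l_coset A) =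
      {orbit (A\<lparr>carrier := H\<rparr>) (l_coset A) c | c. c \<in> S \<and> (\<exists>s \<in> F \<inter> H. s <# c = c)}" (is "_ = ?O")
    using J.joint_orbits_eq F_Int_H[OF \<phi>_F] by (simp add: l_coset_def)
  moreover have "frob_unique \<longleftrightarrow> ?O = {{H}}"
  proof
    have HH: "orbit (A\<lparr>carrier := H\<rparr>) (l_coset A) H = {H}"
      unfolding orbit_def using H_fixes \<phi> by auto
    assume frob_unique
    then have "c = H" if "c \<in> S" "s \<in> F \<inter> H" "s <# c = c" for c s
      using that unfolding frob_unique_H invariants_def by blast
    moreover have "\<exists>s \<in> F \<inter> H. s <# H = H" using \<phi>_F H_fixes by auto
    ultimately have "c \<in> S \<and> (\<exists>s \<in> F \<inter> H. s <# c = c) \<longleftrightarrow> c = H" for c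
      using H_in_S by metis
    then show "?O = {{H}}" using HH by simp
  next
    assume O: "?O = {{H}}"
    show frob_unique unfolding frob_unique_H
    proof (intro ballI)
      fix s c assume s: "s \<in> F \<inter> H" and "c \<in> Fix s"
      then have c: "c \<in> S" "s <# c = c" unfolding invariants_def by auto
      then have "orbit (A\<lparr>carrier := H\<rparr>) (l_coset A) c \<in> ?O" using s by blast
      then have "orbit (A\<lparr>carrier := H\<rparr>) (l_coset A) c = {H}" using O by blast
      moreover have "s <# c \<in> orbit (A\<lparr>carrier := H\<rparr>) (l_coset A) c" unfolding orbit_def using s by auto
      ultimately show "c = H" using c by simp
    qed
  qed
  ultimately show ?thesis by simp
qed

text \<open>A pair is fixed by \<open>s\<close> exactly when both entries are, so a joint orbit off
  the diagonal amounts to two distinct fixed points of one element of \<open>F\<close>. The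
  diagonal, written \<open>Id_on S\<close>, is a single \<open>A\<close>-orbit by transitivity on
  cosets, and a joint one because \<open>\<phi>\<close> fixes \<open>H\<close>.\<close>

lemma frob_unique_orbits_pairs:
  fixes act2 defines "act2 \<equiv> \<lambda>s (c, d). (s <# c, s <# d)"
  shows "frob_unique \<longleftrightarrow> orbits A (S \<times> S) act2 \<inter> orbits (A\<lparr>carrier := I\<rparr>) (S \<times> S) act2 = {Id_on S}"
proof -
  interpret J: joint_orbits A I \<phi> "S \<times> S" act2
  proof (intro joint_orbits.intro joint_orbits_axioms.intro, goal_cases)
    case 4 then show ?case by (rule cyclic)
  next
    case 6 then show ?case using lcos_m_assoc[OF S_sub] by (auto simp: act2_def)
  qed (use group_axioms I \<phi>_carrier cyclic S_closed lcos_mult_one[OF S_sub] in \<open>auto simp: act2_def\<close>)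
  have "orbits A (S \<times> S) act2 \<inter> orbits (A\<lparr>carrier := I\<rparr>) (S \<times> S) act2 =
      {orbit A act2 x | x. x \<in> S \<times> S \<and> (\<exists>s \<in> F. act2 s x = x)}" (is "_ = ?O")
    using J.joint_orbits_eq .
  moreover have "frob_unique \<longleftrightarrow> ?O = {Id_on S}"
  proof
    have diag: "orbit A act2 (c, c) = Id_on S" if c: "c \<in> S" for c
    proof -
      obtain t where t: "t \<in> carrier A" "c = t <# H" using S_E[OF c] .
      have "\<exists>g \<in> carrier A. d = g <# c" if d: "d \<in> S" for d
      proof -
        obtain u where u: "u \<in> carrier A" "d = u <# H" using S_E[OF d] .
        have "d = (u \<otimes> inv t) <# c" unfolding t(2) u(2)
          using t u by (simp add: lcos_m_assoc subgroup.subset[OF H] m_assoc)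
        then show ?thesis using t u by auto
      qed
      then show ?thesis unfolding orbit_def act2_def Id_on_def using S_closed[OF _ c] by auto
    qed
    assume fu: frob_unique
    then have "c = d" if "c \<in> S" "d \<in> S" "s \<in> F" "s <# c = c" "s <# d = d" for c d s
      using that unfolding frob_unique_def Uniq_def invariants_def by blast
    then have dg: "fst x = snd x" if "x \<in> S \<times> S" "s \<in> F" "act2 s x = x" for x s
      using that unfolding act2_def by (cases x) auto
    have eq: "orbit A act2 x = Id_on S" if x: "x \<in> S \<times> S" "s \<in> F" "act2 s x = x" for x s
    proof -
      have "x = (fst x, fst x)" using dg[OF x] by (metis prod.collapse)
      moreover have "fst x \<in> S" using x(1) by (rule mem_Times_iff[THEN iffD1, THEN conjunct1])
      ultimately show ?thesis using diag by metis
    qed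
    have "?O \<subseteq> {Id_on S}"
    proof
      fix O' assume "O' \<in> ?O"
      then obtain x s where "O' = orbit A act2 x" "x \<in> S \<times> S" "s \<in> F" "act2 s x = x" by auto
      then show "O' \<in> {Id_on S}" using eq by simp
    qed
    moreover have "act2 \<phi> (H, H) = (H, H)" unfolding act2_def using H_fixes[OF \<phi>] by simp
    then have "Id_on S \<in> ?O"
      using diag[OF H_in_S] \<phi>_F H_in_S by (intro CollectI exI[of _ "(H, H)"]) auto
    ultimately show "?O = {Id_on S}" by blast
  next
    assume O: "?O = {Id_on S}"
    show frob_unique unfolding frob_unique_def Uniq_def
    proof (intro ballI allI impI)
      fix s c d assume s: "s \<in> F" and "c \<in> Fix s" "d \<in> Fix s"
      then have cd: "c \<in> S" "d \<in> S" "act2 s (c, d) = (c, d)" unfolding invariants_def act2_def by auto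
      then have "orbit A act2 (c, d) \<in> ?O" using s by blast
      then have "orbit A act2 (c, d) = Id_on S" using O by blast
      moreover have "act2 s (c, d) \<in> orbit A act2 (c, d)" unfolding orbit_def using F_carrier[OF s] by auto
      ultimately have "(c, d) \<in> Id_on S" using cd by simp
      then show "c = d" by auto
    qed
  qed
  ultimately show ?thesis by simp
qed

end

section \<open>Extension of embeddings\<close>

context field
begin

text \<open>Polynomials are coefficient lists with nonzero head. A field homomorphism is injective,
  so applying it to the coefficients keeps the head nonzero and no renormalization interferes with
  sums and products.\<close>

lemma map_poly_hom:
  assumes F: "subfield F R" and \<phi>: "\<phi> \<in> ring_hom (R\<lparr>carrier := F\<rparr>) R"
  shows "map \<phi> \<in> ring_hom (F[X]) (poly_ring R)"
    and "\<And>p. p \<in> carrier (F[X]) \<Longrightarrow> length (map \<phi> p) = length p"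
    and "inj_on \<phi> F"
proof -
  interpret FR: field "R\<lparr>carrier := F\<rparr>" using subfield_iff(2)[OF F] .
  interpret h: ring_hom_ring "R\<lparr>carrier := F\<rparr>" R \<phi>
    using ring_hom_ringI2[OF FR.ring_axioms ring_axioms \<phi>] .
  note sub = subfieldE(1)[OF F]
  show inj: "inj_on \<phi> F"
    using non_trivial_field_hom_is_inj[OF \<phi> FR.field_axioms field_axioms] by simp
  have pol: "polynomial (carrier R) (map \<phi> p)" if "polynomial F p" for p
  proof (cases p)
    case Nil then show ?thesis unfolding polynomial_def by simp
  next
    case (Cons a q)
    then have a: "a \<in> F" "a \<noteq> \<zero>" and q: "set p \<subseteq> F" using that unfolding polynomial_def by auto
    have "\<phi> a \<noteq> \<phi> \<zero>" using inj_onD[OF inj _ a(1)] a(2) subringE(2)[OF sub] by metis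
    moreover have "\<phi> \<zero> = \<zero>" using h.hom_zero by simp
    ultimately show ?thesis using Cons q h.hom_closed unfolding polynomial_def by auto
  qed
  show "map \<phi> \<in> ring_hom (F[X]) (poly_ring R)"
  proof (rule ring_hom_memI)
    fix p assume "p \<in> carrier (F[X])"
    then show "map \<phi> p \<in> carrier (poly_ring R)" using pol unfolding univ_poly_carrier[symmetric] by simp
  next
    fix p q assume "p \<in> carrier (F[X])" "q \<in> carrier (F[X])"
    then have pq: "polynomial F p" "polynomial F q" unfolding univ_poly_carrier[symmetric] .
    then have set: "set p \<subseteq> F" "set q \<subseteq> F" using polynomial_incl by auto
    have "normalize (map \<phi> (poly_mult p q)) = poly_mult (map \<phi> p) (map \<phi> q)"
      using h.poly_mult_hom'[of p q] set poly_mult_consistent[OF sub] by simp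
    moreover have "normalize (map \<phi> (poly_mult p q)) = map \<phi> (poly_mult p q)"
      using normalize_polynomial[OF pol[OF poly_mult_closed[OF sub pq]]] .
    ultimately show "map \<phi> (p \<otimes>\<^bsub>F[X]\<^esub> q) = map \<phi> p \<otimes>\<^bsub>poly_ring R\<^esub> map \<phi> q"
      by (simp add: univ_poly_mult)
    have "normalize (map \<phi> (poly_add p q)) = poly_add (map \<phi> p) (map \<phi> q)"
      using h.poly_add_hom'[of p q] set poly_add_consistent[OF sub] by simp
    moreover have "normalize (map \<phi> (poly_add p q)) = map \<phi> (poly_add p q)"
      using normalize_polynomial[OF pol[OF poly_add_closed[OF sub pq]]] .
    ultimately show "map \<phi> (p \<oplus>\<^bsub>F[X]\<^esub> q) = map \<phi> p \<oplus>\<^bsub>poly_ring R\<^esub> map \<phi> q"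
      by (simp add: univ_poly_add)
  next
    show "map \<phi> \<one>\<^bsub>F[X]\<^esub> = \<one>\<^bsub>poly_ring R\<^esub>" using h.hom_one by (simp add: univ_poly_one)
  qed
  show "\<And>p. p \<in> carrier (F[X]) \<Longrightarrow> length (map \<phi> p) = length p" by simp
qed

text \<open>The simple extension is F[X] modulo the minimal polynomial of \<open>x\<close>. The
  element \<open>eval p x\<close> goes to the value at \<open>y\<close> of the polynomial with the
  coefficients of \<open>p\<close> transported by \<open>\<phi>\<close>.\<close>

lemma extend_to_simple_extension:
  assumes F: "subfield F R" and \<phi>: "\<phi> \<in> ring_hom (R\<lparr>carrier := F\<rparr>) R"
    and x: "x \<in> carrier R" "(algebraic over F) x"
    and y: "y \<in> carrier R" "eval (map \<phi> (Irr F x)) y = \<zero>"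
  shows "\<exists>\<psi> \<in> ring_hom (R\<lparr>carrier := simple_extension F x\<rparr>) R. (\<forall>z\<in>F. \<psi> z = \<phi> z) \<and> \<psi> x = y"
proof -
  note sub = subfieldE(1)[OF F]
  interpret p: ring_hom_ring "R\<lparr>carrier := F\<rparr>" R \<phi>
    using ring_hom_ringI2[OF subring_is_ring[OF sub] ring_axioms \<phi>] .
  define h where "h = (\<lambda>p. eval (map \<phi> p) y)"
  have "h = (\<lambda>p. eval p y) \<circ> map \<phi>" unfolding h_def by auto
  then have "h \<in> ring_hom (F[X]) R"
    using ring_hom_trans[OF map_poly_hom(1)[OF F \<phi>] eval_is_hom[OF carrier_is_subring y(1)]] by simp
  then interpret h: ring_hom_cring "F[X]" R h
    using univ_poly_is_cring[OF sub] cring_axioms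
    by (intro ring_hom_cringI ring_hom_ringI2) (auto simp: cring.axioms)
  interpret e: ring_hom_cring "F[X]" R "\<lambda>p. eval p x" using eval_cring_hom[OF sub x(1)] .
  have wd: "h p = h q"
    if "p \<in> carrier (F[X])" "q \<in> carrier (F[X])" "eval p x = eval q x" for p q
  proof -
    let ?d = "p \<ominus>\<^bsub>F[X]\<^esub> q"
    have d: "?d \<in> carrier (F[X])" using that by simp
    have "eval ?d x = \<zero>" using that by (simp add: e.hom_sub)
    then have "Irr F x divides\<^bsub>F[X]\<^esub> ?d"
      using Irr_minimal[OF F x d] pdivides_iff_shell[OF F IrrE(1)[OF F x] d] by simp
    then obtain s where s: "s \<in> carrier (F[X])" "?d = Irr F x \<otimes>\<^bsub>F[X]\<^esub> s"
      unfolding factor_def by auto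
    have "h (Irr F x) = \<zero>" using y(2) unfolding h_def .
    then have "h ?d = \<zero>" using s IrrE(1)[OF F x] h.hom_closed[OF s(1)] by simp
    moreover have "h ?d = h p \<ominus> h q" using that by (simp add: h.hom_sub)
    ultimately show ?thesis using that h.hom_closed by simp
  qed
  \<comment> \<open>Many \<open>p\<close> represent the same \<open>z\<close>. By \<open>wd\<close>
    the choice does not matter: two of them differ by a multiple of \<open>Irr F x\<close>, which
    \<open>h\<close> sends to \<open>\<zero>\<close>.\<close>
  define \<psi> where "\<psi> z = h (SOME p. p \<in> carrier (F[X]) \<and> eval p x = z)" for z
  have \<psi>: "\<psi> (eval p x) = h p" if "p \<in> carrier (F[X])" for p
  proof -
    have "\<exists>q. q \<in> carrier (F[X]) \<and> eval q x = eval p x" using that by blast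
    from someI_ex[OF this] show ?thesis unfolding \<psi>_def using wd that by blast
  qed
  have img: "simple_extension F x = (\<lambda>p. eval p x) ` carrier (F[X])"
    using simple_extension_as_eval_img[OF subfieldE(3)[OF F] x(1)] .
  have "\<psi> \<in> ring_hom (R\<lparr>carrier := simple_extension F x\<rparr>) R"
  proof (rule ring_hom_memI)
    fix z assume "z \<in> carrier (R\<lparr>carrier := simple_extension F x\<rparr>)"
    then show "\<psi> z \<in> carrier R" using img \<psi> h.hom_closed by auto
  next
    fix z w assume "z \<in> carrier (R\<lparr>carrier := simple_extension F x\<rparr>)"
      "w \<in> carrier (R\<lparr>carrier := simple_extension F x\<rparr>)"
    then obtain p q where p: "p \<in> carrier (F[X])" "z = eval p x"
      and q: "q \<in> carrier (F[X])" "w = eval q x" using img by auto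
    have zw: "z \<otimes> w = eval (p \<otimes>\<^bsub>F[X]\<^esub> q) x" "z \<oplus> w = eval (p \<oplus>\<^bsub>F[X]\<^esub> q) x"
      using p q e.hom_mult e.hom_add by simp_all
    show "\<psi> (z \<otimes>\<^bsub>R\<lparr>carrier := simple_extension F x\<rparr>\<^esub> w) = \<psi> z \<otimes> \<psi> w"
      "\<psi> (z \<oplus>\<^bsub>R\<lparr>carrier := simple_extension F x\<rparr>\<^esub> w) = \<psi> z \<oplus> \<psi> w"
      using p q \<psi>[OF h.R.m_closed[OF p(1) q(1)]] \<psi>[OF h.R.a_closed[OF p(1) q(1)]] \<psi>[OF p(1)] \<psi>[OF q(1)]
      by (simp_all add: zw[symmetric] del: e.hom_mult e.hom_add)
  next
    have "\<psi> (eval \<one>\<^bsub>F[X]\<^esub> x) = h \<one>\<^bsub>F[X]\<^esub>" by (rule \<psi>) simp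
    then show "\<psi> \<one>\<^bsub>R\<lparr>carrier := simple_extension F x\<rparr>\<^esub> = \<one>" using e.hom_one h.hom_one by simp
  qed
  moreover have \<psi>F: "\<psi> z = \<phi> z" if z: "z \<in> F" for z
  \<comment> \<open>The constant polynomial of \<open>\<zero>\<close> is the empty list, whereas
    \<open>[z]\<close> is a polynomial only for nonzero \<open>z\<close>.\<close>
  proof (cases "z = \<zero>")
    case True
    have "\<phi> \<zero> = \<zero>" using p.hom_zero by simp
    moreover have "\<psi> \<zero> = \<zero>" using \<psi>[of "\<zero>\<^bsub>F[X]\<^esub>"] e.hom_zero h.hom_zero by simp
    ultimately show ?thesis using True by simp
  next
    case False
    have "[z] \<in> carrier (F[X])" using z False unfolding univ_poly_carrier[symmetric] polynomial_def by simp
    moreover have "z \<in> carrier R" "\<phi> z \<in> carrier R"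
      using z subfieldE(3)[OF F] ring_hom_memE(1)[OF \<phi>] by auto
    ultimately show ?thesis using \<psi>[of "[z]"] x y unfolding h_def by simp
  qed
  moreover have "\<psi> x = y"
  proof -
    have one: "\<one> \<in> F" "\<zero> \<in> F" using subringE(2,3)[OF sub] by auto
    have X: "X \<in> carrier (F[X])" using var_closed(1)[OF sub] .
    have "\<phi> \<one> = \<one>" "\<phi> \<zero> = \<zero>"
      using p.hom_one p.hom_zero by simp_all
    then have "map \<phi> X = X" unfolding var_def by simp
    then have "h X = y" unfolding h_def using eval_var[OF y(1)] by simp
    then show ?thesis using \<psi>[OF X] eval_var[OF x(1)] by simp
  qed
  ultimately show ?thesis by blast
qed

lemma poly_subset: "F \<subseteq> E \<Longrightarrow> carrier (F[X]) \<subseteq> carrier (E[X])"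
  unfolding univ_poly_def polynomial_def by auto

lemma Irr_not_Nil:
  assumes "subfield F R" "x \<in> carrier R" "(algebraic over F) x"
  shows "Irr F x \<noteq> []" "degree (Irr F x) \<ge> 1"
  using pirreducible_degree[OF assms(1) IrrE(1,2)[OF assms]] by auto

text \<open>\<open>Irr F x\<close> divides \<open>Irr K x\<close>, and \<open>\<phi>\<close> leaves
  the coefficients of the latter alone. So the transported polynomial still divides
  \<open>Irr K x\<close> and inherits its splitting and the bound on its roots.\<close>

lemma map_Irr:
  assumes K: "subfield K R" and F: "subfield F R" "K \<subseteq> F"
    and \<phi>: "\<phi> \<in> ring_hom (R\<lparr>carrier := F\<rparr>) R" "\<And>z. z \<in> K \<Longrightarrow> \<phi> z = z"
    and x: "x \<in> carrier R" "(algebraic over K) x" "splitted (Irr K x)"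
  shows "map \<phi> (Irr F x) \<in> carrier (poly_ring R)"
    and "splitted (map \<phi> (Irr F x))"
    and "roots (map \<phi> (Irr F x)) \<subseteq># roots (Irr K x)"
    and "\<exists>y \<in> carrier R. eval (map \<phi> (Irr F x)) y = \<zero>"
proof -
  have xF: "(algebraic over F) x" using algebraic_mono[OF F(2) x(2)] .
  note I = IrrE[OF K x(1,2)] and J = IrrE[OF F(1) x(1) xF]
  let ?m = "map \<phi> (Irr F x)"
  note hom = map_poly_hom(1)[OF F(1) \<phi>(1)]
  show m: "?m \<in> carrier (poly_ring R)" using ring_hom_memE(1)[OF hom J(1)] .
  have IF: "Irr K x \<in> carrier (F[X])" using poly_subset[OF F(2)] I(1) by auto
  have IR: "Irr K x \<in> carrier (poly_ring R)" using carrier_polynomial_shell[OF subfieldE(1)[OF K] I(1)] .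
  have "Irr F x divides\<^bsub>F[X]\<^esub> Irr K x"
    using Irr_minimal[OF F(1) x(1) xF IF I(4)] pdivides_iff_shell[OF F(1) J(1) IF] by simp
  then obtain s where s: "s \<in> carrier (F[X])" "Irr K x = Irr F x \<otimes>\<^bsub>F[X]\<^esub> s"
    unfolding factor_def by auto
  have "set (Irr K x) \<subseteq> K" using I(1) unfolding univ_poly_carrier[symmetric] polynomial_def by auto
  then have "map \<phi> (Irr K x) = Irr K x" using \<phi>(2) by (intro map_idI) auto
  then have "Irr K x = ?m \<otimes>\<^bsub>poly_ring R\<^esub> map \<phi> s"
    using ring_hom_memE(2)[OF hom J(1) s(1)] s(2) by simp
  then have dvd: "?m pdivides Irr K x"
    using ring_hom_memE(1)[OF hom s(1)] unfolding pdivides_def factor_def by auto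
  show spl: "splitted ?m"
    using pdivides_imp_splitted[OF m IR Irr_not_Nil(1)[OF K x(1,2)] x(3) dvd] .
  show "roots ?m \<subseteq># roots (Irr K x)"
    using pdivides_imp_roots_incl[OF m IR Irr_not_Nil(1)[OF K x(1,2)] dvd] .
  have "size (roots ?m) \<noteq> 0"
    using spl Irr_not_Nil(2)[OF F(1) x(1) xF] unfolding splitted_def by simp
  then have "roots ?m \<noteq> {#}" by auto
  then obtain y where "y \<in># roots ?m" by blast
  then have "is_root ?m y" using roots_mem_iff_is_root[OF m] by simp
  then show "\<exists>y \<in> carrier R. eval ?m y = \<zero>" unfolding is_root_def by auto
qed

lemma extend_to_finite_extension:
  assumes K: "subfield K R" and F: "subfield F R" "K \<subseteq> F"
    and \<phi>: "\<phi> \<in> ring_hom (R\<lparr>carrier := F\<rparr>) R" "\<And>z. z \<in> K \<Longrightarrow> \<phi> z = z"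
    and rs: "\<And>r. r \<in> set rs \<Longrightarrow> r \<in> carrier R \<and> (algebraic over K) r \<and> splitted (Irr K r)"
  shows "\<exists>\<psi> \<in> ring_hom (R\<lparr>carrier := finite_extension F rs\<rparr>) R. \<forall>z\<in>F. \<psi> z = \<phi> z"
  using rs
proof (induction rs)
  case Nil
  then show ?case using \<phi>(1) by auto
next
  case (Cons r rs)
  then obtain \<psi> where \<psi>: "\<psi> \<in> ring_hom (R\<lparr>carrier := finite_extension F rs\<rparr>) R" "\<forall>z\<in>F. \<psi> z = \<phi> z"
    by (metis list.set_intros(2))
  let ?E = "finite_extension F rs"
  have rs: "set rs \<subseteq> carrier R" using Cons.prems by auto
  have alg: "(algebraic over F) s" if "s \<in> set rs" for s
    using algebraic_mono[OF F(2)] Cons.prems that by auto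
  have E: "subfield ?E R" using finite_extension_is_subfield[OF F(1) rs alg] .
  have FE: "F \<subseteq> ?E" using finite_extension_incl[OF subfieldE(3)[OF F(1)] rs] .
  have r: "r \<in> carrier R" "(algebraic over K) r" "splitted (Irr K r)" using Cons.prems by auto
  have KE: "K \<subseteq> ?E" using F(2) FE by auto
  have fixK: "\<psi> z = z" if "z \<in> K" for z using that \<psi>(2) \<phi>(2) F(2) by auto
  obtain y where y: "y \<in> carrier R" "eval (map \<psi> (Irr ?E r)) y = \<zero>"
    using map_Irr(4)[OF K E KE \<psi>(1) fixK r] by blast
  obtain \<chi> where \<chi>: "\<chi> \<in> ring_hom (R\<lparr>carrier := simple_extension ?E r\<rparr>) R" "\<forall>z\<in>?E. \<chi> z = \<psi> z"
    using extend_to_simple_extension[OF E \<psi>(1) r(1) algebraic_mono[OF KE r(2)] y] by blast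
  then have "\<forall>z\<in>F. \<chi> z = \<phi> z" using \<psi>(2) FE by auto
  then show ?case using \<chi>(1) by (intro bexI[of _ \<chi>]) auto
qed

lemma ring_hom_id: "(\<lambda>x. x) \<in> ring_hom (R\<lparr>carrier := F\<rparr>) R" if "F \<subseteq> carrier R"
  using that by (intro ring_hom_memI) auto

text \<open>An irreducible factor over \<open>E\<close> has a root in the large field; that root
  lies in \<open>E\<close>, so the factor is linear.\<close>

lemma splitted_in_subfield:
  assumes E: "subfield E R" and p: "p \<in> carrier (E[X])" "p \<noteq> []" "splitted p"
    and roots: "\<And>a. is_root p a \<Longrightarrow> a \<in> E"
  shows "ring.splitted (R\<lparr>carrier := E\<rparr>) p"
proof -
  note sub = subfieldE(1)[OF E]
  interpret E: field "R\<lparr>carrier := E\<rparr>" using subfield_iff(2)[OF E] .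
  have EX: "univ_poly (R\<lparr>carrier := E\<rparr>) E = E[X]" using univ_poly_consistent[OF sub] by metis
  have pR: "p \<in> carrier (poly_ring R)" using carrier_polynomial_shell[OF sub p(1)] .
  have pE: "p \<in> carrier (poly_ring (R\<lparr>carrier := E\<rparr>))" using p(1) EX by simp
  show ?thesis
  proof (rule E.trivial_factors_imp_splitted[OF pE])
    fix q assume "q \<in> carrier (poly_ring (R\<lparr>carrier := E\<rparr>))"
      and "pirreducible\<^bsub>R\<lparr>carrier := E\<rparr>\<^esub> (carrier (R\<lparr>carrier := E\<rparr>)) q"
      and "q pdivides\<^bsub>R\<lparr>carrier := E\<rparr>\<^esub> p"
    note q' = this
    have q: "q \<in> carrier (E[X])" "pirreducible E q" "q divides\<^bsub>E[X]\<^esub> p"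
      using q' EX unfolding pdivides_def by simp_all
    have qR: "q \<in> carrier (poly_ring R)" using carrier_polynomial_shell[OF sub q(1)] .
    have dvd: "q pdivides p" using pdivides_iff_shell[OF E q(1) p(1)] q(3) by simp
    have spl: "splitted q" using pdivides_imp_splitted[OF qR pR p(2,3) dvd] .
    have deg: "degree q \<ge> 1" using pirreducible_degree[OF E q(1,2)] .
    then have "roots q \<noteq> {#}" using spl unfolding splitted_def by auto
    then obtain a where "a \<in># roots q" by blast
    then have a: "is_root q a" using roots_mem_iff_is_root[OF qR] by simp
    then have "eval p a = \<zero>" using pdivides_imp_root_sharing[OF qR dvd] unfolding is_root_def by simp
    then have "a \<in> E" using roots a p(2) unfolding is_root_def by simp
    then have "E.is_root q a"
      using a eval_consistent[OF sub] unfolding is_root_def E.is_root_def by simp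
    then have "E.roots q \<noteq> {#}" using E.roots_mem_iff_is_root[OF q'(1), of a] by auto
    then have "degree q = 1" using E.pirreducible_roots[OF q'(1,2)] by blast
    then show "degree q \<le> 1" by simp
  qed
qed

end

section \<open>Finite Galois extensions\<close>

lemma galois_group_iff:
  "\<sigma> \<in> carrier (galois_group N M) \<longleftrightarrow>
    \<sigma> \<in> ring_hom N N \<and> bij_betw \<sigma> (carrier N) (carrier N) \<and> \<sigma> \<in> extensional (carrier N) \<and>
    (\<forall>x\<in>M. \<sigma> x = x)"
  unfolding galois_group_def ring_iso_def Bij_def by auto

lemma galois_group_mono: "M \<subseteq> E \<Longrightarrow> carrier (galois_group N E) \<subseteq> carrier (galois_group N M)"
  unfolding galois_group_iff subset_iff by blast

lemma galois_group_eqI: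
  assumes "\<sigma> \<in> carrier (galois_group N M)" "\<tau> \<in> carrier (galois_group N M)"
    and "\<And>x. x \<in> carrier N \<Longrightarrow> \<sigma> x = \<tau> x"
  shows "\<sigma> = \<tau>"
  using assms extensionalityI unfolding galois_group_iff by blast

lemma size_eq_card_set_mset:
  assumes "\<And>a. count M a \<le> 1"
  shows "size M = card (set_mset M)"
proof -
  have "count M a = 1" if "a \<in># M" for a
    using assms[of a] that by (simp add: le_antisym Suc_leI count_greater_zero_iff)
  then show ?thesis unfolding size_multiset_overloaded_eq by simp
qed

lemma (in field) card_roots_le:
  assumes "p \<in> carrier (poly_ring R)" "p \<noteq> []"
  shows "finite {y. is_root p y}" "card {y. is_root p y} \<le> degree p"
proof -
  have eq: "{y. is_root p y} = set_mset (roots p)"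
    using roots_mem_iff_is_root[OF assms(1)] by auto
  then show "finite {y. is_root p y}" by simp
  have "card (set_mset (roots p)) \<le> size (roots p)"
    using sum_mono[of "set_mset (roots p)" "\<lambda>_. 1" "count (roots p)"]
    unfolding size_multiset_overloaded_eq by (simp add: Suc_le_eq)
  then show "card {y. is_root p y} \<le> degree p"
    using size_roots_le_degree[OF assms(1)] eq by simp
qed

text \<open>A finite Galois extension given by a list of generators. Normality is asked of all
  elements, separability of the generators, in the form used by the induction that adjoins them one
  at a time.\<close>

locale galois_ext = field R for R (structure) +
  fixes K rs
  assumes K: "subfield K R"
    and rs: "set rs \<subseteq> carrier R" "finite_extension K rs = carrier R"
    and splits: "\<And>x. x \<in> carrier R \<Longrightarrow> (algebraic over K) x \<and> splitted (Irr K x)"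
    and separable: "\<And>r a. r \<in> set rs \<Longrightarrow> a \<in> carrier R \<Longrightarrow> alg_mult (Irr K r) a \<le> 1"
begin

abbreviation "Gal M \<equiv> carrier (galois_group R M)"

lemma GalD:
  assumes "\<sigma> \<in> Gal M"
  shows "\<sigma> \<in> ring_hom R R" "bij_betw \<sigma> (carrier R) (carrier R)" "\<And>x. x \<in> M \<Longrightarrow> \<sigma> x = x"
    and "\<sigma> \<in> extensional (carrier R)"
  using assms unfolding galois_group_iff by auto

lemma Gal_hom: "\<sigma> \<in> Gal M \<Longrightarrow> ring_hom_ring R R \<sigma>"
  using ring_hom_ringI2[OF ring_axioms ring_axioms] GalD(1) by blast

lemma Gal_closed: "\<sigma> \<in> Gal M \<Longrightarrow> x \<in> carrier R \<Longrightarrow> \<sigma> x \<in> carrier R"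
  using GalD(1) ring_hom_memE(1) by metis

lemma Gal_inj: "\<sigma> \<in> Gal M \<Longrightarrow> inj_on \<sigma> (carrier R)"
  using GalD(2) bij_betw_def by metis

lemma Gal_eq_iff: "\<sigma> \<in> Gal M \<Longrightarrow> x \<in> carrier R \<Longrightarrow> y \<in> carrier R \<Longrightarrow> \<sigma> x = \<sigma> y \<longleftrightarrow> x = y"
  using Gal_inj inj_on_eq_iff by metis

lemma K_carrier: "K \<subseteq> carrier R" using subfieldE(3)[OF K] .

lemma Gal_root:
  assumes "\<sigma> \<in> Gal M" "p \<in> carrier (M[X])" "M \<subseteq> carrier R" "is_root p x"
  shows "is_root p (\<sigma> x)"
proof -
  interpret h: ring_hom_ring R R \<sigma> using Gal_hom[OF assms(1)] .
  have p: "set p \<subseteq> M" using assms(2) unfolding univ_poly_def polynomial_def by auto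
  have x: "x \<in> carrier R" "eval p x = \<zero>" "p \<noteq> []" using assms(4) unfolding is_root_def by auto
  have "map \<sigma> p = p" using p GalD(3)[OF assms(1)] by (intro map_idI) auto
  then have "eval p (\<sigma> x) = \<sigma> (eval p x)" using h.eval_hom'[OF x(1)] p assms(3) by (metis subset_trans)
  then show ?thesis using x h.hom_closed unfolding is_root_def by simp
qed

text \<open>For surjectivity, \<open>\<phi>\<close> maps the finite root set of
  \<open>Irr K x\<close> injectively into itself, hence onto itself, and \<open>x\<close> belongs to
  it. The restriction makes the map extensional, as membership in the Galois group demands.\<close>

lemma aut_of_embedding:
  assumes \<phi>: "\<phi> \<in> ring_hom R R" "\<And>z. z \<in> K \<Longrightarrow> \<phi> z = z"
  shows "restrict \<phi> (carrier R) \<in> Gal K"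
proof -
  interpret h: ring_hom_ring R R \<phi> using ring_hom_ringI2[OF ring_axioms ring_axioms \<phi>(1)] .
  have inj: "inj_on \<phi> (carrier R)" using non_trivial_field_hom_is_inj[OF \<phi>(1) field_axioms field_axioms] .
  have "x \<in> \<phi> ` carrier R" if x: "x \<in> carrier R" for x
  proof -
    have alg: "(algebraic over K) x" using splits[OF x] by simp
    let ?p = "Irr K x" and ?Z = "{y. is_root (Irr K x) y}"
    have p: "?p \<in> carrier (K[X])" "?p \<noteq> []" "eval ?p x = \<zero>"
      using IrrE[OF K x alg] Irr_not_Nil[OF K x alg] by auto
    have set: "set ?p \<subseteq> K" using p(1) unfolding univ_poly_def polynomial_def by auto
    have "map \<phi> ?p = ?p" using set \<phi>(2) by (intro map_idI) auto
    then have "\<phi> ` ?Z \<subseteq> ?Z"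
      using h.eval_hom'[of _ ?p] set K_carrier unfolding is_root_def by fastforce
    moreover have "finite ?Z"
      using finite_number_of_roots carrier_polynomial_shell[OF subfieldE(1)[OF K] p(1)] by auto
    moreover have "inj_on \<phi> ?Z" using inj unfolding is_root_def by (auto intro: inj_on_subset)
    ultimately have "\<phi> ` ?Z = ?Z" by (intro endo_inj_surj) auto
    moreover have "x \<in> ?Z" using p x unfolding is_root_def by auto
    ultimately show ?thesis unfolding is_root_def by auto
  qed
  then have "bij_betw \<phi> (carrier R) (carrier R)" using inj h.hom_closed unfolding bij_betw_def by auto
  then have "bij_betw (restrict \<phi> (carrier R)) (carrier R) (carrier R)"
    using bij_betw_cong[of "carrier R" "restrict \<phi> (carrier R)" \<phi>] by simp
  moreover have "restrict \<phi> (carrier R) \<in> ring_hom R R"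
    using ring_hom_restrict[OF \<phi>(1), of "restrict \<phi> (carrier R)"] by simp
  ultimately show ?thesis unfolding galois_group_iff using \<phi>(2) K_carrier by auto
qed

lemma extend_to_aut:
  assumes M: "subfield M R" "K \<subseteq> M"
    and \<phi>: "\<phi> \<in> ring_hom (R\<lparr>carrier := M\<rparr>) R" "\<And>z. z \<in> K \<Longrightarrow> \<phi> z = z"
  shows "\<exists>\<sigma> \<in> Gal K. \<forall>z\<in>M. \<sigma> z = \<phi> z"
proof -
  have "finite_extension M rs = carrier R"
    using mono_finite_extension[OF M(2)] rs finite_extension_in_carrier[OF subfieldE(3)[OF M(1)] rs(1)]
    by blast
  moreover have "R\<lparr>carrier := carrier R\<rparr> = R" by simp
  ultimately obtain \<psi> where \<psi>: "\<psi> \<in> ring_hom R R" "\<forall>z\<in>M. \<psi> z = \<phi> z"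
    using extend_to_finite_extension[OF K M \<phi>, of rs] splits rs(1) by (auto simp: subset_iff)
  have "\<psi> z = z" if "z \<in> K" for z using that \<psi>(2) \<phi>(2) M(2) by (metis subsetD)
  then have "restrict \<psi> (carrier R) \<in> Gal K" by (rule aut_of_embedding[OF \<psi>(1)])
  moreover have "\<forall>z\<in>M. restrict \<psi> (carrier R) z = \<phi> z" using \<psi>(2) subfieldE(3)[OF M(1)] by auto
  ultimately show ?thesis by blast
qed

text \<open>The identity of \<open>M\<close> extends to the simple extension with \<open>x\<close>
  sent to \<open>y\<close>, and from there to the whole field by normality over
  \<open>K\<close>.\<close>

lemma conjugate_root:
  assumes M: "subfield M R" "K \<subseteq> M" and x: "x \<in> carrier R" and y: "is_root (Irr M x) y"
  shows "\<exists>\<sigma> \<in> Gal M. \<sigma> x = y"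
proof -
  have alg: "(algebraic over M) x" using algebraic_mono[OF M(2)] splits[OF x] by auto
  have "set (Irr M x) \<subseteq> M" using IrrE(1)[OF M(1) x alg] unfolding univ_poly_def polynomial_def by auto
  have y': "y \<in> carrier R" "eval (map (\<lambda>x. x) (Irr M x)) y = \<zero>" using y unfolding is_root_def by auto
  obtain \<psi> where \<psi>: "\<psi> \<in> ring_hom (R\<lparr>carrier := simple_extension M x\<rparr>) R" "\<forall>z\<in>M. \<psi> z = z" "\<psi> x = y"
    using extend_to_simple_extension[OF M(1) ring_hom_id[OF subfieldE(3)[OF M(1)]] x alg y'] by auto
  have S: "subfield (simple_extension M x) R" using simple_extension_is_subfield[OF M(1) x] alg by simp
  have incl: "M \<subseteq> simple_extension M x" using simple_extension_incl[OF subfieldE(3)[OF M(1)] x] .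
  obtain \<sigma> where \<sigma>: "\<sigma> \<in> Gal K" "\<forall>z\<in>simple_extension M x. \<sigma> z = \<psi> z"
    using extend_to_aut[OF S _ \<psi>(1)] \<psi>(2) M(2) incl by (metis subsetD subset_trans)
  have "\<sigma> \<in> Gal M" using \<sigma> \<psi>(2) incl unfolding galois_group_iff by auto
  moreover have "\<sigma> x = y"
    using \<sigma>(2) \<psi>(3) simple_extension_mem[OF subfieldE(1)[OF M(1)] x] by simp
  ultimately show ?thesis by blast
qed

text \<open>The roots of \<open>Irr K r\<close> are simple by separability, and
  \<open>Irr M r\<close>, whose roots form a sub-multiset, has simple roots as well.\<close>

lemma card_conjugates:
  assumes M: "subfield M R" "K \<subseteq> M" and r: "r \<in> set rs"
  shows "card {y. is_root (Irr M r) y} = degree (Irr M r)"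
proof -
  have rc: "r \<in> carrier R" using r rs by auto
  have alg: "(algebraic over K) r" "splitted (Irr K r)" using splits[OF rc] by auto
  have algM: "(algebraic over M) r" using algebraic_mono[OF M(2)] alg by auto
  have id: "map (\<lambda>x. x) (Irr M r) = Irr M r" by simp
  note m = map_Irr[OF K M ring_hom_id[OF subfieldE(3)[OF M(1)]] refl rc alg, unfolded id]
  have pK: "Irr K r \<in> carrier (poly_ring R)"
    using carrier_polynomial_shell[OF subfieldE(1)[OF K]] IrrE(1)[OF K rc alg(1)] .
  have "count (roots (Irr K r)) a \<le> 1" for a
    using separable[OF r, of a] alg_mult_eq_count_roots[OF pK] by (metis alg_mult_def le0)
  then have "count (roots (Irr M r)) a \<le> 1" for a
    using mset_subset_eq_count[OF m(3), of a] by (metis le_trans)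
  then have "size (roots (Irr M r)) = card (set_mset (roots (Irr M r)))"
    by (rule size_eq_card_set_mset)
  moreover have "set_mset (roots (Irr M r)) = {y. is_root (Irr M r) y}"
    using roots_mem_iff_is_root[OF m(1)] by auto
  ultimately show ?thesis using m(2) unfolding splitted_def by simp
qed

text \<open>In the step that adjoins \<open>r\<close>, write \<open>x\<close> as a polynomial
  \<open>p\<close> in \<open>r\<close> of degree below that of the minimal polynomial. If every
  automorphism over the smaller field fixed \<open>x\<close>, then \<open>p - x\<close> would vanish
  at all conjugates of \<open>r\<close>, which are more than its degree permits.\<close>

lemma moved_by_Gal_finite_extension:
  assumes M: "subfield M R" "K \<subseteq> M" and ss: "set ss \<subseteq> set rs"
    and x: "x \<in> finite_extension M ss" "x \<notin> M"
  shows "\<exists>\<sigma> \<in> Gal M. \<sigma> x \<noteq> x"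
  using ss x(1)
proof (induction ss)
  case Nil
  then show ?case using x(2) by simp
next
  case (Cons r ss)
  let ?F = "finite_extension M ss"
  have ss: "set ss \<subseteq> carrier R" and rr: "r \<in> set rs" and r: "r \<in> carrier R" using Cons.prems rs(1) by auto
  have alg: "(algebraic over M) s" if "s \<in> set ss" for s
    using algebraic_mono[OF M(2)] splits ss that by auto
  have F: "subfield ?F R" using finite_extension_is_subfield[OF M(1) ss alg] .
  have MF: "M \<subseteq> ?F" using finite_extension_incl[OF subfieldE(3)[OF M(1)] ss] .
  have KF: "K \<subseteq> ?F" using M(2) MF by auto
  have algF: "(algebraic over ?F) r" using algebraic_mono[OF KF] splits[OF r] by auto
  show ?case
  proof (cases "x \<in> ?F")
    case True
    then show ?thesis using Cons by auto
  next
    case False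
    let ?m = "Irr ?F r"
    have "x \<in> simple_extension ?F r" using Cons.prems by simp
    then have "x \<in> Span ?F (exp_base r (degree ?m))" using Span_exp_base[OF F r algF] by simp
    then obtain p where p: "p \<in> carrier (?F[X])" "length p \<le> degree ?m" "x = eval p r"
      unfolding Span_eq_eval_img[OF F r] by auto
    have xc: "x \<in> carrier R"
      using p(3) eval_poly_in_carrier[OF subfieldE(1)[OF F] _ r] p(1) unfolding univ_poly_carrier by simp
    show ?thesis
    proof (rule ccontr)
      assume "\<not> ?thesis"
      then have fix_x: "\<sigma> x = x" if "\<sigma> \<in> Gal ?F" for \<sigma> using galois_group_mono[OF MF] that by blast
      interpret P: domain "poly_ring R" using univ_poly_is_domain[OF carrier_is_subring] .
      have pR: "p \<in> carrier (poly_ring R)" using carrier_polynomial_shell[OF subfieldE(1)[OF F] p(1)] .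
      have pF: "set p \<subseteq> ?F" using p(1) unfolding univ_poly_def polynomial_def by auto
      have x0: "x \<noteq> \<zero>" using False subringE(2)[OF subfieldE(1)[OF F]] by auto
      have c: "[x] \<in> carrier (poly_ring R)" using x0 xc unfolding univ_poly_def polynomial_def by simp
      \<comment> \<open>The constant \<open>x\<close> lies outside \<open>?F\<close>, while the
        coefficients of \<open>p\<close> lie in \<open>?F\<close>; hence the difference is not
        zero.\<close>
      let ?q = "p \<ominus>\<^bsub>poly_ring R\<^esub> [x]"
      have q: "?q \<in> carrier (poly_ring R)" using pR c by simp
      have "?q \<noteq> []"
      proof
        assume "?q = []"
        then have "p = [x]" using P.r_right_minus_eq[OF pR c] univ_poly_zero by metis
        then show False using pF False by simp
      qed
      have "{y. is_root ?m y} \<subseteq> {y. is_root ?q y}"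
      proof
        fix y assume y: "y \<in> {y. is_root ?m y}"
        then have yc: "y \<in> carrier R" unfolding is_root_def by auto
        obtain \<sigma> where \<sigma>: "\<sigma> \<in> Gal ?F" "\<sigma> r = y" using conjugate_root[OF F KF r] y by auto
        interpret h: ring_hom_ring R R \<sigma> using Gal_hom[OF \<sigma>(1)] .
        have "map \<sigma> p = p" using pF GalD(3)[OF \<sigma>(1)] by (intro map_idI) auto
        then have "eval p y = \<sigma> x"
          using h.eval_hom'[OF r, of p] pF subfieldE(3)[OF F] \<sigma>(2) p(3) by (metis subset_trans)
        then have "eval p y = x" using fix_x[OF \<sigma>(1)] by simp
        moreover have "eval [x] y = x" using xc yc by simp
        ultimately have "eval ?q y = \<zero>" using ring_hom_cring.hom_sub[OF eval_cring_hom[OF carrier_is_subring yc] pR c] xc by simp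
        then show "y \<in> {y. is_root ?q y}" using yc \<open>?q \<noteq> []\<close> unfolding is_root_def by simp
      qed
      then have "degree ?m \<le> degree ?q"
        using card_conjugates[OF F KF rr] card_roots_le[OF q \<open>?q \<noteq> []\<close>] card_mono
        by (metis (no_types, lifting) le_trans)
      \<comment> \<open>The length of a coefficient list is the degree plus one. The 1 stands for
        the constant \<open>[x]\<close> and is absorbed because
        \<open>degree ?m \<ge> 1\<close>.\<close>
      moreover have "length ?q \<le> max (length p) 1"
        using poly_add_length_le[of p "\<ominus>\<^bsub>poly_ring R\<^esub> [x]"] univ_poly_a_inv_length[OF carrier_is_subring c]
        unfolding a_minus_def univ_poly_add by simp
      moreover have "degree ?m \<ge> 1" using Irr_not_Nil(2)[OF F r algF] .
      moreover have "length ?q > 0" using \<open>?q \<noteq> []\<close> by simp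
      ultimately show False using p(2) by linarith
    qed
  qed
qed

theorem fixed_field:
  assumes M: "subfield M R" "K \<subseteq> M" and x: "x \<in> carrier R" "\<And>\<sigma>. \<sigma> \<in> Gal M \<Longrightarrow> \<sigma> x = x"
  shows "x \<in> M"
proof (rule ccontr)
  assume "x \<notin> M"
  moreover have "x \<in> finite_extension M rs" using mono_finite_extension[OF M(2)] rs(2) x(1) by blast
  ultimately show False using moved_by_Gal_finite_extension[OF M, of rs x] x(2) by blast
qed

text \<open>An automorphism is determined by its values on \<open>rs\<close>, and each value is one
  of the finitely many roots of a minimal polynomial.\<close>

lemma finite_Gal: "finite (Gal K)"
proof -
  define Z where "Z = (\<Union>r\<in>set rs. {y. is_root (Irr K r) y})"
  have irr: "Irr K r \<in> carrier (K[X])" "is_root (Irr K r) r" if "r \<in> set rs" for r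
    using that rs(1) splits IrrE[OF K, of r] Irr_not_Nil[OF K, of r] unfolding is_root_def by auto
  have "finite Z" unfolding Z_def
    using irr finite_number_of_roots carrier_polynomial_shell[OF subfieldE(1)[OF K]] by auto
  then have "finite {ys. set ys \<subseteq> Z \<and> length ys = length rs}" by (rule finite_lists_length_eq)
  moreover have "\<sigma> r \<in> Z" if "\<sigma> \<in> Gal K" "r \<in> set rs" for \<sigma> r
    using Gal_root[OF that(1) irr(1)[OF that(2)] K_carrier irr(2)[OF that(2)]] that(2)
    unfolding Z_def by blast
  then have "(\<lambda>\<sigma>. map \<sigma> rs) ` Gal K \<subseteq> {ys. set ys \<subseteq> Z \<and> length ys = length rs}" by auto
  moreover have "inj_on (\<lambda>\<sigma>. map \<sigma> rs) (Gal K)"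
  proof (rule inj_onI)
    fix \<sigma> \<tau> assume \<sigma>: "\<sigma> \<in> Gal K" and \<tau>: "\<tau> \<in> Gal K" and eq: "map \<sigma> rs = map \<tau> rs"
    interpret s: ring_hom_ring R R \<sigma> using Gal_hom[OF \<sigma>] .
    interpret t: ring_hom_ring R R \<tau> using Gal_hom[OF \<tau>] .
    have "subring {z \<in> carrier R. \<sigma> z = \<tau> z} R" by (rule subringI) auto
    moreover have "K \<subseteq> {z \<in> carrier R. \<sigma> z = \<tau> z}" using GalD(3)[OF \<sigma>] GalD(3)[OF \<tau>] K_carrier by auto
    moreover have "set rs \<subseteq> {z \<in> carrier R. \<sigma> z = \<tau> z}" using eq rs(1) by auto
    ultimately have "carrier R \<subseteq> {z \<in> carrier R. \<sigma> z = \<tau> z}"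
      using finite_extension_subring_incl rs(2) by metis
    then show "\<sigma> = \<tau>" using galois_group_eqI[OF \<sigma> \<tau>] by auto
  qed
  ultimately show ?thesis using finite_imageD finite_subset by blast
qed

end

text \<open>\<open>rs\<close> lists all conjugates of a basis of \<open>L\<close>. The field they
  generate over \<open>K\<close> is normal: an embedding sending \<open>x\<close> to another root of
  its minimal polynomial permutes \<open>rs\<close> within itself, so it keeps the field in place.
  Minimality of the closure then makes this field the whole one.\<close>

lemma (in field) galois_closure_galois_ext:
  assumes K: "subfield K R" and L: "subfield L R" "K \<subseteq> L" "finite_dimension K L" "separable_extension K L"
    and closure: "is_galois_closure K L"
  shows "\<exists>rs. galois_ext R K rs"
proof -
  have splits: "(algebraic over K) x \<and> splitted (Irr K x)" if "x \<in> carrier R" for x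
    using closure that unfolding is_galois_closure_def normal_extension_def by simp
  obtain n where "dimension n K L" using L(3) by auto
  then obtain Us where Us: "set Us \<subseteq> carrier R" "Span K Us = L" using exists_base[OF K] by blast
  have UL: "set Us \<subseteq> L" using Span_base_incl[OF K Us(1)] Us(2) by simp
  let ?Z = "\<Union>u\<in>set Us. {y. is_root (Irr K u) y}"
  have irr: "Irr K u \<in> carrier (K[X])" "is_root (Irr K u) u" "Irr K u \<noteq> []" if "u \<in> carrier R" for u
    using IrrE[OF K that] Irr_not_Nil[OF K that] splits[OF that] that unfolding is_root_def by auto
  note polyR = carrier_polynomial_shell[OF subfieldE(1)[OF K]]
  have "finite ?Z" using finite_number_of_roots[OF polyR[OF irr(1)]] Us(1) by auto
  then obtain rs where rs: "set rs = ?Z" using finite_list by blast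
  have rsc: "set rs \<subseteq> carrier R" unfolding rs is_root_def by auto
  let ?E = "finite_extension K rs"
  have alg: "(algebraic over K) r" if "r \<in> set rs" for r using splits that rsc by auto
  have E: "subfield ?E R" using finite_extension_is_subfield[OF K rsc alg] .
  have KE: "K \<subseteq> ?E" using finite_extension_incl[OF subfieldE(3)[OF K] rsc] .
  have rsE: "set rs \<subseteq> ?E" using finite_extension_mem[OF subfieldE(1)[OF K] rsc] .
  have "subalgebra K ?E R"
    using finite_dimension_imp_subalgebra[OF K finite_extension_finite_dimension(1)[OF K rsc alg]] .
  moreover have "set Us \<subseteq> ?E" using rsE irr(2) Us(1) unfolding rs by blast
  ultimately have LE: "L \<subseteq> ?E" using subalgebra_Span_incl[OF K] Us(2) by auto
  have "normal_extension K ?E" unfolding normal_extension_def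
  proof (intro ballI conjI)
    fix x assume xE: "x \<in> ?E"
    then have x: "x \<in> carrier R" using subfieldE(3)[OF E] by auto
    show "(algebraic over K) x" using splits[OF x] by simp
    have px: "Irr K x \<in> carrier (?E[X])" using poly_subset[OF KE] irr(1)[OF x] by auto
    show "ring.splitted (R\<lparr>carrier := ?E\<rparr>) (Irr K x)"
    proof (rule splitted_in_subfield[OF E px irr(3)[OF x]])
      show "splitted (Irr K x)" using splits[OF x] by simp
      fix y assume y: "is_root (Irr K x) y"
      have y': "y \<in> carrier R" "eval (map (\<lambda>x. x) (Irr K x)) y = \<zero>" using y unfolding is_root_def by auto
      let ?F = "simple_extension K x"
      have F: "subfield ?F R" using simple_extension_is_subfield[OF K x] splits[OF x] by simp
      have KF: "K \<subseteq> ?F" using simple_extension_incl[OF subfieldE(3)[OF K] x] .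
      obtain \<psi> where \<psi>: "\<psi> \<in> ring_hom (R\<lparr>carrier := ?F\<rparr>) R" "\<forall>z\<in>K. \<psi> z = z" "\<psi> x = y"
        using extend_to_simple_extension[OF K ring_hom_id[OF subfieldE(3)[OF K]] x _ y'] splits[OF x] by auto
      obtain \<chi> where \<chi>: "\<chi> \<in> ring_hom (R\<lparr>carrier := finite_extension ?F rs\<rparr>) R" "\<forall>z\<in>?F. \<chi> z = \<psi> z"
        using extend_to_finite_extension[OF K F KF \<psi>(1), of rs] \<psi>(2) splits rsc by (auto simp: subset_iff)
      \<comment> \<open>Built over the simple extension by \<open>x\<close>, where \<open>x\<close>
        can be sent to \<open>y\<close>. It contains \<open>?E\<close>, which is generated by the
        same \<open>rs\<close> over the smaller field \<open>K\<close>.\<close>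
      let ?D = "finite_extension ?F rs"
      have D: "subring ?D R" using finite_extension_is_subring[OF subfieldE(1)[OF F] rsc] .
      have ED: "?E \<subseteq> ?D" using mono_finite_extension[OF KF] .
      have FD: "?F \<subseteq> ?D" using finite_extension_incl[OF subfieldE(3)[OF F] rsc] .
      have \<chi>K: "\<chi> z = z" if "z \<in> K" for z using that \<chi>(2) \<psi>(2) KF by auto
      interpret D: ring "R\<lparr>carrier := ?D\<rparr>" using subring_is_ring[OF D] .
      interpret h: ring_hom_ring "R\<lparr>carrier := ?D\<rparr>" R \<chi>
        using ring_hom_ringI2[OF D.ring_axioms ring_axioms \<chi>(1)] .
      have "\<chi> r \<in> set rs" if r: "r \<in> set rs" for r
      proof -
        obtain u where u: "u \<in> set Us" "is_root (Irr K u) r" using r unfolding rs by auto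
        have uc: "u \<in> carrier R" using u Us(1) by auto
        have set: "set (Irr K u) \<subseteq> K" using irr(1)[OF uc] unfolding univ_poly_def polynomial_def by auto
        have rD: "r \<in> ?D" using rsE ED r by auto
        have "map \<chi> (Irr K u) = Irr K u" using set \<chi>K by (intro map_idI) auto
        moreover have "set (Irr K u) \<subseteq> ?D" using set KF FD by auto
        ultimately have "\<chi> (eval (Irr K u) r) = eval (Irr K u) (\<chi> r)"
          using h.eval_hom'[of r "Irr K u"] rD eval_consistent[OF D] by simp
        moreover have "eval (Irr K u) r = \<zero>" using u(2) unfolding is_root_def by simp
        ultimately have "eval (Irr K u) (\<chi> r) = \<zero>" using h.hom_zero by simp
        then have "is_root (Irr K u) (\<chi> r)" using irr(3)[OF uc] h.hom_closed rD unfolding is_root_def by simp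
        then show ?thesis using u(1) unfolding rs by auto
      qed
      then have 1: "set rs \<subseteq> {z \<in> ?D. \<chi> z \<in> ?E}" using rsE ED by auto
      have 2: "K \<subseteq> {z \<in> ?D. \<chi> z \<in> ?E}" using \<chi>K KE KF FD by auto
      note s = subringE[OF D] and e = subringE[OF subfieldE(1)[OF E]]
      have hm: "\<chi> (a \<otimes> b) = \<chi> a \<otimes> \<chi> b" "\<chi> (a \<oplus> b) = \<chi> a \<oplus> \<chi> b" if "a \<in> ?D" "b \<in> ?D" for a b
        using ring_hom_memE(2,3)[OF \<chi>(1)] that by simp_all
      have hi: "\<chi> (\<ominus> a) = \<ominus> \<chi> a" if "a \<in> ?D" for a
      proof -
        have "\<chi> (\<ominus> a) \<oplus> \<chi> a = \<zero>"
          using hm(2)[OF s(5)[OF that] that] that s(1) h.hom_zero by (auto simp: l_neg subset_iff)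
        then show ?thesis
          using minus_equality h.hom_closed that s(5)[OF that] by simp
      qed
      have "\<chi> \<one> = \<one>" using h.hom_one by simp
      \<comment> \<open>The elements sent into \<open>?E\<close> form a subring containing
        \<open>K\<close> and \<open>rs\<close>, hence all of \<open>?E\<close>.\<close>
      then have "subring {z \<in> ?D. \<chi> z \<in> ?E} R"
        using s e hm hi by (intro subringI) auto
      then have "?E \<subseteq> {z \<in> ?D. \<chi> z \<in> ?E}" using finite_extension_subring_incl[OF _ 2 1] by simp
      then have "\<chi> x \<in> ?E" using xE by auto
      moreover have "\<chi> x = y" using \<chi>(2) \<psi>(3) simple_extension_mem[OF subfieldE(1)[OF K] x] by simp
      ultimately show "y \<in> ?E" by simp
    qed
  qed
  then have "?E = carrier R" using closure E KE LE unfolding is_galois_closure_def by blast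
  moreover have "alg_mult (Irr K r) a \<le> 1" if r: "r \<in> set rs" and a: "a \<in> carrier R" for r a
  proof -
    obtain u where u: "u \<in> set Us" "is_root (Irr K u) r" using r unfolding rs by auto
    have uc: "u \<in> carrier R" and uL: "u \<in> L" using u Us(1) UL by auto
    have rc: "r \<in> carrier R" using r rsc by auto
    have "Irr K r pdivides Irr K u"
      using Irr_minimal[OF K rc alg[OF r] irr(1)[OF uc]] u(2) unfolding is_root_def by simp
    then have "roots (Irr K r) \<subseteq># roots (Irr K u)"
      using pdivides_imp_roots_incl[OF polyR[OF irr(1)[OF rc]] polyR[OF irr(1)[OF uc]] irr(3)[OF uc]] by simp
    then have "count (roots (Irr K r)) a \<le> count (roots (Irr K u)) a" by (rule mset_subset_eq_count)
    moreover have "alg_mult (Irr K u) a \<le> 1" using L(4) uL a unfolding separable_extension_def by blast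
    ultimately show ?thesis
      using alg_mult_eq_count_roots[OF polyR[OF irr(1)[OF rc]]]
        alg_mult_eq_count_roots[OF polyR[OF irr(1)[OF uc]]] by simp
  qed
  ultimately have "galois_ext R K rs"
    using K rsc splits field_axioms by (intro galois_ext.intro galois_ext_axioms.intro) auto
  then show ?thesis by blast
qed

section \<open>Polynomials with prescribed roots\<close>

context field
begin

text \<open>The product of the factors X - f i. It is indexed by a set instead of by the roots, so
  that roots may repeat: conjugates can coincide, and a constant family gives a power of one linear
  factor.\<close>

definition roots_poly :: "('i \<Rightarrow> 'a) \<Rightarrow> 'i set \<Rightarrow> 'a list"
  where "roots_poly f B = finprod (poly_ring R) (\<lambda>i. [\<one>, \<ominus> f i]) B"

lemma linear_factor_closed:
  assumes "subring S R" "x \<in> S"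
  shows "[\<one>, \<ominus> x] \<in> carrier (S[X])"
  using assms subringE(3,5)[OF assms(1)] unfolding univ_poly_def polynomial_def by simp

lemma poly_domain: "domain (poly_ring R)"
  using univ_poly_is_domain[OF carrier_is_subring] .

lemma roots_poly_empty: "roots_poly f {} = [\<one>]"
proof -
  interpret P: domain "poly_ring R" by (rule poly_domain)
  show ?thesis unfolding roots_poly_def by (simp add: univ_poly_one)
qed

lemma roots_poly_insert:
  assumes "finite B" "i \<notin> B" "\<And>j. j \<in> insert i B \<Longrightarrow> f j \<in> carrier R"
  shows "roots_poly f (insert i B) = [\<one>, \<ominus> f i] \<otimes>\<^bsub>poly_ring R\<^esub> roots_poly f B"
proof -
  interpret P: domain "poly_ring R" by (rule poly_domain)
  show ?thesis
    unfolding roots_poly_def using assms linear_factor_closed[OF carrier_is_subring]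
    by (intro P.finprod_insert) auto
qed

lemma roots_poly_closed:
  assumes "finite B" "subring S R" "\<And>i. i \<in> B \<Longrightarrow> f i \<in> S"
  shows "roots_poly f B \<in> carrier (S[X])"
  using assms(1,3)
proof (induction B)
  case empty
  then show ?case
    unfolding roots_poly_empty using subringE(3)[OF assms(2)] unfolding univ_poly_def polynomial_def by simp
next
  case (insert i B)
  interpret S: domain "S[X]" using univ_poly_is_domain[OF assms(2)] .
  have car: "f j \<in> carrier R" if "j \<in> insert i B" for j
    using insert.prems[OF that] subringE(1)[OF assms(2)] by blast
  have "roots_poly f (insert i B) = [\<one>, \<ominus> f i] \<otimes>\<^bsub>S[X]\<^esub> roots_poly f B"
    using roots_poly_insert[OF insert(1,2) car] by (simp only: univ_poly_mult)
  then show ?case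
    using S.m_closed[OF linear_factor_closed[OF assms(2)]] insert by simp
qed

lemma length_roots_poly:
  assumes "finite B" "\<And>i. i \<in> B \<Longrightarrow> f i \<in> carrier R"
  shows "length (roots_poly f B) = Suc (card B)"
  using assms
proof (induction B)
  case empty
  then show ?case by (simp add: roots_poly_empty)
next
  case (insert i B)
  let ?p = "[\<one>, \<ominus> f i]" and ?q = "roots_poly f B"
  have p: "polynomial (carrier R) ?p" and q: "polynomial (carrier R) ?q"
    using linear_factor_closed[OF carrier_is_subring] roots_poly_closed[OF insert(1) carrier_is_subring] insert.prems
    unfolding univ_poly_carrier by auto
  have len: "length ?q = Suc (card B)" using insert by simp
  then have "?q \<noteq> []" by auto
  have eq: "roots_poly f (insert i B) = poly_mult ?p ?q"
    using roots_poly_insert[OF insert(1,2), of f] insert.prems by (simp add: univ_poly_mult)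
  have "poly_mult ?p ?q \<noteq> []"
    using poly_mult_integral[OF carrier_is_subring p q] \<open>?q \<noteq> []\<close> by auto
  moreover have "degree (poly_mult ?p ?q) = Suc (card B)"
    using poly_mult_degree_eq[OF carrier_is_subring p q] len \<open>?q \<noteq> []\<close> by (simp del: poly_mult.simps)
  ultimately have "length (poly_mult ?p ?q) = Suc (Suc (card B))" by (cases "poly_mult ?p ?q") auto
  then show ?case using eq insert by simp
qed

lemma eval_roots_poly:
  assumes "finite B" "\<And>i. i \<in> B \<Longrightarrow> f i \<in> carrier R" "y \<in> carrier R"
  shows "eval (roots_poly f B) y = finprod R (\<lambda>i. y \<ominus> f i) B"
  using assms(1,2)
proof (induction B)
  case empty
  then show ?case using assms(3) by (simp add: roots_poly_empty)
next
  case (insert i B)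
  interpret e: ring_hom_cring "poly_ring R" R "\<lambda>p. eval p y"
    using eval_cring_hom[OF carrier_is_subring assms(3)] .
  have "eval [\<one>, \<ominus> f i] y = y \<ominus> f i" using assms(3) insert.prems by (simp add: a_minus_def)
  then show ?case
    using roots_poly_insert[OF insert(1,2), of f] insert assms(3)
      roots_poly_closed[OF insert(1) carrier_is_subring] linear_factor_closed[OF carrier_is_subring, of "f i"]
    by simp
qed

text \<open>\<open>A\<close> stands for a multiplicatively closed set; it is used for the nonzero
  elements and, in the valuation ring, for the complement of the maximal ideal.\<close>

lemma finprod_in_prime:
  assumes "finite B" "\<And>i. i \<in> B \<Longrightarrow> g i \<in> carrier R" "\<And>i. i \<in> B \<Longrightarrow> g i \<in> A" "\<one> \<in> A"
    and "\<And>x y. x \<in> carrier R \<Longrightarrow> y \<in> carrier R \<Longrightarrow> x \<in> A \<Longrightarrow> y \<in> A \<Longrightarrow> x \<otimes> y \<in> A"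
  shows "finprod R g B \<in> A"
  using assms(1-3)
proof (induction B)
  case empty
  then show ?case using assms(4) by simp
next
  case (insert i B)
  then have "finprod R g (insert i B) = g i \<otimes> finprod R g B" by (intro finprod_insert) auto
  then show ?case using assms(5)[of "g i" "finprod R g B"] insert by auto
qed

lemma eval_roots_poly_zero_iff:
  assumes "finite B" "\<And>i. i \<in> B \<Longrightarrow> f i \<in> carrier R" "y \<in> carrier R"
  shows "eval (roots_poly f B) y = \<zero> \<longleftrightarrow> (\<exists>i\<in>B. y = f i)"
proof
  assume *: "eval (roots_poly f B) y = \<zero>"
  show "\<exists>i\<in>B. y = f i"
  proof (rule ccontr)
    assume "\<not> ?thesis"
    then have "finprod R (\<lambda>i. y \<ominus> f i) B \<in> - {\<zero>}"
      using assms r_right_minus_eq by (intro finprod_in_prime) (auto simp: integral_iff)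
    then show False using * eval_roots_poly[OF assms] by simp
  qed
next
  assume "\<exists>i\<in>B. y = f i"
  then obtain i where i: "i \<in> B" "y = f i" by blast
  have "finprod R (\<lambda>i. y \<ominus> f i) (insert i (B - {i})) = (y \<ominus> f i) \<otimes> finprod R (\<lambda>i. y \<ominus> f i) (B - {i})"
    using assms i by (intro finprod_insert) auto
  also have "y \<ominus> f i = \<zero>" using i assms(3) r_right_minus_eq by simp
  also have "\<zero> \<otimes> finprod R (\<lambda>i. y \<ominus> f i) (B - {i}) = \<zero>"
    using assms by (intro l_null finprod_closed) auto
  finally show "eval (roots_poly f B) y = \<zero>"
    using eval_roots_poly[OF assms] i by (simp add: insert_absorb)
qed

lemma map_roots_poly:
  assumes "finite B" "\<And>i. i \<in> B \<Longrightarrow> f i \<in> carrier R" "\<tau> \<in> ring_hom R R"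
  shows "map \<tau> (roots_poly f B) = roots_poly (\<lambda>i. \<tau> (f i)) B"
  using assms(1,2)
proof (induction B)
  case empty
  then show ?case using ring_hom_memE(4)[OF assms(3)] by (simp add: roots_poly_empty)
next
  case (insert i B)
  interpret h: ring_hom_ring R R \<tau> using ring_hom_ringI2[OF ring_axioms ring_axioms assms(3)] .
  have hom: "map \<tau> \<in> ring_hom (poly_ring R) (poly_ring R)"
    using map_poly_hom(1)[OF carrier_is_subfield, of \<tau>] assms(3) by simp
  have "map \<tau> (roots_poly f (insert i B)) = map \<tau> [\<one>, \<ominus> f i] \<otimes>\<^bsub>poly_ring R\<^esub> map \<tau> (roots_poly f B)"
    using roots_poly_insert[OF insert(1,2), of f] insert.prems
      ring_hom_memE(2)[OF hom linear_factor_closed[OF carrier_is_subring]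
        roots_poly_closed[OF insert(1) carrier_is_subring]] by simp
  also have "map \<tau> [\<one>, \<ominus> f i] = [\<one>, \<ominus> \<tau> (f i)]" using insert.prems by simp
  finally show ?case using roots_poly_insert[OF insert(1,2), of "\<lambda>i. \<tau> (f i)"] insert h.hom_closed by simp
qed

text \<open>Applied to the coefficients, \<open>\<tau>\<close> merely permutes the linear factors,
  so it fixes their product.\<close>

lemma roots_poly_invariant:
  assumes "finite B" "\<And>i. i \<in> B \<Longrightarrow> f i \<in> carrier R" "\<tau> \<in> ring_hom R R"
    and \<pi>: "bij_betw \<pi> B B" "\<And>i. i \<in> B \<Longrightarrow> \<tau> (f i) = f (\<pi> i)"
    and c: "c \<in> set (roots_poly f B)"
  shows "\<tau> c = c"
proof -
  interpret P: domain "poly_ring R" by (rule poly_domain)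
  have lin: "(\<lambda>i. [\<one>, \<ominus> f i]) \<in> B \<rightarrow> carrier (poly_ring R)"
    using assms(2) linear_factor_closed[OF carrier_is_subring] by auto
  have "map \<tau> (roots_poly f B) = roots_poly (\<lambda>i. \<tau> (f i)) B" using map_roots_poly[OF assms(1-3)] .
  also have "\<dots> = finprod (poly_ring R) (\<lambda>i. [\<one>, \<ominus> f (\<pi> i)]) B"
    unfolding roots_poly_def using lin \<pi> bij_betwE[OF \<pi>(1)] by (intro P.finprod_cong') auto
  also have "\<dots> = finprod (poly_ring R) (\<lambda>i. [\<one>, \<ominus> f i]) (\<pi> ` B)"
    using lin \<pi>(1) unfolding bij_betw_def by (intro P.finprod_reindex[symmetric]) auto
  also have "\<pi> ` B = B" using \<pi>(1) unfolding bij_betw_def by simp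
  finally have "map \<tau> (roots_poly f B) = map (\<lambda>x. x) (roots_poly f B)" unfolding roots_poly_def by simp
  then show ?thesis using c unfolding map_eq_conv by simp
qed

end

section \<open>The Galois correspondence\<close>

context galois_ext
begin

abbreviation "A \<equiv> galois_group R K"

section \<open>Subgroups, fixed fields and degrees\<close>

lemma subgroup_Gal_Bij:
  assumes "M \<subseteq> carrier R"
  shows "subgroup (Gal M) (BijGroup (carrier R))"
proof -
  interpret B: group "BijGroup (carrier R)" by (rule group_BijGroup)
  have Bij: "\<sigma> \<in> Bij (carrier R)" if "\<sigma> \<in> Gal M" for \<sigma> using that unfolding galois_group_iff Bij_def by auto
  show ?thesis
  proof (rule B.subgroupI)
    show "Gal M \<subseteq> carrier (BijGroup (carrier R))" using Bij unfolding BijGroup_def by auto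
    have "restrict (\<lambda>x. x) (carrier R) \<in> ring_hom R R" by (intro ring_hom_memI) auto
    moreover have "bij_betw (restrict (\<lambda>x. x) (carrier R)) (carrier R) (carrier R)"
      unfolding bij_betw_def inj_on_def by auto
    ultimately have "restrict (\<lambda>x. x) (carrier R) \<in> Gal M"
      unfolding galois_group_iff using assms by (auto simp: subset_iff)
    then show "Gal M \<noteq> {}" by blast
  next
    fix \<sigma> assume \<sigma>: "\<sigma> \<in> Gal M"
    note s = GalD[OF \<sigma>]
    have iso: "\<sigma> \<in> ring_iso R R" using s unfolding ring_iso_def by simp
    let ?i = "restrict (inv_into (carrier R) \<sigma>) (carrier R)"
    have "?i \<in> ring_iso R R"
      using ring_iso_restrict[OF ring_iso_set_sym[OF ring_axioms iso], of ?i] by simp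
    moreover have "inv_into (carrier R) \<sigma> x = x" if "x \<in> M" for x
      using that assms s inv_into_f_f[OF Gal_inj[OF \<sigma>], of x] by auto
    ultimately have "?i \<in> Gal M" unfolding galois_group_iff ring_iso_def using assms by auto
    then show "inv\<^bsub>BijGroup (carrier R)\<^esub> \<sigma> \<in> Gal M" using inv_BijGroup[OF Bij[OF \<sigma>]] by simp
  next
    fix \<sigma> \<tau> assume \<sigma>: "\<sigma> \<in> Gal M" and \<tau>: "\<tau> \<in> Gal M"
    have "compose (carrier R) \<sigma> \<tau> \<in> ring_hom R R"
      using ring_hom_restrict[OF ring_hom_trans[OF GalD(1)[OF \<tau>] GalD(1)[OF \<sigma>]],
          of "compose (carrier R) \<sigma> \<tau>"] by (simp add: compose_def)
    moreover have "bij_betw (compose (carrier R) \<sigma> \<tau>) (carrier R) (carrier R)"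
      using compose_Bij[OF Bij[OF \<sigma>] Bij[OF \<tau>]] unfolding Bij_def by simp
    moreover have "compose (carrier R) \<sigma> \<tau> x = x" if "x \<in> M" for x
      using that assms GalD(3)[OF \<sigma>] GalD(3)[OF \<tau>] by (auto simp: compose_def)
    ultimately have "compose (carrier R) \<sigma> \<tau> \<in> Gal M"
      unfolding galois_group_iff by (simp add: compose_def)
    then show "\<sigma> \<otimes>\<^bsub>BijGroup (carrier R)\<^esub> \<tau> \<in> Gal M"
      using Bij[OF \<sigma>] Bij[OF \<tau>] unfolding BijGroup_def by simp
  qed
qed

lemma galois_group_restrict: "galois_group R M = A\<lparr>carrier := Gal M\<rparr>"
  unfolding galois_group_def by simp

lemma group_Gal: "M \<subseteq> carrier R \<Longrightarrow> group (galois_group R M)"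
  using group.subgroup_imp_group[OF group_BijGroup subgroup_Gal_Bij] unfolding galois_group_def by simp

lemma group_A: "group A" using group_Gal[OF K_carrier] .

lemma subgroup_Gal:
  assumes "K \<subseteq> M" "M \<subseteq> carrier R"
  shows "subgroup (Gal M) A"
  using group.subgroup_incl[OF group_BijGroup subgroup_Gal_Bij[OF assms(2)] subgroup_Gal_Bij[OF K_carrier]
      galois_group_mono[OF assms(1)]] unfolding galois_group_def by simp

lemma mult_apply:
  assumes "\<sigma> \<in> Gal K" "\<tau> \<in> Gal K" "x \<in> carrier R"
  shows "(\<sigma> \<otimes>\<^bsub>A\<^esub> \<tau>) x = \<sigma> (\<tau> x)"
proof -
  have "\<sigma> \<in> Bij (carrier R)" "\<tau> \<in> Bij (carrier R)" using assms unfolding galois_group_iff Bij_def by auto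
  then show ?thesis using assms unfolding galois_group_def BijGroup_def by (simp add: compose_def)
qed

lemma one_apply: "x \<in> carrier R \<Longrightarrow> \<one>\<^bsub>A\<^esub> x = x"
  unfolding galois_group_def BijGroup_def by simp

lemma inv_apply:
  assumes "\<sigma> \<in> Gal K" "x \<in> carrier R"
  shows "(inv\<^bsub>A\<^esub> \<sigma>) (\<sigma> x) = x" "\<sigma> ((inv\<^bsub>A\<^esub> \<sigma>) x) = x"
proof -
  interpret A: group A by (rule group_A)
  show "(inv\<^bsub>A\<^esub> \<sigma>) (\<sigma> x) = x" "\<sigma> ((inv\<^bsub>A\<^esub> \<sigma>) x) = x"
    using mult_apply[of "inv\<^bsub>A\<^esub> \<sigma>" \<sigma> x] mult_apply[of \<sigma> "inv\<^bsub>A\<^esub> \<sigma>" x] assms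
    by (simp_all add: one_apply)
qed

lemma Gal_conj_iff:
  assumes "\<sigma> \<in> Gal K" "\<tau> \<in> Gal K" "M \<subseteq> carrier R"
  shows "\<tau> \<in> Gal (\<sigma> ` M) \<longleftrightarrow> inv\<^bsub>A\<^esub> \<sigma> \<otimes>\<^bsub>A\<^esub> \<tau> \<otimes>\<^bsub>A\<^esub> \<sigma> \<in> Gal M"
proof -
  interpret A: group A by (rule group_A)
  let ?c = "inv\<^bsub>A\<^esub> \<sigma> \<otimes>\<^bsub>A\<^esub> \<tau> \<otimes>\<^bsub>A\<^esub> \<sigma>"
  have c: "?c \<in> Gal K" using assms by simp
  have "?c x = (inv\<^bsub>A\<^esub> \<sigma>) (\<tau> (\<sigma> x))" if "x \<in> carrier R" for x
    using that assms by (simp add: mult_apply Gal_closed)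
  then have "?c x = x \<longleftrightarrow> \<tau> (\<sigma> x) = \<sigma> x" if "x \<in> carrier R" for x
    using that inv_apply[OF assms(1)] Gal_closed[OF assms(1)] Gal_closed[OF assms(2)]
    by metis
  moreover have "\<tau> \<in> Gal (\<sigma> ` M) \<longleftrightarrow> (\<forall>x\<in>M. \<tau> (\<sigma> x) = \<sigma> x)" using assms(2) unfolding galois_group_iff by auto
  moreover have "?c \<in> Gal M \<longleftrightarrow> (\<forall>x\<in>M. ?c x = x)" using c unfolding galois_group_iff by blast
  ultimately show ?thesis using assms(3) by auto
qed

lemma subfield_fixed:
  assumes "H \<subseteq> Gal K"
  shows "subfield {x \<in> carrier R. \<forall>\<sigma>\<in>H. \<sigma> x = x} R"
proof (rule subfieldI')
  have hom: "ring_hom_ring R R \<sigma>" if "\<sigma> \<in> H" for \<sigma> using that assms Gal_hom by blast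
  have "\<sigma> \<one> = \<one>" "\<And>x. x \<in> carrier R \<Longrightarrow> \<sigma> (\<ominus> x) = \<ominus> \<sigma> x"
    "\<And>x y. x \<in> carrier R \<Longrightarrow> y \<in> carrier R \<Longrightarrow> \<sigma> (x \<otimes> y) = \<sigma> x \<otimes> \<sigma> y"
    "\<And>x y. x \<in> carrier R \<Longrightarrow> y \<in> carrier R \<Longrightarrow> \<sigma> (x \<oplus> y) = \<sigma> x \<oplus> \<sigma> y" if "\<sigma> \<in> H" for \<sigma>
  proof -
    interpret h: ring_hom_ring R R \<sigma> using hom[OF that] .
    show "\<sigma> \<one> = \<one>" "\<And>x. x \<in> carrier R \<Longrightarrow> \<sigma> (\<ominus> x) = \<ominus> \<sigma> x"
      "\<And>x y. x \<in> carrier R \<Longrightarrow> y \<in> carrier R \<Longrightarrow> \<sigma> (x \<otimes> y) = \<sigma> x \<otimes> \<sigma> y"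
      "\<And>x y. x \<in> carrier R \<Longrightarrow> y \<in> carrier R \<Longrightarrow> \<sigma> (x \<oplus> y) = \<sigma> x \<oplus> \<sigma> y" by simp_all
  qed
  then show "subring {x \<in> carrier R. \<forall>\<sigma>\<in>H. \<sigma> x = x} R"
    by (intro subringI) (auto, metis+)
  fix k assume k: "k \<in> {x \<in> carrier R. \<forall>\<sigma>\<in>H. \<sigma> x = x} - {\<zero>}"
  then have ku: "k \<in> Units R" using field_Units by auto
  have "\<sigma> (inv k) = inv k" if "\<sigma> \<in> H" for \<sigma>
  proof -
    interpret h: ring_hom_ring R R \<sigma> using hom[OF that] .
    have "\<sigma> (inv k) \<otimes> \<sigma> k = \<sigma> (inv k \<otimes> k)" by (rule h.hom_mult[symmetric]) (use k ku in auto)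
    also have "inv k \<otimes> k = \<one>" using ku by simp
    also have "\<sigma> k = k" using k that by blast
    finally have "\<sigma> (inv k) \<otimes> k = \<one>" by simp
    then show ?thesis using comm_inv_char[of k "\<sigma> (inv k)"] k ku m_comm by simp
  qed
  then show "inv k \<in> {x \<in> carrier R. \<forall>\<sigma>\<in>H. \<sigma> x = x}" using ku by simp
qed

lemma Gal_generate_field:
  assumes "H \<subseteq> carrier R" "\<sigma> \<in> Gal K"
  shows "\<sigma> \<in> Gal (generate_field R H) \<longleftrightarrow> (\<forall>x\<in>H. \<sigma> x = x)"
proof
  assume "\<sigma> \<in> Gal (generate_field R H)"
  then show "\<forall>x\<in>H. \<sigma> x = x" using GalD(3) generate_field.incl by metis
next
  assume fix': "\<forall>x\<in>H. \<sigma> x = x"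
  have "generate_field R H \<subseteq> {x \<in> carrier R. \<forall>\<tau>\<in>{\<sigma>}. \<tau> x = x}"
    using fix' assms by (intro generate_field_min_subfield1 subfield_fixed) auto
  then show "\<sigma> \<in> Gal (generate_field R H)" using assms(2) unfolding galois_group_iff by blast
qed

text \<open>The product of X - \<sigma>(a) over \<open>H\<close> has coefficients fixed by
  \<open>H\<close>, hence in \<open>E\<close>, and vanishes at \<open>a\<close>. The hypothesis on
  \<open>E\<close> is phrased to fit both uses: \<open>H\<close> the Galois group over
  \<open>E\<close>, and \<open>E\<close> the fixed field of \<open>H\<close>.\<close>

lemma degree_Irr_le_card:
  assumes E: "subfield E R" "K \<subseteq> E" and H: "subgroup H A" and a: "a \<in> carrier R"
    and fixed: "\<And>x. x \<in> carrier R \<Longrightarrow> (\<And>\<sigma>. \<sigma> \<in> H \<Longrightarrow> \<sigma> x = x) \<Longrightarrow> x \<in> E"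
  shows "degree (Irr E a) \<le> card H"
proof -
  interpret A: group A by (rule group_A)
  have HK: "H \<subseteq> Gal K" using subgroup.subset[OF H] .
  have fin: "finite H" using finite_subset[OF HK finite_Gal] .
  let ?p = "roots_poly (\<lambda>\<sigma>. \<sigma> a) H"
  have cl: "\<sigma> a \<in> carrier R" if "\<sigma> \<in> H" for \<sigma> using that HK Gal_closed a by blast
  have pR: "?p \<in> carrier (poly_ring R)" using roots_poly_closed[OF fin carrier_is_subring] cl by auto
  have coeff: "c \<in> E" if c: "c \<in> set ?p" for c
  proof (rule fixed)
    show "c \<in> carrier R" using pR c unfolding univ_poly_def polynomial_def by auto
    fix \<tau> assume \<tau>: "\<tau> \<in> H"
    have "(\<lambda>\<sigma>. \<tau> \<otimes>\<^bsub>A\<^esub> \<sigma>) ` H = H"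
    proof (intro subset_antisym subsetI)
      fix x assume x: "x \<in> H"
      then have "x = \<tau> \<otimes>\<^bsub>A\<^esub> (inv\<^bsub>A\<^esub> \<tau> \<otimes>\<^bsub>A\<^esub> x)"
        using \<tau> HK by (simp add: A.m_assoc[symmetric] subset_iff)
      then show "x \<in> (\<lambda>\<sigma>. \<tau> \<otimes>\<^bsub>A\<^esub> \<sigma>) ` H"
        using x \<tau> H subgroup.m_closed[OF H] subgroup.m_inv_closed[OF H] by blast
    qed (use \<tau> subgroup.m_closed[OF H] in auto)
    then have bij: "bij_betw (\<lambda>\<sigma>. \<tau> \<otimes>\<^bsub>A\<^esub> \<sigma>) H H"
      using fin eq_card_imp_inj_on unfolding bij_betw_def by metis
    show "\<tau> c = c"
    proof (rule roots_poly_invariant[where f = "\<lambda>\<sigma>. \<sigma> a" and B = H and \<pi> = "(\<otimes>\<^bsub>A\<^esub>) \<tau>"])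
      show "\<tau> \<in> ring_hom R R" using GalD(1) \<tau> HK by blast
      show "bij_betw ((\<otimes>\<^bsub>A\<^esub>) \<tau>) H H" by (rule bij)
      fix \<sigma> assume "\<sigma> \<in> H"
      then show "\<tau> (\<sigma> a) = (\<tau> \<otimes>\<^bsub>A\<^esub> \<sigma>) a" using mult_apply[OF subsetD[OF HK \<tau>] subsetD[OF HK] a] by simp
    qed (use fin cl c in auto)
  qed
  have len: "length ?p = Suc (card H)" by (rule length_roots_poly) (use fin cl in auto)
  then have ne: "?p \<noteq> []" by auto
  have pE: "?p \<in> carrier (E[X])"
    using pR coeff unfolding univ_poly_def polynomial_def by auto
  have alg: "(algebraic over E) a" using algebraic_mono[OF E(2)] splits[OF a] by auto
  have "\<one>\<^bsub>A\<^esub> \<in> H" "\<one>\<^bsub>A\<^esub> a = a" using subgroup.one_closed[OF H] one_apply[OF a] by auto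
  moreover have "eval ?p a = \<zero> \<longleftrightarrow> (\<exists>\<sigma>\<in>H. a = \<sigma> a)"
    by (rule eval_roots_poly_zero_iff) (use fin cl a in auto)
  ultimately have "eval ?p a = \<zero>" by metis
  then have "Irr E a pdivides ?p" using Irr_minimal[OF E(1) a alg pE] by simp
  then have "degree (Irr E a) \<le> degree ?p"
    using pdivides_imp_degree_le[OF subfieldE(1)[OF E(1)] IrrE(1)[OF E(1) a alg] pE ne] by simp
  then show ?thesis using len by simp
qed

text \<open>By induction on the set of automorphisms that must move the element. Passing from
  \<open>a\<close> to \<open>a \<oplus> c \<otimes> b\<close>, each automorphism excludes at most
  one scalar \<open>c\<close>, and \<open>K\<close> is infinite.\<close>

lemma ex_primitive_element:
  assumes "infinite K"
  shows "\<exists>a \<in> carrier R. \<forall>\<sigma> \<in> Gal K. \<sigma> a = a \<longrightarrow> \<sigma> = \<one>\<^bsub>A\<^esub>"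
proof -
  interpret A: group A by (rule group_A)
  have "\<exists>a \<in> carrier R. \<forall>\<sigma> \<in> T. \<sigma> a \<noteq> a" if "finite T" "T \<subseteq> Gal K - {\<one>\<^bsub>A\<^esub>}" for T
    using that
  proof (induction T)
    case empty
    then show ?case by auto
  next
    case (insert \<tau> T)
    then obtain a where a: "a \<in> carrier R" "\<forall>\<sigma> \<in> T. \<sigma> a \<noteq> a" by auto
    have \<tau>: "\<tau> \<in> Gal K" "\<tau> \<noteq> \<one>\<^bsub>A\<^esub>" using insert.prems by auto
    have "\<exists>b \<in> carrier R. \<tau> b \<noteq> b"
      using galois_group_eqI[OF \<tau>(1) A.one_closed] \<tau>(2) one_apply by metis
    then obtain b where b: "b \<in> carrier R" "\<tau> b \<noteq> b" by blast
    let ?bad = "\<lambda>\<sigma>. {c \<in> K. \<sigma> (a \<oplus> c \<otimes> b) = a \<oplus> c \<otimes> b}"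
    have "finite (?bad \<sigma>)" if \<sigma>: "\<sigma> \<in> insert \<tau> T" for \<sigma>
    proof -
      have \<sigma>K: "\<sigma> \<in> Gal K" using \<sigma> insert.prems by auto
      interpret h: ring_hom_ring R R \<sigma> using Gal_hom[OF \<sigma>K] .
      have "c = d" if c: "c \<in> ?bad \<sigma>" and d: "d \<in> ?bad \<sigma>" for c d
      proof (rule ccontr)
        assume "c \<noteq> d"
        have cd: "c \<in> carrier R" "d \<in> carrier R" "\<sigma> c = c" "\<sigma> d = d"
          using c d K_carrier GalD(3)[OF \<sigma>K] by auto
        have e: "\<sigma> a \<oplus> c \<otimes> \<sigma> b = a \<oplus> c \<otimes> b" "\<sigma> a \<oplus> d \<otimes> \<sigma> b = a \<oplus> d \<otimes> b"
          using c d cd a b by auto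
        have sc: "\<sigma> a \<in> carrier R" "\<sigma> b \<in> carrier R" using a b by auto
        \<comment> \<open>Subtracting the two equations eliminates \<open>a\<close>. Two bad scalars
          would thus force \<open>\<sigma>\<close> to fix \<open>b\<close>, and then
          \<open>a\<close> too.\<close>
        have "(c \<ominus> d) \<otimes> (\<sigma> b \<ominus> b) =
            ((\<sigma> a \<oplus> c \<otimes> \<sigma> b) \<ominus> (a \<oplus> c \<otimes> b)) \<ominus> ((\<sigma> a \<oplus> d \<otimes> \<sigma> b) \<ominus> (a \<oplus> d \<otimes> b))"
          using cd a(1) b(1) sc by algebra
        also have "\<dots> = \<zero>"
          unfolding e using cd a(1) b(1) r_right_minus_eq[of "a \<oplus> c \<otimes> b" "a \<oplus> c \<otimes> b"]
            r_right_minus_eq[of "a \<oplus> d \<otimes> b" "a \<oplus> d \<otimes> b"] r_right_minus_eq[of \<zero> \<zero>] by (simp del: r_right_minus_eq)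
        finally have "c \<ominus> d = \<zero> \<or> \<sigma> b \<ominus> b = \<zero>" using integral[of "c \<ominus> d" "\<sigma> b \<ominus> b"] cd sc b minus_closed by blast
        then have sb: "\<sigma> b = b" using \<open>c \<noteq> d\<close> r_right_minus_eq cd sc b by auto
        then have "\<sigma> \<noteq> \<tau>" using b by auto
        moreover have "\<sigma> a = a" using e(1) sb a(1) b(1) cd sc by simp
        ultimately show False using a(2) \<sigma> by auto
      qed
      then obtain c where "?bad \<sigma> \<subseteq> {c}" by blast
      then show ?thesis using finite_subset[of _ "{c}"] by blast
    qed
    then have "finite (\<Union>\<sigma>\<in>insert \<tau> T. ?bad \<sigma>)" using insert.hyps by blast
    then have "\<not> K \<subseteq> (\<Union>\<sigma>\<in>insert \<tau> T. ?bad \<sigma>)" using assms finite_subset by blast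
    then obtain c where c: "c \<in> K" "c \<notin> (\<Union>\<sigma>\<in>insert \<tau> T. ?bad \<sigma>)" by blast
    then have "\<forall>\<sigma> \<in> insert \<tau> T. \<sigma> (a \<oplus> c \<otimes> b) \<noteq> a \<oplus> c \<otimes> b" by blast
    moreover have "a \<oplus> c \<otimes> b \<in> carrier R" using a b c K_carrier by auto
    ultimately show ?case by blast
  qed
  from this[of "Gal K - {\<one>\<^bsub>A\<^esub>}"] show ?thesis using finite_Gal by blast
qed

text \<open>Only the identity fixes \<open>a\<close>, so the Galois group over the simple extension
  by \<open>a\<close> is trivial and that extension is everything. Likewise the values at
  \<open>a\<close> separate the elements of the Galois group over \<open>E\<close>, and they are
  roots of \<open>Irr E a\<close>.\<close>

lemma primitive_simple_extension:
  assumes a: "a \<in> carrier R" "\<forall>\<sigma> \<in> Gal K. \<sigma> a = a \<longrightarrow> \<sigma> = \<one>\<^bsub>A\<^esub>"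
    and E: "subfield E R" "K \<subseteq> E"
  shows "dimension (degree (Irr E a)) E (carrier R)"
    and "card (Gal E) \<le> degree (Irr E a)"
proof -
  interpret A: group A by (rule group_A)
  have alg: "(algebraic over E) a" using algebraic_mono[OF E(2)] splits[OF a(1)] by auto
  let ?E = "simple_extension E a"
  have EE: "subfield ?E R" using simple_extension_is_subfield[OF E(1) a(1)] alg by simp
  have incl: "E \<subseteq> ?E" using simple_extension_incl[OF subfieldE(3)[OF E(1)] a(1)] .
  have mem: "a \<in> ?E" using simple_extension_mem[OF subfieldE(1)[OF E(1)] a(1)] .
  have "x \<in> ?E" if x: "x \<in> carrier R" for x
  proof (rule fixed_field[OF EE _ x])
    show "K \<subseteq> ?E" using E(2) incl by auto
    fix \<sigma> assume \<sigma>: "\<sigma> \<in> Gal ?E"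
    then have "\<sigma> \<in> Gal K" using galois_group_mono[of K ?E] E(2) incl by auto
    then have "\<sigma> = \<one>\<^bsub>A\<^esub>" using a(2) GalD(3)[OF \<sigma> mem] by auto
    then show "\<sigma> x = x" using one_apply[OF x] by simp
  qed
  then have "?E = carrier R" using subfieldE(3)[OF EE] by auto
  then show "dimension (degree (Irr E a)) E (carrier R)" using dimension_simple_extension[OF E(1) a(1) alg] by simp
  have irr: "Irr E a \<in> carrier (E[X])" "is_root (Irr E a) a" "Irr E a \<noteq> []"
    using IrrE[OF E(1) a(1) alg] Irr_not_Nil[OF E(1) a(1) alg] a(1) unfolding is_root_def by auto
  have irrR: "Irr E a \<in> carrier (poly_ring R)" using carrier_polynomial_shell[OF subfieldE(1)[OF E(1)] irr(1)] .
  have EK: "Gal E \<subseteq> Gal K" using galois_group_mono[OF E(2)] .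
  have "inj_on (\<lambda>\<sigma>. \<sigma> a) (Gal E)"
  proof (rule inj_onI)
    fix \<sigma> \<tau> assume st: "\<sigma> \<in> Gal E" "\<tau> \<in> Gal E" "\<sigma> a = \<tau> a"
    then have stK: "\<sigma> \<in> Gal K" "\<tau> \<in> Gal K" using EK by auto
    have "(inv\<^bsub>A\<^esub> \<sigma> \<otimes>\<^bsub>A\<^esub> \<tau>) a = a"
      using mult_apply[of "inv\<^bsub>A\<^esub> \<sigma>" \<tau> a] stK a(1) st(3) inv_apply(1)[OF stK(1) a(1)] by simp
    then have "inv\<^bsub>A\<^esub> \<sigma> \<otimes>\<^bsub>A\<^esub> \<tau> = \<one>\<^bsub>A\<^esub>" using a(2) stK by simp
    then show "\<sigma> = \<tau>" using stK by (metis A.inv_closed A.inv_equality A.inv_inv)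
  qed
  then have "card (Gal E) = card ((\<lambda>\<sigma>. \<sigma> a) ` Gal E)" by (simp add: card_image)
  also have "\<dots> \<le> card {y. is_root (Irr E a) y}"
    using card_roots_le(1)[OF irrR irr(3)] Gal_root[OF _ irr(1) subfieldE(3)[OF E(1)] irr(2)]
    by (intro card_mono) auto
  also have "\<dots> \<le> degree (Irr E a)" using card_roots_le(2)[OF irrR irr(3)] .
  finally show "card (Gal E) \<le> degree (Irr E a)" .
qed

theorem degree_eq_card_Gal:
  assumes "infinite K" and E: "subfield E R" "K \<subseteq> E"
  shows "dimension (card (Gal E)) E (carrier R)"
proof -
  obtain a where a: "a \<in> carrier R" "\<forall>\<sigma> \<in> Gal K. \<sigma> a = a \<longrightarrow> \<sigma> = \<one>\<^bsub>A\<^esub>"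
    using ex_primitive_element[OF assms(1)] by blast
  have "degree (Irr E a) \<le> card (Gal E)"
    using degree_Irr_le_card[OF E subgroup_Gal[OF E(2) subfieldE(3)[OF E(1)]] a(1)] fixed_field[OF E] by blast
  then show ?thesis using primitive_simple_extension[OF a E] by (metis le_antisym)
qed

text \<open>Artin's argument: for a primitive \<open>a\<close>, the order of the Galois group over
  \<open>E\<close> is at most the degree of \<open>Irr E a\<close>, which is at most
  \<open>card H\<close>; and \<open>H\<close> is contained in that group.\<close>

theorem Gal_fixed_field:
  assumes "infinite K" and H: "subgroup H A"
  defines "E \<equiv> {x \<in> carrier R. \<forall>\<sigma>\<in>H. \<sigma> x = x}"
  shows "subfield E R" "K \<subseteq> E" "Gal E = H"
proof -
  have HK: "H \<subseteq> Gal K" using subgroup.subset[OF H] .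
  show E: "subfield E R" unfolding E_def using subfield_fixed[OF HK] .
  show KE: "K \<subseteq> E" unfolding E_def using GalD(3) HK K_carrier by auto
  obtain a where a: "a \<in> carrier R" "\<forall>\<sigma> \<in> Gal K. \<sigma> a = a \<longrightarrow> \<sigma> = \<one>\<^bsub>A\<^esub>"
    using ex_primitive_element[OF assms(1)] by blast
  have "degree (Irr E a) \<le> card H"
    using degree_Irr_le_card[OF E KE H a(1)] unfolding E_def by blast
  then have "card (Gal E) \<le> card H" using primitive_simple_extension(2)[OF a E KE] by simp
  moreover have "H \<subseteq> Gal E" using HK unfolding E_def galois_group_iff subset_iff by blast
  moreover have "finite (Gal E)" using finite_subset[OF galois_group_mono[OF KE] finite_Gal] .
  ultimately show "Gal E = H" using card_seteq by blast
qed

end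

section \<open>Valuations\<close>

lemma (in ring) a_inv_consistent:
  assumes "subring S R" "x \<in> S"
  shows "\<ominus>\<^bsub>R\<lparr>carrier := S\<rparr>\<^esub> x = \<ominus> x"
proof -
  interpret S: ring "R\<lparr>carrier := S\<rparr>" using subring_is_ring[OF assms(1)] .
  have c: "\<ominus>\<^bsub>R\<lparr>carrier := S\<rparr>\<^esub> x \<in> S" using S.a_inv_closed[of x] assms(2) by simp
  have "\<ominus>\<^bsub>R\<lparr>carrier := S\<rparr>\<^esub> x \<oplus> x = \<zero>" using S.l_neg[of x] assms(2) by simp
  then show ?thesis using minus_equality c subringE(1)[OF assms(1)] assms(2) by (metis subsetD)
qed

lemma (in ring) a_minus_consistent:
  assumes "subring S R" "x \<in> S" "y \<in> S"
  shows "x \<ominus>\<^bsub>R\<lparr>carrier := S\<rparr>\<^esub> y = x \<ominus> y"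
  using a_inv_consistent[OF assms(1,3)] by (simp add: a_minus_def)

context discretely_valued_field
begin

text \<open>The value \<open>v \<zero>\<close> carries no meaning. Building in the convention for
  \<open>\<zero>\<close> and membership in the carrier lets sums and products be estimated without
  case distinctions.\<close>

definition vge :: "int \<Rightarrow> 'a \<Rightarrow> bool"
  where "vge n x \<longleftrightarrow> x \<in> carrier R \<and> (x = \<zero> \<or> v x \<ge> n)"

lemma v_one: "v \<one> = 0"
  using val_mult[of \<one> \<one>] by simp

lemma v_pow: "x \<in> carrier R \<Longrightarrow> x \<noteq> \<zero> \<Longrightarrow> v (x [^] (n::nat)) = int n * v x \<and> x [^] n \<noteq> \<zero>"
proof (induction n)
  case 0
  then show ?case using v_one by simp
next
  case (Suc n)
  then show ?case using val_mult[of "x [^] n" x] by (auto simp: integral_iff algebra_simps)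
qed

lemma v_inv: "x \<in> carrier R \<Longrightarrow> x \<noteq> \<zero> \<Longrightarrow> v (inv x) = - v x"
proof -
  assume x: "x \<in> carrier R" "x \<noteq> \<zero>"
  then have u: "x \<in> Units R" using field_Units by simp
  then have "x \<otimes> inv x = \<one>" "inv x \<in> carrier R" by simp_all
  moreover from this have "inv x \<noteq> \<zero>" using x(1) one_not_zero r_null by metis
  ultimately show ?thesis using val_mult[of x "inv x"] x v_one by simp
qed

lemma v_minus: 
  assumes "x \<in> carrier R"
  shows "v (\<ominus> x) = v x"
proof (cases "x = \<zero>")
  case False
  have nz: "\<ominus> \<one> \<noteq> \<zero>" using l_neg[of \<one>] by (metis add.inv_eq_1_iff one_closed one_not_zero)
  have "(\<ominus> \<one>) \<otimes> (\<ominus> \<one>) = \<one>" by algebra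
  then have "v (\<ominus> \<one>) = 0" using val_mult[of "\<ominus> \<one>" "\<ominus> \<one>"] nz v_one by simp
  moreover have "\<ominus> x = (\<ominus> \<one>) \<otimes> x" using assms by algebra
  ultimately show ?thesis using val_mult[of "\<ominus> \<one>" x] nz False assms by simp
qed simp

lemma vge_carrier: "vge n x \<Longrightarrow> x \<in> carrier R"
  unfolding vge_def by simp

lemma vge_zero [simp]: "vge n \<zero>"
  unfolding vge_def by simp

lemma vge_mono: "vge n x \<Longrightarrow> m \<le> n \<Longrightarrow> vge m x"
  unfolding vge_def by auto

lemma vge_add: "vge n x \<Longrightarrow> vge n y \<Longrightarrow> vge n (x \<oplus> y)"
proof -
  assume xy: "vge n x" "vge n y"
  show "vge n (x \<oplus> y)"
  proof (cases "x = \<zero> \<or> y = \<zero> \<or> x \<oplus> y = \<zero>")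
    case True
    then show ?thesis using xy unfolding vge_def by auto
  next
    case False
    then show ?thesis using xy val_add[of x y] unfolding vge_def by auto
  qed
qed

lemma vge_mult: "vge n x \<Longrightarrow> vge m y \<Longrightarrow> vge (n + m) (x \<otimes> y)"
  using val_mult[of x y] unfolding vge_def by (cases "x = \<zero> \<or> y = \<zero>") auto

lemma vge_minus: "vge n x \<Longrightarrow> vge n (\<ominus> x)"
  unfolding vge_def using v_minus by auto

lemma vge_diff: "vge n x \<Longrightarrow> vge n y \<Longrightarrow> vge n (x \<ominus> y)"
  unfolding a_minus_def by (intro vge_add vge_minus)

lemma vge_all: "(\<And>n. vge n x) \<Longrightarrow> x = \<zero>"
  unfolding vge_def by (metis add.commute less_add_one not_le)

lemma ex_vge: "x \<in> carrier R \<Longrightarrow> \<exists>n. vge n x"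
  unfolding vge_def by auto

text \<open>The easy half of comparing norms: the linear combination loses at most the worst
  valuation among the \<open>Us\<close>, uniformly in the coefficients.\<close>

lemma combine_vge:
  assumes "set Us \<subseteq> carrier R"
  shows "\<exists>D. \<forall>Ks n. length Ks = length Us \<longrightarrow> (\<forall>k\<in>set Ks. vge n k) \<longrightarrow> vge (n - D) (combine Ks Us)"
  using assms
proof (induction Us)
  case Nil
  then show ?case by auto
next
  case (Cons u Us)
  then obtain D where D: "\<And>Ks n. length Ks = length Us \<Longrightarrow> (\<forall>k\<in>set Ks. vge n k) \<Longrightarrow> vge (n - D) (combine Ks Us)"
    by auto
  obtain d where d: "vge d u" using ex_vge Cons.prems by auto
  have "vge (n - max D (- d)) (combine Ks (u # Us))"
    if len: "length Ks = length (u # Us)" and ks: "\<forall>k\<in>set Ks. vge n k" for Ks n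
  proof -
    obtain k Ks' where Ks: "Ks = k # Ks'" using len by (cases Ks) auto
    have "vge (n - max D (- d)) (k \<otimes> u)"
      using vge_mono[OF vge_mult[OF _ d, of n k]] ks Ks by auto
    moreover have "vge (n - max D (- d)) (combine Ks' Us)"
      using vge_mono[OF D[of Ks' n]] ks Ks len by auto
    ultimately show ?thesis unfolding Ks by (simp add: vge_add)
  qed
  then show ?case by blast
qed

end

section \<open>Finite-dimensional spaces over a complete subfield\<close>

locale complete_subfield = discretely_valued_field R v for R (structure) and v +
  fixes K
  assumes subfield_K: "subfield K R"
    and complete_K: "val_complete (R\<lparr>carrier := K\<rparr>) v"
begin

lemma limit_in_K:
  assumes s: "\<And>i::nat. s i \<in> K" and cauchy: "\<And>n. \<exists>k. \<forall>i\<ge>k. \<forall>j\<ge>k. vge n (s i \<ominus> s j)"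
  shows "\<exists>l\<in>K. \<forall>n. \<exists>k. \<forall>i\<ge>k. vge n (s i \<ominus> l)"
proof -
  note sub = subfieldE(1)[OF subfield_K]
  have close: "val_close (R\<lparr>carrier := K\<rparr>) v n x y \<longleftrightarrow> vge n (x \<ominus> y)" if "x \<in> K" "y \<in> K" for x y n
    using that a_minus_consistent[OF sub that] subringE(1)[OF sub]
    unfolding val_close_def vge_def by auto
  have "range s \<subseteq> carrier (R\<lparr>carrier := K\<rparr>)" using s by auto
  moreover have "\<forall>n. \<exists>k. \<forall>i\<ge>k. \<forall>j\<ge>k. val_close (R\<lparr>carrier := K\<rparr>) v n (s i) (s j)"
    using cauchy close s by simp
  ultimately have "\<exists>l\<in>carrier (R\<lparr>carrier := K\<rparr>). \<forall>n. \<exists>k. \<forall>i\<ge>k. val_close (R\<lparr>carrier := K\<rparr>) v n (s i) l"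
    using complete_K unfolding val_complete_def by blast
  then show ?thesis using close s by auto
qed

lemma combine_diff:
  assumes "length Ks = length Us" "length Ls = length Us"
    and "set Ks \<subseteq> K" "set Ls \<subseteq> K" "set Us \<subseteq> carrier R"
  shows "combine Ks Us \<ominus> combine Ls Us = combine (map2 (a_minus R) Ks Ls) Us"
  using assms
proof (induction Us arbitrary: Ks Ls)
  case Nil
  then show ?case by (simp add: a_minus_def)
next
  case (Cons u Us)
  obtain k Ks' where Ks: "Ks = k # Ks'" using Cons.prems by (cases Ks) auto
  obtain l Ls' where Ls: "Ls = l # Ls'" using Cons.prems by (cases Ls) auto
  have sub: "K \<subseteq> carrier R" using subfieldE(3)[OF subfield_K] .
  have c: "k \<in> carrier R" "l \<in> carrier R" "u \<in> carrier R"
      "combine Ks' Us \<in> carrier R" "combine Ls' Us \<in> carrier R"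
    using Cons.prems Ks Ls sub by auto
  have "combine Ks (u # Us) \<ominus> combine Ls (u # Us) =
      (k \<ominus> l) \<otimes> u \<oplus> (combine Ks' Us \<ominus> combine Ls' Us)"
    unfolding Ks Ls combine.simps using c by algebra
  then show ?case using Cons.IH[of Ks' Ls'] Cons.prems unfolding Ks Ls by simp
qed

text \<open>All norms on a finite-dimensional space over a complete field are equivalent: if the claim
  failed in the induction step, elements of the span of \<open>Us\<close> would approximate \<open>\<ominus> u\<close> arbitrarily
  well, and their coordinates would converge by the induction hypothesis.\<close>

lemma coordinates_vge:
  assumes "independent K Us"
  shows "\<exists>C. \<forall>Ks n. set Ks \<subseteq> K \<longrightarrow> length Ks = length Us \<longrightarrow> vge n (combine Ks Us) \<longrightarrow>
    (\<forall>k\<in>set Ks. vge (n - C) k)"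
  using assms
proof (induction Us rule: list.induct)
  case Nil
  then show ?case by auto
next
  case (Cons u Us)
  note sub = subfieldE(1)[OF subfield_K] and Kc = subfieldE(3)[OF subfield_K]
  have ind: "independent K Us" and u: "u \<notin> Span K Us"
    using independent_backwards[OF Cons.prems] by auto
  have uc: "u \<in> carrier R" and Usc: "set Us \<subseteq> carrier R"
    using independent_in_carrier[OF Cons.prems] by auto
  obtain C where C: "\<And>Ks n k. set Ks \<subseteq> K \<Longrightarrow> length Ks = length Us \<Longrightarrow> vge n (combine Ks Us) \<Longrightarrow>
      k \<in> set Ks \<Longrightarrow> vge (n - C) k"
    using Cons.IH[OF ind] by blast
  obtain D where D: "\<And>Ks n. length Ks = length Us \<Longrightarrow> (\<forall>k\<in>set Ks. vge n k) \<Longrightarrow> vge (n - D) (combine Ks Us)"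
    using combine_vge[OF Usc] by blast
  have cc: "combine Ks Us \<in> carrier R" if "set Ks \<subseteq> K" for Ks using that Kc Usc by auto
  have "\<exists>B. \<forall>Ks. set Ks \<subseteq> K \<longrightarrow> length Ks = length Us \<longrightarrow> \<not> vge B (u \<oplus> combine Ks Us)"
  proof (rule ccontr)
    assume "\<not> ?thesis"
    then have "\<forall>i::nat. \<exists>Ks. set Ks \<subseteq> K \<and> length Ks = length Us \<and> vge (int i) (u \<oplus> combine Ks Us)" by blast
    then obtain Q where Q: "\<And>i::nat. set (Q i) \<subseteq> K" "\<And>i. length (Q i) = length Us"
        "\<And>i. vge (int i) (u \<oplus> combine (Q i) Us)" by metis
    have diff: "vge n (combine (Q i) Us \<ominus> combine (Q j) Us)" if "n \<le> int i" "n \<le> int j" for i j n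
    proof -
      have "vge n ((u \<oplus> combine (Q i) Us) \<ominus> (u \<oplus> combine (Q j) Us))"
        using Q(3) that by (intro vge_diff) (auto intro: vge_mono)
      moreover have "(u \<oplus> combine (Q i) Us) \<ominus> (u \<oplus> combine (Q j) Us) = combine (Q i) Us \<ominus> combine (Q j) Us"
        using uc cc[OF Q(1)[of i]] cc[OF Q(1)[of j]] by algebra
      ultimately show ?thesis by simp
    qed
    have coord: "vge (n - C) (Q i ! p \<ominus> Q j ! p)" if "n \<le> int i" "n \<le> int j" "p < length Us" for i j n p
    proof -
      have s1: "set (map2 (a_minus R) (Q i) (Q j)) \<subseteq> K"
      proof
        fix x assume "x \<in> set (map2 (a_minus R) (Q i) (Q j))"
        then obtain a b where ab: "(a, b) \<in> set (zip (Q i) (Q j))" "x = a \<ominus> b" by auto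
        then have "a \<in> K" "b \<in> K" using set_zip_leftD set_zip_rightD Q(1) by (metis subsetD)+
        then show "x \<in> K" unfolding ab(2) a_minus_def using subringE(5,7)[OF sub] by blast
      qed
      have s2: "vge n (combine (map2 (a_minus R) (Q i) (Q j)) Us)"
        using diff[OF that(1,2)] combine_diff[OF Q(2) Q(2) Q(1) Q(1) Usc] by simp
      have s3: "Q i ! p \<ominus> Q j ! p \<in> set (map2 (a_minus R) (Q i) (Q j))"
        using that(3) Q(2) by (auto simp: set_conv_nth intro!: exI[of _ p])
      show ?thesis using C[OF s1 _ s2 s3] Q(2) by simp
    qed
    have "\<exists>l\<in>K. \<forall>n. \<exists>k. \<forall>i\<ge>k. vge n (Q i ! p \<ominus> l)" if p: "p < length Us" for p
    proof (rule limit_in_K)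
      show "Q i ! p \<in> K" for i using Q(1)[of i] Q(2)[of i] p by (auto simp: subset_iff)
      show "\<exists>k. \<forall>i\<ge>k. \<forall>j\<ge>k. vge n (Q i ! p \<ominus> Q j ! p)" for n
        using coord[of "n + C" _ _ p] p by (intro exI[of _ "nat (n + C)"]) (auto simp: nat_le_iff)
    qed
    then obtain l where l: "\<And>p. p < length Us \<Longrightarrow> l p \<in> K"
      "\<And>p n. p < length Us \<Longrightarrow> \<exists>k. \<forall>i\<ge>k. vge n (Q i ! p \<ominus> l p)" by metis
    let ?L = "map l [0..<length Us]"
    have LK: "set ?L \<subseteq> K" using l(1) by auto
    have "vge n (u \<oplus> combine ?L Us)" for n
    proof -
      have "\<forall>p\<in>{..<length Us}. eventually (\<lambda>i. vge (n + D) (Q i ! p \<ominus> l p)) sequentially"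
        using l(2) unfolding eventually_sequentially by auto
      then have "eventually (\<lambda>i. \<forall>p\<in>{..<length Us}. vge (n + D) (Q i ! p \<ominus> l p)) sequentially"
        by (intro eventually_ball_finite) auto
      then obtain k where k: "\<And>i p. i \<ge> k \<Longrightarrow> p < length Us \<Longrightarrow> vge (n + D) (Q i ! p \<ominus> l p)"
        unfolding eventually_sequentially by auto
      \<comment> \<open>Large enough for two approximations: the coordinates are within
        \<open>n + D\<close> of their limits, and the combination is within \<open>n\<close> of
        \<open>\<ominus> u\<close>.\<close>
      let ?i = "max k (nat n)"
      have "\<forall>x\<in>set (map2 (a_minus R) (Q ?i) ?L). vge (n + D) x"
        using k[of ?i] Q(2)[of ?i] by (auto simp: set_zip)
      then have "vge n (combine (map2 (a_minus R) (Q ?i) ?L) Us)" using D[of "map2 (a_minus R) (Q ?i) ?L" "n + D"] Q(2) by simp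
      then have "vge n (combine (Q ?i) Us \<ominus> combine ?L Us)"
        using combine_diff[OF Q(2) _ Q(1) LK Usc] by simp
      moreover have "vge n (u \<oplus> combine (Q ?i) Us)" using vge_mono[OF Q(3)] by simp
      ultimately have "vge n ((u \<oplus> combine (Q ?i) Us) \<ominus> (combine (Q ?i) Us \<ominus> combine ?L Us))"
        by (rule vge_diff[rotated])
      moreover have "(u \<oplus> combine (Q ?i) Us) \<ominus> (combine (Q ?i) Us \<ominus> combine ?L Us) = u \<oplus> combine ?L Us"
        using uc cc[OF Q(1)[of ?i]] cc[OF LK] by algebra
      ultimately show ?thesis by simp
    qed
    then have "u \<oplus> combine ?L Us = \<zero>" by (rule vge_all)
    then have "u = \<ominus> combine ?L Us" using uc cc[OF LK] by (metis minus_equality a_comm minus_minus)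
    moreover have "combine ?L Us \<in> Span K Us"
      using Span_mem_iff_length_version[OF subfield_K Usc] LK by (metis length_map length_upt minus_nat.diff_0)
    ultimately show False using u Span_subgroup_props(4)[OF subfield_K Usc] by metis
  qed
  then obtain B where B: "\<And>Ks. set Ks \<subseteq> K \<Longrightarrow> length Ks = length Us \<Longrightarrow> \<not> vge B (u \<oplus> combine Ks Us)" by blast
  obtain d where d: "vge d u" using ex_vge uc by blast
  \<comment> \<open>\<open>B\<close> bounds the loss in the coefficient of \<open>u\<close>. The
    other coordinates lose \<open>C\<close> with respect to the valuation of the rest of the
    combination, which is known only up to the smaller of \<open>n\<close> and
    \<open>n - B + d\<close>, the latter coming from the term in \<open>u\<close>.\<close>
  define C' where "C' = max B (max C (C + B - d))"
  have "vge (n - C') k'" if ks: "set Ks \<subseteq> K" "length Ks = length (u # Us)" "vge n (combine Ks (u # Us))"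
    and k': "k' \<in> set Ks" for Ks n k'
  proof -
    obtain k Ks' where Ks: "Ks = k # Ks'" using ks(2) by (cases Ks) auto
    have k: "k \<in> K" "k \<in> carrier R" and ks': "set Ks' \<subseteq> K" "length Ks' = length Us" using ks Ks Kc by auto
    let ?w = "combine Ks' Us"
    have w: "?w \<in> carrier R" using cc[OF ks'(1)] .
    have ge: "vge n (k \<otimes> u \<oplus> ?w)" using ks(3) Ks by simp
    have vk: "vge (n - B) k"
    proof (rule ccontr)
      assume "\<not> ?thesis"
      then have k0: "k \<noteq> \<zero>" and vk: "v k < n - B" using k unfolding vge_def by auto
      have ik: "inv k \<in> K" "inv k \<in> carrier R" "inv k \<noteq> \<zero>" "inv k \<otimes> k = \<one>"
        using subfield_m_inv[OF subfield_K, of k] k k0 Kc by auto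
      \<comment> \<open>Dividing by a coefficient of too small valuation would bring
        \<open>u\<close> plus a combination of \<open>Us\<close> closer to \<open>\<zero>\<close>
        than \<open>B\<close> allows.\<close>
      have "vge (- v k + n) (inv k \<otimes> (k \<otimes> u \<oplus> ?w))"
        using vge_mult[OF _ ge, of "- v k" "inv k"] ik v_inv[OF k(2) k0] unfolding vge_def by simp
      moreover have "inv k \<otimes> (k \<otimes> u \<oplus> ?w) = u \<oplus> combine (map ((\<otimes>) (inv k)) Ks') Us"
        using combine_r_distr[of Ks' Us "inv k"] ik k uc w ks'(1) Kc Usc
        by (simp add: r_distr m_assoc[symmetric])
      ultimately have "vge B (u \<oplus> combine (map ((\<otimes>) (inv k)) Ks') Us)" using vk by (auto intro: vge_mono)
      moreover have "set (map ((\<otimes>) (inv k)) Ks') \<subseteq> K" using ik(1) ks'(1) subringE(6)[OF sub] by auto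
      ultimately show False using B ks'(2) by simp
    qed
    have "vge (min n (n - B + d)) ((k \<otimes> u \<oplus> ?w) \<ominus> k \<otimes> u)"
      using vge_mono[OF ge] vge_mono[OF vge_mult[OF vk d]] by (intro vge_diff) auto
    moreover have "(k \<otimes> u \<oplus> ?w) \<ominus> k \<otimes> u = ?w" using k uc w by algebra
    ultimately have "vge (min n (n - B + d) - C) x" if "x \<in> set Ks'" for x using C[OF ks' _ that] by simp
    moreover have "n - C' \<le> min n (n - B + d) - C" "n - C' \<le> n - B" unfolding C'_def by auto
    ultimately show ?thesis using k' vk vge_mono unfolding Ks set_simps by blast
  qed
  then show ?case by blast
qed

text \<open>Comparison with coordinates shows that \<open>\<sigma>\<close> lowers valuations by at
  most the constant \<open>C + D\<close>. Applied to the power \<open>x [^] m\<close>, a loss of 1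
  at \<open>x\<close> would become a loss of \<open>m\<close>, which is unbounded.\<close>

lemma automorphism_preserves_v:
  assumes fin: "finite_dimension K (carrier R)"
    and \<sigma>: "\<sigma> \<in> ring_hom R R" "\<And>x. x \<in> K \<Longrightarrow> \<sigma> x = x" and x: "x \<in> carrier R" "x \<noteq> \<zero>"
  shows "v x \<le> v (\<sigma> x)"
proof -
  interpret h: ring_hom_ring R R \<sigma> using ring_hom_ringI2[OF ring_axioms ring_axioms \<sigma>(1)] .
  have inj: "inj_on \<sigma> (carrier R)" using non_trivial_field_hom_is_inj[OF \<sigma>(1) field_axioms field_axioms] .
  note Kc = subfieldE(3)[OF subfield_K]
  obtain n where "dimension n K (carrier R)" using fin by auto
  then obtain Us where Us: "set Us \<subseteq> carrier R" "independent K Us" "Span K Us = carrier R"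
    using exists_base[OF subfield_K] by blast
  obtain C where C: "\<And>Ks n k. set Ks \<subseteq> K \<Longrightarrow> length Ks = length Us \<Longrightarrow> vge n (combine Ks Us) \<Longrightarrow>
      k \<in> set Ks \<Longrightarrow> vge (n - C) k"
    using coordinates_vge[OF Us(2)] by blast
  have "set (map \<sigma> Us) \<subseteq> carrier R" using Us(1) h.hom_closed by auto
  then obtain D where D: "\<And>Ks n. length Ks = length Us \<Longrightarrow> (\<forall>k\<in>set Ks. vge n k) \<Longrightarrow>
      vge (n - D) (combine Ks (map \<sigma> Us))"
    using combine_vge[of "map \<sigma> Us"] unfolding length_map by blast
  have bound: "vge (n - C - D) (\<sigma> y)" if y: "vge n y" for n y
  proof -
    have "y \<in> Span K Us" using vge_carrier[OF y] Us(3) by simp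
    then obtain Ks where Ks: "set Ks \<subseteq> K" "length Ks = length Us" "y = combine Ks Us"
      using Span_mem_iff_length_version[OF subfield_K Us(1)] by blast
    have "map \<sigma> Ks = Ks" using Ks(1) \<sigma>(2) by (intro map_idI) auto
    moreover have "set Ks \<subseteq> carrier R" using Ks(1) Kc by auto
    ultimately have "\<sigma> y = combine Ks (map \<sigma> Us)" using h.combine_hom[of Ks Us] Us(1) Ks(3) by simp
    moreover have "\<forall>k\<in>set Ks. vge (n - C) k" using C[OF Ks(1,2)] y Ks(3) by blast
    ultimately show ?thesis using D[OF Ks(2)] by simp
  qed
  have \<sigma>x: "\<sigma> x \<in> carrier R" "\<sigma> x \<noteq> \<zero>"
    using x inj_onD[OF inj, of x \<zero>] by auto
  have mult: "int m * v x - C - D \<le> int m * v (\<sigma> x)" for m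
  proof -
    have "vge (int m * v x) (x [^] m)" using v_pow[OF x, of m] x unfolding vge_def by simp
    then have "vge (int m * v x - C - D) (\<sigma> x [^] m)" using bound h.hom_nat_pow[OF x(1)] by metis
    then show ?thesis using v_pow[OF \<sigma>x, of m] unfolding vge_def by simp
  qed
  show ?thesis
  proof (rule ccontr)
    assume "\<not> ?thesis"
    then have "v (\<sigma> x) + 1 \<le> v x" by simp
    then have "int m * (v (\<sigma> x) + 1) \<le> int m * v x" for m by (intro mult_left_mono) auto
    then have le: "int m * v (\<sigma> x) + int m \<le> int m * v x" for m by (simp add: distrib_left)
    have "int m \<le> C + D" for m using le[of m] mult[of m] by linarith
    \<comment> \<open>The instance 0 shows that \<open>C + D\<close> is nonnegative, so the other
      instance exceeds it.\<close>
    from this[of "nat (C + D) + 1"] this[of 0] show False by simp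
  qed
qed

end

section \<open>Finite fields\<close>

context field
begin

lemma lead_coeff_roots_poly:
  assumes "finite B" "\<And>i. i \<in> B \<Longrightarrow> f i \<in> carrier R"
  shows "lead_coeff (roots_poly f B) = \<one>"
  using assms
proof (induction B)
  case empty
  then show ?case by (simp add: roots_poly_empty)
next
  case (insert i B)
  let ?p = "[\<one>, \<ominus> f i]" and ?q = "roots_poly f B"
  have p: "polynomial (carrier R) ?p" and q: "polynomial (carrier R) ?q"
    using linear_factor_closed[OF carrier_is_subring] roots_poly_closed[OF insert(1) carrier_is_subring] insert.prems
    unfolding univ_poly_carrier by auto
  have "length ?q = Suc (card B)" using length_roots_poly[OF insert(1)] insert.prems by simp
  then have ne: "?q \<noteq> []" by auto
  have "roots_poly f (insert i B) = poly_mult ?p ?q"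
    using roots_poly_insert[OF insert(1,2), of f] insert.prems by (simp add: univ_poly_mult)
  then show ?case
    using poly_mult_lead_coeff[OF carrier_is_subring p q _ ne] insert by (simp del: poly_mult.simps)
qed

text \<open>The leading terms cancel, so \<open>p - p' - e\<close> has degree below
  \<open>q\<close>, yet it vanishes at the at least \<open>q\<close> points of \<open>Z\<close>; it
  is therefore the zero polynomial.\<close>

lemma monic_eval_eq:
  assumes p: "p \<in> carrier (poly_ring R)" "length p = Suc q" "lead_coeff p = \<one>"
    and p': "p' \<in> carrier (poly_ring R)" "length p' = Suc q" "lead_coeff p' = \<one>"
    and e: "e \<in> carrier R" and q: "q > 0"
    and Z: "finite Z" "Z \<subseteq> carrier R" "card Z \<ge> q" "\<And>z. z \<in> Z \<Longrightarrow> eval p z = eval p' z \<oplus> e"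
    and x: "x \<in> carrier R"
  shows "eval p x = eval p' x \<oplus> e"
proof -
  interpret P: domain "poly_ring R" by (rule poly_domain)
  let ?d = "p \<ominus>\<^bsub>poly_ring R\<^esub> p'"
  \<comment> \<open>Normalizing covers \<open>e = \<zero>\<close>, whose constant polynomial is the
    empty list.\<close>
  define c where "c = normalize [e]"
  have c: "c \<in> carrier (poly_ring R)"
    unfolding c_def univ_poly_carrier[symmetric] using e by (intro normalize_gives_polynomial) simp
  define D where "D = ?d \<ominus>\<^bsub>poly_ring R\<^esub> c"
  have D: "D \<in> carrier (poly_ring R)" unfolding D_def using p p' c by simp
  have ev: "eval D z = (eval p z \<ominus> eval p' z) \<ominus> e" if z: "z \<in> carrier R" for z
  proof -
    interpret h: ring_hom_cring "poly_ring R" R "\<lambda>p. eval p z" using eval_cring_hom[OF carrier_is_subring z] .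
    have "eval c z = e" unfolding c_def using eval_normalize[of "[e]" z] e z by simp
    then show ?thesis unfolding D_def using p(1) p'(1) c by (simp add: h.hom_sub del: normalize.simps)
  qed
  have evc: "eval p z \<in> carrier R" "eval p' z \<in> carrier R" if "z \<in> carrier R" for z
    using eval_poly_in_carrier[OF carrier_is_subring _ that] p(1) p'(1) unfolding univ_poly_carrier by auto
  have neg: "\<ominus>\<^bsub>poly_ring R\<^esub> p' = map (\<lambda>a. \<ominus> a) p'" using univ_poly_a_inv_def'[OF carrier_is_subring p'(1)] .
  have sets: "set p \<subseteq> carrier R" "set (map (\<lambda>a. \<ominus> a) p') \<subseteq> carrier R" "set c \<subseteq> carrier R"
    using p(1) p'(1) c unfolding univ_poly_def polynomial_def by auto
  have "length ?d \<le> q"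
  proof -
    obtain a p1 where pa: "p = a # p1" "length p1 = q" using p(2) by (cases p) auto
    obtain b p2 where pb: "p' = b # p2" "length p2 = q" using p'(2) by (cases p') auto
    have ab: "a = \<one>" "b = \<one>" using p(3) p'(3) pa pb by auto
    have "?d = normalize (map2 (\<oplus>) p (map (\<lambda>a. \<ominus> a) p'))"
      unfolding a_minus_def univ_poly_add neg using p(2) p'(2) by simp
    also have "\<dots> = normalize (\<zero> # map2 (\<oplus>) p1 (map (\<lambda>a. \<ominus> a) p2))"
      unfolding pa pb ab by (simp add: r_neg)
    finally have "?d = normalize (map2 (\<oplus>) p1 (map (\<lambda>a. \<ominus> a) p2))" by simp
    then show ?thesis using normalize_length_le[of "map2 (\<oplus>) p1 (map (\<lambda>a. \<ominus> a) p2)"] pa pb by simp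
  qed
  moreover have "length c \<le> q" unfolding c_def using normalize_length_le[of "[e]"] q by simp
  moreover have "length D \<le> max (length ?d) (length c)"
    using poly_add_length_le[of ?d "\<ominus>\<^bsub>poly_ring R\<^esub> c"] univ_poly_a_inv_length[OF carrier_is_subring c]
    unfolding D_def a_minus_def[of "poly_ring R" ?d c] univ_poly_add by simp
  ultimately have len: "length D \<le> q" by simp
  have "D = []"
  proof (rule ccontr)
    assume ne: "D \<noteq> []"
    have "Z \<subseteq> {y. is_root D y}"
    proof
      fix z assume z: "z \<in> Z"
      then have zc: "z \<in> carrier R" using Z(2) by auto
      have "eval D z = ((eval p' z \<oplus> e) \<ominus> eval p' z) \<ominus> e" using ev[OF zc] Z(4)[OF z] by simp
      also have "\<dots> = \<zero>" using evc[OF zc] e by algebra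
      finally show "z \<in> {y. is_root D y}" using zc ne unfolding is_root_def by simp
    qed
    then have "card Z \<le> card {y. is_root D y}" by (rule card_mono[OF card_roots_le(1)[OF D ne]])
    then have "q \<le> degree D" using card_roots_le(2)[OF D ne] Z(3) by linarith
    then show False using len ne q by (cases D) auto
  qed
  then have "(eval p x \<ominus> eval p' x) \<ominus> e = \<zero>" using ev[OF x] by simp
  moreover have "eval p x = ((eval p x \<ominus> eval p' x) \<ominus> e) \<oplus> (eval p' x \<oplus> e)" using evc[OF x] e by algebra
  ultimately show ?thesis using evc[OF x] e by (metis a_closed l_zero)
qed

end

locale finite_field = field R for R (structure) +
  assumes finite_carrier: "finite (carrier R)"
begin

lemma card_subfield_gt_1:
  assumes F: "subfield F R"
  shows "card F > 1"
proof -
  have "{\<zero>, \<one>} \<subseteq> F" using subringE(2,3)[OF subfieldE(1)[OF F]] by auto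
  then have "card {\<zero>, \<one>} \<le> card F"
    using subfieldE(3)[OF F] finite_carrier by (intro card_mono) (auto intro: finite_subset)
  then show ?thesis by simp
qed

lemma pow_card_subfield:
  assumes F: "subfield F R" and c: "c \<in> F"
  shows "c [^] card F = c"
proof (cases "c = \<zero>")
  case True
  then show ?thesis using card_subfield_gt_1[OF F] by (simp add: nat_pow_zero)
next
  case False
  interpret F: field "R\<lparr>carrier := F\<rparr>" using subfield_iff(2)[OF F] .
  interpret G: group "Multiplicative_Group.mult_of (R\<lparr>carrier := F\<rparr>)" by (rule F.field_mult_group)
  have finF: "finite F" using subfieldE(3)[OF F] finite_carrier finite_subset by auto
  have "order (Multiplicative_Group.mult_of (R\<lparr>carrier := F\<rparr>)) = card F - 1"
    using F.order_mult_of finF by (simp add: order_def)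
  moreover have "c [^]\<^bsub>Multiplicative_Group.mult_of (R\<lparr>carrier := F\<rparr>)\<^esub> order (Multiplicative_Group.mult_of (R\<lparr>carrier := F\<rparr>)) = \<one>"
    using G.pow_order_eq_1[of c] c False by simp
  moreover have "x [^]\<^bsub>Multiplicative_Group.mult_of (R\<lparr>carrier := F\<rparr>)\<^esub> (n::nat) = x [^] n" for x n
    by (simp add: nat_pow_def)
  ultimately have "c [^] (card F - 1) = \<one>" by simp
  moreover have "c [^] card F = c [^] (card F - 1) \<otimes> c"
    using card_subfield_gt_1[OF F] by (metis Suc_diff_1 less_imp_le_nat nat_pow_Suc not_less zero_less_one less_trans)
  ultimately show ?thesis using c subfieldE(3)[OF F] by auto
qed

text \<open>The nonzero elements of \<open>F\<close> already account for all the
  \<open>card F - 1\<close> solutions that \<open>x [^] (card F - 1) = \<one>\<close> can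
  have.\<close>

lemma pow_card_subfield_iff:
  assumes F: "subfield F R" and c: "c \<in> carrier R"
  shows "c [^] card F = c \<longleftrightarrow> c \<in> F"
proof
  show "c \<in> F \<Longrightarrow> c [^] card F = c" using pow_card_subfield[OF F] .
  assume *: "c [^] card F = c"
  let ?q = "card F"
  have Fc: "F \<subseteq> carrier R" using subfieldE(3)[OF F] .
  have cf: "x [^] (?q - 1) = \<one>" if "x \<in> carrier R" "x [^] ?q = x" "x \<noteq> \<zero>" for x
  proof -
    have "x [^] ?q = x [^] (?q - 1) \<otimes> x"
      using card_subfield_gt_1[OF F] by (metis Suc_diff_1 less_imp_le_nat nat_pow_Suc not_less zero_less_one less_trans)
    then have "x [^] (?q - 1) \<otimes> x = \<one> \<otimes> x" using that by simp
    then show ?thesis using m_rcancel[OF that(3,1) nat_pow_closed[OF that(1)] one_closed] by blast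
  qed
  let ?W = "{x \<in> carrier R. x [^] (?q - 1) = \<one>}"
  have "F - {\<zero>} \<subseteq> ?W" using cf pow_card_subfield[OF F] Fc by auto
  moreover have "card ?W \<le> card (F - {\<zero>})"
    using num_roots_le_deg[OF finite_carrier, of "?q - 1"] card_subfield_gt_1[OF F]
      subringE(2)[OF subfieldE(1)[OF F]] by simp
  ultimately have "F - {\<zero>} = ?W" using finite_carrier by (intro card_seteq) auto
  then show "c \<in> F" using cf[OF c *] c subringE(2)[OF subfieldE(1)[OF F]] by auto
qed

text \<open>For \<open>y \<noteq> \<zero>\<close> the polynomials \<open>(X + y)\<^sup>q\<close> and \<open>X\<^sup>q + y\<^sup>q\<close> agree at the \<open>q\<close> elements of
  \<open>F y\<close>, and their difference has degree less than \<open>q\<close>.\<close>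

lemma frobenius_add:
  assumes F: "subfield F R" and x: "x \<in> carrier R" and y: "y \<in> carrier R"
  shows "(x \<oplus> y) [^] card F = x [^] card F \<oplus> y [^] card F"
proof (cases "y = \<zero>")
  case True
  then show ?thesis using card_subfield_gt_1[OF F] x by (simp add: nat_pow_zero)
next
  case False
  let ?q = "card F"
  let ?p = "roots_poly (\<lambda>_. \<ominus> y) {..<?q}" and ?p' = "roots_poly (\<lambda>_. \<zero>) {..<?q}"
  have ev: "eval ?p z = (z \<oplus> y) [^] ?q" "eval ?p' z = z [^] ?q" if z: "z \<in> carrier R" for z
    using eval_roots_poly[of "{..<?q}" "\<lambda>_. \<ominus> y" z] eval_roots_poly[of "{..<?q}" "\<lambda>_. \<zero>" z] y z
    by (simp_all add: finprod_const a_minus_def)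
  have Fc: "F \<subseteq> carrier R" using subfieldE(3)[OF F] .
  let ?Z = "(\<lambda>c. c \<otimes> y) ` F"
  have "inj_on (\<lambda>c. c \<otimes> y) F" using Fc False y by (auto intro!: inj_onI simp: m_rcancel subset_iff)
  then have card: "card ?Z = ?q" by (rule card_image)
  have zz: "eval ?p z = eval ?p' z \<oplus> y [^] ?q" if "z \<in> ?Z" for z
  proof -
    obtain c where c: "c \<in> F" "z = c \<otimes> y" using \<open>z \<in> ?Z\<close> by auto
    have cc: "c \<in> carrier R" using c Fc by auto
    have c1: "c \<oplus> \<one> \<in> F" using c subringE(3,7)[OF subfieldE(1)[OF F]] by auto
    have "z \<oplus> y = (c \<oplus> \<one>) \<otimes> y" unfolding c(2) using cc y by algebra
    then have "(z \<oplus> y) [^] ?q = (c \<oplus> \<one>) [^] ?q \<otimes> y [^] ?q" using cc y by (simp add: nat_pow_distrib)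
    also have "\<dots> = (c \<oplus> \<one>) \<otimes> y [^] ?q" using pow_card_subfield[OF F c1] by simp
    also have "\<dots> = c [^] ?q \<otimes> y [^] ?q \<oplus> y [^] ?q" using pow_card_subfield[OF F c(1)] cc y by (simp add: l_distr)
    also have "\<dots> = z [^] ?q \<oplus> y [^] ?q" unfolding c(2) using cc y by (simp add: nat_pow_distrib)
    finally show ?thesis using ev cc y c(2) by simp
  qed
  have fZ: "finite ?Z" "?Z \<subseteq> carrier R" using finite_subset[OF Fc finite_carrier] Fc y by auto
  have "eval ?p x = eval ?p' x \<oplus> y [^] ?q"
  proof (rule monic_eval_eq[where Z = ?Z and q = ?q])
    show "?p \<in> carrier (poly_ring R)" "?p' \<in> carrier (poly_ring R)"
      using y by (auto intro!: roots_poly_closed carrier_is_subring)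
    show "length ?p = Suc ?q" "length ?p' = Suc ?q" using y by (simp_all add: length_roots_poly)
    show "lead_coeff ?p = \<one>" "lead_coeff ?p' = \<one>" using y by (simp_all add: lead_coeff_roots_poly)
    show "?q > 0" using card_subfield_gt_1[OF F] by simp
  qed (use fZ card zz y x in auto)
  then show ?thesis using ev[OF x] by simp
qed

lemma frobenius_hom:
  assumes F: "subfield F R"
  shows "(\<lambda>x. x [^] card F) \<in> ring_hom R R"
  using frobenius_add[OF F] by (intro ring_hom_memI) (auto simp: nat_pow_distrib nat_pow_one)

lemma card_eq_pow_dimension:
  assumes F: "subfield F R" and "dimension n F E"
  shows "card E = card F ^ n"
  using assms(2)
proof (induction n arbitrary: E)
  case 0
  show ?case using dimension_zero[OF F 0] by simp
next
  case (Suc n E')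
  obtain w E where Suc_dim: "w \<in> carrier R" "w \<notin> E" "dimension n F E" and E': "E' = line_extension F w E"
    using dimension_backwards[OF F Suc.prems] by blast
  have Fc: "F \<subseteq> carrier R" using subfieldE(3)[OF F] .
  note sp = space_subgroup_props[OF F Suc_dim(3)]
  have "line_extension F w E = (\<lambda>(k, u). k \<otimes> w \<oplus> u) ` (F \<times> E)"
  proof (intro Set.set_eqI)
    fix u show "u \<in> line_extension F w E \<longleftrightarrow> u \<in> (\<lambda>(k, u). k \<otimes> w \<oplus> u) ` (F \<times> E)"
      unfolding line_extension_mem_iff image_iff by fastforce
  qed
  moreover have "inj_on (\<lambda>(k, u). k \<otimes> w \<oplus> u) (F \<times> E)"
  proof (rule inj_onI, clarify)
    fix k u l s assume k: "k \<in> F" and l: "l \<in> F" and u: "u \<in> E" and s: "s \<in> E"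
      and eq: "k \<otimes> w \<oplus> u = l \<otimes> w \<oplus> s"
    have c: "k \<in> carrier R" "l \<in> carrier R" "u \<in> carrier R" "s \<in> carrier R" "w \<in> carrier R"
      using k l u s Fc sp(1) Suc_dim(1) by auto
    have "(k \<ominus> l) \<otimes> w = (k \<otimes> w \<oplus> u) \<ominus> (l \<otimes> w \<oplus> u)" using c by algebra
    also have "\<dots> = s \<ominus> u" unfolding eq using c by algebra
    finally have "(k \<ominus> l) \<otimes> w \<in> E" using sp(3)[OF s sp(4)[OF u]] by (simp add: a_minus_def)
    moreover have "k \<ominus> l \<in> F" using k l subringE(5,7)[OF subfieldE(1)[OF F]] by (simp add: a_minus_def)
    ultimately have "k \<ominus> l = \<zero>" using sp(6)[of "k \<ominus> l" w] Suc_dim(1,2) by blast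
    then have kl: "k = l" using c by simp
    then show "k = l \<and> u = s" using eq c by simp
  qed
  ultimately have "card (line_extension F w E) = card F * card E"
    by (simp add: card_image card_cartesian_product)
  then show ?case using Suc.IH[OF Suc_dim(3)] E' by simp
qed

lemma ex_dimension:
  assumes F: "subfield F R" and E: "subfield E R" "F \<subseteq> E"
  shows "\<exists>n. dimension n F E"
proof -
  obtain Us where Us: "set Us = E" using finite_list finite_subset[OF subfieldE(3)[OF E(1)] finite_carrier] by metis
  have Ec: "E \<subseteq> carrier R" using subfieldE(3)[OF E(1)] .
  note e = subringE[OF subfieldE(1)[OF E(1)]]
  have "subalgebra F E R"
    unfolding subalgebra_def subalgebra_axioms_def
    using subring.axioms(1)[OF subfieldE(1)[OF E(1)]] e(6) E(2) by auto
  then have "Span F Us \<subseteq> E" using subalgebra_Span_incl[OF F] Us by simp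
  moreover have "E \<subseteq> Span F Us" using Span_base_incl[OF F, of Us] Us Ec by simp
  ultimately have "Span F Us = E" by simp
  then show ?thesis using Span_finite_dimension[OF F, of Us] Us Ec by (auto simp: finite_dimension_def)
qed

lemma dim_eq:
  assumes F: "subfield F R" and E: "subfield E R" "F \<subseteq> E"
  shows "card E = card F ^ ((dim over F) E)"
  using ex_dimension[OF assms] card_eq_pow_dimension[OF F] dimI[OF F] by metis

lemma dim_one_iff:
  assumes F: "subfield F R" and E: "subfield E R" "F \<subseteq> E"
  shows "(dim over F) E = 1 \<longleftrightarrow> E = F"
proof
  assume "(dim over F) E = 1"
  then have "card E = card F" using dim_eq[OF assms] by simp
  then show "E = F"
    using card_subset_eq[OF finite_subset[OF subfieldE(3)[OF E(1)] finite_carrier] E(2)] by simp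
next
  assume "E = F"
  then show "(dim over F) E = 1" using dimI[OF F dimension_one[OF F]] by simp
qed

section \<open>Generators of the multiplicative group and endomorphisms fixing a subfield\<close>

definition "generator g \<longleftrightarrow> g \<in> carrier R \<and> g \<noteq> \<zero> \<and> (\<forall>x\<in>carrier R - {\<zero>}. \<exists>i::nat. x = g [^] i)"

lemma generatorD:
  assumes "generator g"
  shows "g \<in> carrier R" "g \<noteq> \<zero>" "\<And>x. x \<in> carrier R \<Longrightarrow> x \<noteq> \<zero> \<Longrightarrow> \<exists>i::nat. x = g [^] i"
  using assms unfolding generator_def by auto

lemma ex_generator: "\<exists>g. generator g"
proof -
  obtain g where g: "g \<in> carrier (Multiplicative_Group.mult_of R)"
      "carrier (Multiplicative_Group.mult_of R) = {g [^] i | i::nat. i \<in> UNIV}"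
    using finite_field_mult_group_has_gen[OF finite_carrier] by blast
  have "\<exists>i::nat. x = g [^] i" if "x \<in> carrier R" "x \<noteq> \<zero>" for x
  proof -
    have "x \<in> {g [^] i | i::nat. i \<in> UNIV}" using that g(2) by auto
    then show ?thesis by auto
  qed
  then have "generator g" using g(1) unfolding generator_def by auto
  then show ?thesis ..
qed

text \<open>The order of \<open>g\<close> is \<open>card (carrier R) - 1\<close>. The exponents
  range from 1 to that order because they will be powers of the size of a subfield.\<close>

lemma generator_pow_inj:
  assumes "generator g"
    and ij: "1 \<le> i" "i < card (carrier R)" "1 \<le> j" "j < card (carrier R)" "g [^] i = g [^] j"
  shows "i = j"
proof -
  note g = generatorD[OF assms(1)]
  interpret G: group "Multiplicative_Group.mult_of R" by (rule field_mult_group)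
  have gG: "g \<in> carrier (Multiplicative_Group.mult_of R)" using g by simp
  have finG: "finite (carrier (Multiplicative_Group.mult_of R))" using finite_carrier by simp
  have "carrier (Multiplicative_Group.mult_of R) \<subseteq> {g [^]\<^bsub>Multiplicative_Group.mult_of R\<^esub> k | k. k \<in> (UNIV::nat set)}"
    using g(3) by (auto simp: Multiplicative_Group.nat_pow_mult_of)
  then have "carrier (Multiplicative_Group.mult_of R) \<subseteq> generate (Multiplicative_Group.mult_of R) {g}"
    using G.generate_pow_on_finite_carrier[OF finG gG] by simp
  then have "generate (Multiplicative_Group.mult_of R) {g} = carrier (Multiplicative_Group.mult_of R)"
    using G.generate_incl[of "{g}"] gG by blast
  then have "G.ord g = card (carrier R) - 1"
    using G.generate_pow_card[OF gG] order_mult_of[OF finite_carrier] by (simp add: order_def)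
  then have "i \<in> {1..G.ord g}" "j \<in> {1..G.ord g}" using ij by auto
  then show ?thesis
    using inj_onD[OF G.ord_inj'[OF gG], of i j] ij(5) by (simp add: Multiplicative_Group.nat_pow_mult_of)
qed

lemma frobenius_powers_distinct:
  assumes F: "subfield F R" "card (carrier R) = card F ^ f"
    and ij: "i < f" "j < f" "\<And>x. x \<in> carrier R \<Longrightarrow> x [^] (card F ^ i) = x [^] (card F ^ j)"
  shows "i = j"
proof -
  obtain g where gen: "generator g" using ex_generator by blast
  note g = generatorD[OF gen]
  have q: "card F > 1" using card_subfield_gt_1[OF F(1)] .
  then have "card F ^ i < card (carrier R)" "card F ^ j < card (carrier R)"
    using F(2) ij by (simp_all add: power_strict_increasing)
  then have "card F ^ i = card F ^ j"
    using generator_pow_inj[OF gen] q ij(3)[OF g(1)] by (simp add: Suc_le_eq)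
  then show ?thesis using q by simp
qed

lemma hom_eq_on_generator:
  assumes "generator g"
    and t: "\<tau> \<in> ring_hom R R" "\<tau> g = g [^] n" "n > 0" and x: "x \<in> carrier R"
  shows "\<tau> x = x [^] (n::nat)"
proof -
  note g = generatorD[OF assms(1)]
  interpret h: ring_hom_ring R R \<tau> using ring_hom_ringI2[OF ring_axioms ring_axioms t(1)] .
  show ?thesis
  proof (cases "x = \<zero>")
    case True
    then show ?thesis using t(3) by (simp add: nat_pow_zero)
  next
    case False
    then obtain i where "x = g [^] (i::nat)" using g(3) x by blast
    then show ?thesis using h.hom_nat_pow[OF g(1)] t(2) g(1) by (simp add: nat_pow_pow mult.commute)
  qed
qed

text \<open>The product of X - g^(q^j) over \<open>j < f\<close>, with \<open>q = card F\<close>, is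
  invariant under the Frobenius map, so its coefficients lie in \<open>F\<close> and
  \<open>\<tau>\<close> fixes them. Hence \<open>\<tau> g\<close> is again a root, and the value at
  a generator determines \<open>\<tau>\<close>.\<close>

lemma hom_fixing_subfield:
  assumes F: "subfield F R" "card (carrier R) = card F ^ f"
    and t: "\<tau> \<in> ring_hom R R" "\<And>c. c \<in> F \<Longrightarrow> \<tau> c = c"
  shows "\<exists>j<f. \<forall>x\<in>carrier R. \<tau> x = x [^] (card F ^ j)"
proof -
  let ?q = "card F"
  obtain g where gen: "generator g" using ex_generator by blast
  note g = generatorD[OF gen]
  have q: "?q > 1" using card_subfield_gt_1[OF F(1)] .
  have "f \<noteq> 0" using F(2) card_subfield_gt_1[OF carrier_is_subfield] by (intro notI) simp
  then have f: "f > 0" by simp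
  let ?a = "\<lambda>j. g [^] (?q ^ j)"
  let ?p = "roots_poly ?a {..<f}"
  \<comment> \<open>The Frobenius map shifts the roots cyclically: after \<open>f\<close> steps the
    exponent is the size of the whole field and \<open>g\<close> returns.\<close>
  let ?s = "\<lambda>j. Suc j mod f"
  have ac: "?a j \<in> carrier R" for j using g by simp
  have af: "?a f = g" using pow_card_subfield[OF carrier_is_subfield g(1)] F(2) by simp
  have "inj_on ?s {..<f}"
  proof (rule inj_onI)
    fix i j assume "i \<in> {..<f}" "j \<in> {..<f}" "Suc i mod f = Suc j mod f"
    then show "i = j" by (cases "Suc i = f"; cases "Suc j = f") auto
  qed
  then have bij: "bij_betw ?s {..<f} {..<f}"
    unfolding bij_betw_def using f endo_inj_surj[of "{..<f}" ?s] by (simp add: image_subset_iff)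
  have frob: "(?a j) [^] ?q = ?a (?s j)" if "j \<in> {..<f}" for j
  proof -
    have "(?a j) [^] ?q = ?a (Suc j)" using g(1) by (simp add: nat_pow_pow mult.commute)
    moreover have "?a (Suc j) = ?a (?s j)" using that af g by (cases "Suc j = f") auto
    ultimately show ?thesis by simp
  qed
  have pc: "?p \<in> carrier (poly_ring R)" by (rule roots_poly_closed) (use ac carrier_is_subring in auto)
  have coeff: "c \<in> F" if c: "c \<in> set ?p" for c
  proof -
    have cc: "c \<in> carrier R" using c pc unfolding univ_poly_def polynomial_def by auto
    have "(\<lambda>x. x [^] ?q) c = c"
      using roots_poly_invariant[where f = ?a and B = "{..<f}" and \<pi> = ?s, OF _ _ frobenius_hom[OF F(1)] bij frob c] ac
      by simp
    then show ?thesis using pow_card_subfield_iff[OF F(1) cc] by simp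
  qed
  interpret h: ring_hom_ring R R \<tau> using ring_hom_ringI2[OF ring_axioms ring_axioms t(1)] .
  have "map \<tau> ?p = ?p" using coeff t(2) by (intro map_idI) auto
  moreover have "set ?p \<subseteq> carrier R" using pc unfolding univ_poly_def polynomial_def by auto
  ultimately have "eval ?p (\<tau> g) = \<tau> (eval ?p g)" using h.eval_hom'[OF g(1), of ?p] by simp
  also have "eval ?p g = \<zero>"
  proof -
    have "\<exists>j\<in>{..<f}. g = ?a j" using f g(1) by (intro bexI[of _ 0]) auto
    then show ?thesis using eval_roots_poly_zero_iff[of "{..<f}" ?a g] ac g(1) by simp
  qed
  finally have "eval ?p (\<tau> g) = \<zero>" by simp
  then obtain j where j: "j < f" "\<tau> g = ?a j"
    using eval_roots_poly_zero_iff[of "{..<f}" ?a "\<tau> g"] ac h.hom_closed[OF g(1)] by auto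
  have "?q ^ j > 0" using q by simp
  then show ?thesis using hom_eq_on_generator[OF gen t(1) j(2)] j(1) by blast
qed

end

section \<open>Residue fields\<close>

context discretely_valued_field
begin

abbreviation "\<O> \<equiv> val_ring R v"
abbreviation "\<mm> \<equiv> val_ideal R v"
abbreviation "k \<equiv> residue_field R v"
abbreviation "\<kappa> \<equiv> residue_subfield R v"

text \<open>The coset is taken in the ambient field, to match \<open>residue_subfield\<close>; it
  agrees with the coset in the valuation ring, from which the residue field is built.\<close>

definition "red x = \<mm> +> x"

lemma O_iff: "x \<in> \<O> \<longleftrightarrow> vge 0 x" and m_iff: "x \<in> \<mm> \<longleftrightarrow> vge 1 x"
  unfolding val_ring_def val_ideal_def vge_def by auto

lemma O_carrier: "\<O> \<subseteq> carrier R" and m_sub: "\<mm> \<subseteq> \<O>"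
  unfolding val_ring_def val_ideal_def by auto

lemma subring_O: "subring \<O> R"
proof (rule subringI)
  show "\<one> \<in> \<O>" using v_one unfolding O_iff vge_def by simp
  show "h1 \<otimes> h2 \<in> \<O>" if "h1 \<in> \<O>" "h2 \<in> \<O>" for h1 h2
    using vge_mult[of 0 h1 0 h2] that unfolding O_iff by simp
qed (auto simp: O_iff intro: vge_minus vge_add vge_carrier)

lemma cring_O: "cring (R\<lparr>carrier := \<O>\<rparr>)"
  using subring_is_domain[OF subring_O] domain.axioms(1) by blast

lemma unit_O: "x \<in> \<O> - \<mm> \<longleftrightarrow> x \<in> carrier R \<and> x \<noteq> \<zero> \<and> v x = 0"
  unfolding val_ring_def val_ideal_def by auto

lemma inv_unit_O: "x \<in> \<O> - \<mm> \<Longrightarrow> inv x \<in> \<O>"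
  using v_inv field_Units unfolding unit_O O_iff vge_def by auto

lemma ideal_m: "ideal \<mm> (R\<lparr>carrier := \<O>\<rparr>)"
proof -
  interpret RO: cring "R\<lparr>carrier := \<O>\<rparr>" by (rule cring_O)
  show ?thesis
  proof (rule idealI)
    show "subgroup \<mm> (add_monoid (R\<lparr>carrier := \<O>\<rparr>))"
    proof (rule group.subgroupI[OF RO.a_group])
      show "\<mm> \<subseteq> carrier (add_monoid (R\<lparr>carrier := \<O>\<rparr>))" using m_sub by simp
      show "\<mm> \<noteq> {}" using vge_zero m_iff by blast
      fix a assume a: "a \<in> \<mm>"
      have "\<ominus>\<^bsub>R\<lparr>carrier := \<O>\<rparr>\<^esub> a = \<ominus> a"
        using a_inv_consistent[OF subring_O, of a] a m_sub by blast
      then show "inv\<^bsub>add_monoid (R\<lparr>carrier := \<O>\<rparr>)\<^esub> a \<in> \<mm>"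
        using a vge_minus unfolding m_iff a_inv_def by simp
      fix b assume "b \<in> \<mm>"
      then show "a \<otimes>\<^bsub>add_monoid (R\<lparr>carrier := \<O>\<rparr>)\<^esub> b \<in> \<mm>" using a vge_add unfolding m_iff by simp
    qed
    fix a x assume "a \<in> \<mm>" "x \<in> carrier (R\<lparr>carrier := \<O>\<rparr>)"
    then have ax: "vge 1 a" "vge 0 x" using m_iff O_iff by auto
    show "x \<otimes>\<^bsub>R\<lparr>carrier := \<O>\<rparr>\<^esub> a \<in> \<mm>" "a \<otimes>\<^bsub>R\<lparr>carrier := \<O>\<rparr>\<^esub> x \<in> \<mm>"
      using vge_mult[OF ax] vge_mult[OF ax(2,1)] unfolding m_iff by simp_all
  qed (rule RO.ring_axioms)
qed

lemma red_def': "red = a_r_coset (R\<lparr>carrier := \<O>\<rparr>) \<mm>"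
  unfolding red_def a_r_coset_def r_coset_def by simp

lemma red_hom: "red \<in> ring_hom (R\<lparr>carrier := \<O>\<rparr>) k"
  unfolding red_def' residue_field_def using ideal.rcos_ring_hom[OF ideal_m] .

lemma carrier_k: "carrier k = red ` \<O>"
  unfolding residue_field_def red_def' FactRing_def A_RCOSETS_def' by auto

lemma red_eq_iff: "x \<in> \<O> \<Longrightarrow> y \<in> \<O> \<Longrightarrow> red x = red y \<longleftrightarrow> x \<ominus> y \<in> \<mm>"
  unfolding red_def'
  using ring.quotient_eq_iff_same_a_r_cos[OF cring.axioms(1)[OF cring_O] ideal_m, of x y]
    a_minus_consistent[OF subring_O, of x y] by simp

lemma zero_k: "\<zero>\<^bsub>k\<^esub> = \<mm>" and one_k: "\<one>\<^bsub>k\<^esub> = red \<one>"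
  unfolding residue_field_def FactRing_def red_def' by simp_all

lemma red_zero: "red \<zero> = \<zero>\<^bsub>k\<^esub>"
proof -
  have "\<mm> \<subseteq> carrier R" using m_sub O_carrier by auto
  then show ?thesis unfolding zero_k red_def by (rule add.coset_mult_one[simplified, folded a_r_coset_def])
qed

lemma red_zero_iff: "x \<in> \<O> \<Longrightarrow> red x = \<zero>\<^bsub>k\<^esub> \<longleftrightarrow> x \<in> \<mm>"
  using red_eq_iff[of x \<zero>] subringE(2)[OF subring_O] red_zero O_carrier by (auto simp: a_minus_def subset_iff)

lemma red_simps:
  assumes "x \<in> \<O>" "y \<in> \<O>"
  shows "red (x \<otimes> y) = red x \<otimes>\<^bsub>k\<^esub> red y" "red (x \<oplus> y) = red x \<oplus>\<^bsub>k\<^esub> red y"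
  using ring_hom_memE(2,3)[OF red_hom] assms by simp_all

lemma red_closed: "x \<in> \<O> \<Longrightarrow> red x \<in> carrier k"
  unfolding carrier_k by simp

lemma field_k: "field k"
proof -
  interpret k: cring k unfolding residue_field_def using ideal.quotient_is_cring[OF ideal_m cring_O] .
  have nz: "\<one>\<^bsub>k\<^esub> \<noteq> \<zero>\<^bsub>k\<^esub>"
    using red_zero_iff[OF subringE(3)[OF subring_O]] one_k v_one unfolding m_iff vge_def by simp
  have "\<exists>b\<in>carrier k. c \<otimes>\<^bsub>k\<^esub> b = \<one>\<^bsub>k\<^esub>" if c: "c \<in> carrier k" "c \<noteq> \<zero>\<^bsub>k\<^esub>" for c
  proof -
    obtain x where x: "x \<in> \<O>" "c = red x" using c unfolding carrier_k by auto
    then have xu: "x \<in> \<O> - \<mm>" using c(2) red_zero_iff by auto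
    then have xR: "x \<in> carrier R" "x \<noteq> \<zero>" unfolding unit_O by auto
    have "red x \<otimes>\<^bsub>k\<^esub> red (inv x) = \<one>\<^bsub>k\<^esub>"
      using red_simps(1)[OF x(1) inv_unit_O[OF xu]] xR field_Units one_k by (simp add: Units_r_inv)
    moreover have "red (inv x) \<in> carrier k" using red_closed[OF inv_unit_O[OF xu]] .
    ultimately show ?thesis using x(2) by auto
  qed
  then show ?thesis using k.cring_fieldI2 nz by metis
qed

sublocale residue: field "residue_field R v" by (rule field_k)

lemma residue_subfield_eq: "\<kappa> M = red ` (M \<inter> \<O>)"
  unfolding residue_subfield_def red_def ..

lemma subfield_residue_subfield:
  assumes M: "subfield M R"
  shows "subfield (\<kappa> M) k"
proof -
  interpret h: ring_hom_ring "R\<lparr>carrier := \<O>\<rparr>" k red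
    using ring_hom_ringI2[OF cring.axioms(1)[OF cring_O] residue.ring_axioms red_hom] .
  have "ring (R\<lparr>carrier := M \<inter> \<O>\<rparr>)"
    using subring_is_ring[OF subring_inter[OF subfieldE(1)[OF M] subring_O]] .
  then have "subring (M \<inter> \<O>) (R\<lparr>carrier := \<O>\<rparr>)" by (intro h.R.ring_incl_imp_subring) auto
  then have "subring (\<kappa> M) k" unfolding residue_subfield_eq using h.img_is_subring by blast
  moreover have "inv\<^bsub>k\<^esub> c \<in> \<kappa> M" if c: "c \<in> \<kappa> M - {\<zero>\<^bsub>k\<^esub>}" for c
  proof -
    obtain x where x: "x \<in> M" "x \<in> \<O>" "c = red x" using c unfolding residue_subfield_eq by auto
    then have xu: "x \<in> \<O> - \<mm>" using c red_zero_iff by auto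
    then have xR: "x \<in> carrier R" "x \<noteq> \<zero>" unfolding unit_O by auto
    have "red x \<otimes>\<^bsub>k\<^esub> red (inv x) = \<one>\<^bsub>k\<^esub>"
      using red_simps(1)[OF x(2) inv_unit_O[OF xu]] xR field_Units one_k by (simp add: Units_r_inv)
    then have "inv\<^bsub>k\<^esub> c = red (inv x)"
      using residue.comm_inv_char red_closed x inv_unit_O[OF xu] by simp
    moreover have "inv x \<in> M" using subfield_m_inv(1)[OF M, of x] x(1) xR by simp
    ultimately show ?thesis using inv_unit_O[OF xu] unfolding residue_subfield_eq by auto
  qed
  ultimately show ?thesis by (rule residue.subfieldI')
qed

lemma residue_subfield_mono: "M \<subseteq> E \<Longrightarrow> \<kappa> M \<subseteq> \<kappa> E"
  unfolding residue_subfield_eq by auto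

lemma red_pow: "x \<in> \<O> \<Longrightarrow> red (x [^] (n::nat)) = red x [^]\<^bsub>k\<^esub> n \<and> x [^] n \<in> \<O>"
proof (induction n)
  case 0
  then show ?case using one_k subringE(3)[OF subring_O] by simp
next
  case (Suc n)
  then show ?case using red_simps(1)[of "x [^] n" x] subringE(6)[OF subring_O] by simp
qed

text \<open>The hypothesis speaks of \<open>M\<close> with its own maximal ideal, the conclusion of
  the image of \<open>M\<close> in the residue field of the ambient field. Chosen representatives
  give an injection from the latter to the former.\<close>

lemma finite_residue_subfield:
  assumes M: "subfield M R" and fin: "finite (carrier (residue_field (R\<lparr>carrier := M\<rparr>) v))"
  shows "finite (\<kappa> M)"
proof -
  let ?m = "val_ideal (R\<lparr>carrier := M\<rparr>) v"
  let ?c = "\<lambda>x. (\<Union>h\<in>?m. {h \<oplus> x})"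
  have O: "val_ring (R\<lparr>carrier := M\<rparr>) v = M \<inter> \<O>" and m: "?m = M \<inter> \<mm>"
    using subfieldE(3)[OF M] unfolding val_ring_def val_ideal_def by auto
  have "carrier (residue_field (R\<lparr>carrier := M\<rparr>) v) = ?c ` (M \<inter> \<O>)"
    unfolding residue_field_def FactRing_def A_RCOSETS_def' a_r_coset_def r_coset_def O by auto
  then have fin': "finite (?c ` (M \<inter> \<O>))" using fin by simp
  define s where "s c = (SOME x. x \<in> M \<inter> \<O> \<and> red x = c)" for c
  have s: "s c \<in> M \<inter> \<O>" "red (s c) = c" if "c \<in> \<kappa> M" for c
  proof -
    have "\<exists>x. x \<in> M \<inter> \<O> \<and> red x = c" using that unfolding residue_subfield_eq by auto
    from someI_ex[OF this] show "s c \<in> M \<inter> \<O>" "red (s c) = c" unfolding s_def by auto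
  qed
  have "inj_on (\<lambda>c. ?c (s c)) (\<kappa> M)"
  proof (rule inj_onI)
    fix c d assume c: "c \<in> \<kappa> M" and d: "d \<in> \<kappa> M" and eq: "?c (s c) = ?c (s d)"
    have R: "s c \<in> carrier R" "s d \<in> carrier R" using s[OF c] s[OF d] O_carrier by auto
    have "\<zero> \<in> ?m" using m subringE(2)[OF subfieldE(1)[OF M]] m_iff by simp
    then have "\<zero> \<oplus> s c \<in> ?c (s c)" by blast
    then have "s c \<in> ?c (s d)" using eq R by simp
    then obtain h where h: "h \<in> \<mm>" "s c = h \<oplus> s d" using m by auto
    have "h \<in> carrier R" using h m_sub O_carrier by auto
    then have "s c \<ominus> s d = h" unfolding h(2) using R by algebra
    then show "c = d" using red_eq_iff[of "s c" "s d"] s[OF c] s[OF d] h(1) by simp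
  qed
  moreover have "(\<lambda>c. ?c (s c)) ` \<kappa> M \<subseteq> ?c ` (M \<inter> \<O>)" using s by auto
  ultimately show ?thesis by (rule inj_on_finite[OF _ _ fin'])
qed

end

section \<open>The action of the Galois group on the residue field\<close>

locale valued_galois = galois_ext R K rs + discretely_valued_field R v
  for R (structure) and K rs v +
  assumes local_K: "local_field (R\<lparr>carrier := K\<rparr>) v"
begin

sublocale complete_subfield R v K
  using K local_field.complete[OF local_K] discretely_valued_field_axioms
  by (intro complete_subfield.intro complete_subfield_axioms.intro)

lemma finite_dim: "finite_dimension K (carrier R)"
  using finite_extension_finite_dimension(1)[OF K rs(1)] splits rs by (metis subsetD)

text \<open>The one-sided estimate is applied to \<open>\<sigma>\<close> and to its inverse.\<close>

lemma v_Gal: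
  assumes \<sigma>: "\<sigma> \<in> Gal K" and x: "x \<in> carrier R" "x \<noteq> \<zero>"
  shows "v (\<sigma> x) = v x" "\<sigma> x \<noteq> \<zero>"
proof -
  interpret A: group A by (rule group_A)
  interpret h: ring_hom_ring R R \<sigma> using Gal_hom[OF \<sigma>] .
  show nz: "\<sigma> x \<noteq> \<zero>" using Gal_eq_iff[OF \<sigma> x(1) zero_closed] x(2) by simp
  have i: "inv\<^bsub>A\<^esub> \<sigma> \<in> Gal K" using \<sigma> by simp
  have "v x \<le> v (\<sigma> x)" using automorphism_preserves_v[OF finite_dim GalD(1,3)[OF \<sigma>] x] .
  moreover have "v (\<sigma> x) \<le> v ((inv\<^bsub>A\<^esub> \<sigma>) (\<sigma> x))"
    using automorphism_preserves_v[OF finite_dim GalD(1,3)[OF i] Gal_closed[OF \<sigma> x(1)] nz] .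
  ultimately show "v (\<sigma> x) = v x" using inv_apply(1)[OF \<sigma> x(1)] by simp
qed

lemma vge_Gal: "\<sigma> \<in> Gal K \<Longrightarrow> vge n x \<Longrightarrow> vge n (\<sigma> x)"
proof -
  assume \<sigma>: "\<sigma> \<in> Gal K" and x: "vge n x"
  interpret h: ring_hom_ring R R \<sigma> using Gal_hom[OF \<sigma>] .
  show ?thesis using x v_Gal[OF \<sigma>, of x] unfolding vge_def by (cases "x = \<zero>") auto
qed

lemma Gal_O: "\<sigma> \<in> Gal K \<Longrightarrow> x \<in> \<O> \<Longrightarrow> \<sigma> x \<in> \<O>"
  using vge_Gal unfolding O_iff by blast

lemma Gal_m: "\<sigma> \<in> Gal K \<Longrightarrow> \<sigma> ` \<mm> = \<mm>"
proof
  assume \<sigma>: "\<sigma> \<in> Gal K"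
  interpret A: group A by (rule group_A)
  show "\<sigma> ` \<mm> \<subseteq> \<mm>" using vge_Gal[OF \<sigma>] by (auto simp: m_iff)
  show "\<mm> \<subseteq> \<sigma> ` \<mm>"
  proof
    fix x assume x: "x \<in> \<mm>"
    then have "(inv\<^bsub>A\<^esub> \<sigma>) x \<in> \<mm>" using vge_Gal[of "inv\<^bsub>A\<^esub> \<sigma>"] \<sigma> unfolding m_iff by simp
    moreover have "x = \<sigma> ((inv\<^bsub>A\<^esub> \<sigma>) x)" using inv_apply(2)[OF \<sigma>] x unfolding m_iff vge_def by simp
    ultimately show "x \<in> \<sigma> ` \<mm>" by (rule rev_image_eqI)
  qed
qed

lemma residue_map_red:
  assumes \<sigma>: "\<sigma> \<in> Gal K" and x: "x \<in> \<O>"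
  shows "residue_map R v \<sigma> (red x) = red (\<sigma> x)"
proof -
  have "\<mm> \<subseteq> carrier R" "x \<in> carrier R" using m_sub O_carrier x by auto
  then have "\<sigma> ` red x = red (\<sigma> x)"
    unfolding red_def using a_coset_hom(2)[OF GalD(1)[OF \<sigma>]] Gal_m[OF \<sigma>] by simp
  then show ?thesis unfolding residue_map_def using red_closed[OF x] by simp
qed

lemma residue_map_hom:
  assumes \<sigma>: "\<sigma> \<in> Gal K"
  shows "residue_map R v \<sigma> \<in> ring_hom k k"
proof -
  interpret h: ring_hom_ring R R \<sigma> using Gal_hom[OF \<sigma>] .
  note r = residue_map_red[OF \<sigma>] and O = subringE[OF subring_O]
  have Oc: "x \<in> carrier R" if "x \<in> \<O>" for x using that O_carrier by auto
  show ?thesis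
  proof (rule ring_hom_memI)
    fix c assume "c \<in> carrier k"
    then show "residue_map R v \<sigma> c \<in> carrier k" using r red_closed Gal_O[OF \<sigma>] unfolding carrier_k by auto
  next
    fix c d assume "c \<in> carrier k" "d \<in> carrier k"
    then obtain x y where x: "x \<in> \<O>" "c = red x" and y: "y \<in> \<O>" "d = red y" unfolding carrier_k by auto
    show "residue_map R v \<sigma> (c \<otimes>\<^bsub>k\<^esub> d) = residue_map R v \<sigma> c \<otimes>\<^bsub>k\<^esub> residue_map R v \<sigma> d"
      unfolding x(2) y(2) red_simps(1)[OF x(1) y(1), symmetric] r[OF O(6)[OF x(1) y(1)]] r[OF x(1)] r[OF y(1)]
      using red_simps(1)[OF Gal_O[OF \<sigma> x(1)] Gal_O[OF \<sigma> y(1)]] Oc x(1) y(1) by simp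
    show "residue_map R v \<sigma> (c \<oplus>\<^bsub>k\<^esub> d) = residue_map R v \<sigma> c \<oplus>\<^bsub>k\<^esub> residue_map R v \<sigma> d"
      unfolding x(2) y(2) red_simps(2)[OF x(1) y(1), symmetric] r[OF O(7)[OF x(1) y(1)]] r[OF x(1)] r[OF y(1)]
      using red_simps(2)[OF Gal_O[OF \<sigma> x(1)] Gal_O[OF \<sigma> y(1)]] Oc x(1) y(1) by simp
  next
    show "residue_map R v \<sigma> \<one>\<^bsub>k\<^esub> = \<one>\<^bsub>k\<^esub>" using r[OF O(3)] one_k by simp
  qed
qed

text \<open>The powers of an element of nonzero valuation have distinct valuations. Infinitude is
  what the primitive element argument asks of \<open>K\<close>.\<close>

lemma infinite_K: "infinite K"
proof
  assume fin: "finite K"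
  interpret LK: local_field "R\<lparr>carrier := K\<rparr>" v by (rule local_K)
  obtain x where x: "x \<in> K" "x \<noteq> \<zero>" "v x \<noteq> 0" using LK.val_nontrivial by auto
  have xc: "x \<in> carrier R" using x K_carrier by auto
  have "x [^] (n::nat) \<in> K" for n
    using x(1) subringE(3,6)[OF subfieldE(1)[OF K]] by (induction n) auto
  then have "range (\<lambda>n::nat. x [^] n) \<subseteq> K" by auto
  moreover have "inj (\<lambda>n::nat. x [^] n)"
  proof (rule injI)
    fix i j :: nat assume "x [^] i = x [^] j"
    then have "int i * v x = int j * v x" using v_pow[OF xc x(2)] by metis
    then show "i = j" using x(3) by simp
  qed
  ultimately show False using fin finite_subset finite_imageD by blast
qed

lemma finite_kappa_K: "finite (\<kappa> K)"
  using finite_residue_subfield[OF K local_field.finite_residue_field[OF local_K]] .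

text \<open>Despite its name this is the characteristic polynomial: a conjugate is repeated whenever
  several automorphisms send \<open>a\<close> to it.\<close>

definition min_poly :: "'a set \<Rightarrow> 'a \<Rightarrow> 'a list"
  where "min_poly M a = roots_poly (\<lambda>\<sigma>. \<sigma> a) (Gal M)"

lemma finite_Gal': "K \<subseteq> M \<Longrightarrow> finite (Gal M)"
  using finite_subset[OF galois_group_mono finite_Gal] .

lemma one_Gal:
  assumes "M \<subseteq> carrier R" "K \<subseteq> M"
  shows "\<one>\<^bsub>A\<^esub> \<in> Gal M"
  using subgroup.one_closed[OF subgroup_Gal[OF assms(2,1)]] .

text \<open>The coefficients are integral because the Galois group preserves the valuation ring, and
  they lie in \<open>M\<close> by the fixed field theorem.\<close>

lemma min_poly:
  assumes M: "subfield M R" "K \<subseteq> M" and a: "a \<in> \<O>"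
  shows "set (min_poly M a) \<subseteq> M \<inter> \<O>" "length (min_poly M a) = Suc (card (Gal M))"
    "lead_coeff (min_poly M a) = \<one>" "eval (min_poly M a) a = \<zero>"
    "\<And>y. y \<in> carrier R \<Longrightarrow> eval (min_poly M a) y = finprod R (\<lambda>\<sigma>. y \<ominus> \<sigma> a) (Gal M)"
proof -
  interpret A: group A by (rule group_A)
  let ?H = "Gal M"
  have HK: "?H \<subseteq> Gal K" using galois_group_mono[OF M(2)] .
  have H: "subgroup ?H A" using subgroup_Gal[OF M(2) subfieldE(3)[OF M(1)]] .
  have fin: "finite ?H" using finite_Gal'[OF M(2)] .
  have ac: "a \<in> carrier R" using a O_carrier by auto
  have cl: "\<sigma> a \<in> \<O>" "\<sigma> a \<in> carrier R" if "\<sigma> \<in> ?H" for \<sigma>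
    using that HK Gal_O[of \<sigma>] a O_carrier by auto
  have pO: "min_poly M a \<in> carrier (\<O>[X])"
    unfolding min_poly_def by (rule roots_poly_closed) (use fin subring_O cl in auto)
  have cM: "c \<in> M" if c: "c \<in> set (min_poly M a)" for c
  proof (rule fixed_field[OF M])
    show "c \<in> carrier R" using pO c O_carrier unfolding univ_poly_def polynomial_def by auto
    fix \<tau> assume \<tau>: "\<tau> \<in> Gal M"
    have im: "(\<lambda>\<sigma>. \<tau> \<otimes>\<^bsub>A\<^esub> \<sigma>) ` ?H \<subseteq> ?H" using \<tau> subgroup.m_closed[OF H] by auto
    have "inj_on (\<lambda>\<sigma>. \<tau> \<otimes>\<^bsub>A\<^esub> \<sigma>) ?H" using \<tau> HK by (auto intro!: inj_onI simp: subset_iff)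
    then have bij: "bij_betw (\<lambda>\<sigma>. \<tau> \<otimes>\<^bsub>A\<^esub> \<sigma>) ?H ?H"
      using endo_inj_surj[OF fin im] unfolding bij_betw_def by simp
    show "\<tau> c = c"
    proof (rule roots_poly_invariant[where f = "\<lambda>\<sigma>. \<sigma> a" and B = ?H and \<pi> = "(\<otimes>\<^bsub>A\<^esub>) \<tau>"])
      show "bij_betw ((\<otimes>\<^bsub>A\<^esub>) \<tau>) ?H ?H" by (rule bij)
      show "c \<in> set (roots_poly (\<lambda>\<sigma>. \<sigma> a) ?H)" using c unfolding min_poly_def .
      fix \<sigma> assume "\<sigma> \<in> ?H"
      then show "\<tau> (\<sigma> a) = (\<tau> \<otimes>\<^bsub>A\<^esub> \<sigma>) a" using mult_apply[OF subsetD[OF HK \<tau>] subsetD[OF HK] ac] by simp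
    qed (use fin cl GalD(1)[OF \<tau>] in auto)
  qed
  show "set (min_poly M a) \<subseteq> M \<inter> \<O>" using pO cM unfolding univ_poly_def polynomial_def by auto
  show "length (min_poly M a) = Suc (card ?H)"
    unfolding min_poly_def by (rule length_roots_poly) (use fin cl in auto)
  show "lead_coeff (min_poly M a) = \<one>"
    unfolding min_poly_def by (rule lead_coeff_roots_poly) (use fin cl in auto)
  have "\<one>\<^bsub>A\<^esub> \<in> ?H" "\<one>\<^bsub>A\<^esub> a = a" using subgroup.one_closed[OF H] one_apply[OF ac] by auto
  moreover have "eval (min_poly M a) a = \<zero> \<longleftrightarrow> (\<exists>\<sigma>\<in>?H. a = \<sigma> a)"
    unfolding min_poly_def by (rule eval_roots_poly_zero_iff) (use fin cl ac in auto)
  ultimately show "eval (min_poly M a) a = \<zero>" by metis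
  show "eval (min_poly M a) y = finprod R (\<lambda>\<sigma>. y \<ominus> \<sigma> a) ?H" if "y \<in> carrier R" for y
    unfolding min_poly_def by (rule eval_roots_poly) (use fin cl that in auto)
qed

lemma eval_red:
  assumes "set p \<subseteq> \<O>" "y \<in> \<O>"
  shows "residue.eval (map red p) (red y) = red (eval p y)" "eval p y \<in> \<O>"
proof -
  interpret h: ring_hom_ring "R\<lparr>carrier := \<O>\<rparr>" k red
    using ring_hom_ringI2[OF cring.axioms(1)[OF cring_O] residue.ring_axioms red_hom] .
  show "residue.eval (map red p) (red y) = red (eval p y)"
    using h.eval_hom'[of y p] assms eval_consistent[OF subring_O] by simp
  show "eval p y \<in> \<O>"
    using h.R.eval_in_carrier[of p y] assms eval_consistent[OF subring_O] by simp
qed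

text \<open>Every residue is a root of a reduced characteristic polynomial, which is monic of degree
  \<open>card (Gal K)\<close> over the finite residue field of \<open>K\<close>. There are finitely
  many such polynomials, each with finitely many roots.\<close>

lemma finite_k: "finite (carrier k)"
proof -
  let ?P = "{p. set p \<subseteq> \<kappa> K \<and> length p = Suc (card (Gal K))}"
  let ?Q = "?P \<inter> carrier (poly_ring k)"
  have "finite ?P" using finite_lists_length_eq[OF finite_kappa_K] .
  then have fin: "finite (\<Union>p\<in>?Q. {y. residue.is_root p y})" using residue.finite_number_of_roots by blast
  have "c \<in> (\<Union>p\<in>?Q. {y. residue.is_root p y})" if c: "c \<in> carrier k" for c
  proof -
    obtain a where a: "a \<in> \<O>" "c = red a" using c unfolding carrier_k by auto
    note m = min_poly[OF K subset_refl a(1)]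
    let ?p = "map red (min_poly K a)"
    have len: "length ?p = Suc (card (Gal K))" using m(2) by simp
    have "set ?p \<subseteq> \<kappa> K" using m(1) unfolding residue_subfield_eq by auto
    then have P: "?p \<in> ?P" using len by simp
    have "min_poly K a \<noteq> []" using m(2) by auto
    then have "lead_coeff ?p = \<one>\<^bsub>k\<^esub>" using m(3) one_k by (simp add: hd_map)
    moreover have "set ?p \<subseteq> carrier k" using m(1) unfolding carrier_k by auto
    ultimately have Q: "?p \<in> carrier (poly_ring k)" unfolding univ_poly_def polynomial_def by simp
    have "residue.eval ?p c = red \<zero>" using eval_red(1)[of "min_poly K a" a] m(1,4) a by simp
    then have "residue.is_root ?p c"
      using c red_zero \<open>min_poly K a \<noteq> []\<close> unfolding residue.is_root_def by simp
    then show ?thesis using P Q by blast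
  qed
  then have "carrier k \<subseteq> (\<Union>p\<in>?Q. {y. residue.is_root p y})" by (rule subsetI)
  then show ?thesis using fin by (rule finite_subset)
qed

sublocale residue: finite_field "residue_field R v"
  using finite_k by unfold_locales

lemma subfield_kappa: "subfield M R \<Longrightarrow> subfield (\<kappa> M) k"
  by (rule subfield_residue_subfield)

text \<open>The image of the conjugate \<open>\<sigma> a\<close> of a lift \<open>a\<close> of a generator is found among the roots of the
  reduced characteristic polynomial of \<open>a\<close>, whose coefficients are fixed by the Frobenius map.\<close>

theorem ex_frobenius:
  assumes M: "subfield M R" "K \<subseteq> M"
  shows "\<exists>\<sigma> \<in> Gal M. \<forall>c\<in>carrier k. residue_map R v \<sigma> c = c [^]\<^bsub>k\<^esub> card (\<kappa> M)"
proof -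
  let ?q = "card (\<kappa> M)"
  obtain g where gen: "residue.generator g" using residue.ex_generator by blast
  note g = residue.generatorD[OF gen]
  obtain a where a: "a \<in> \<O>" "g = red a" using g(1) unfolding carrier_k by auto
  have ac: "a \<in> carrier R" using a O_carrier by auto
  have MK: "Gal M \<subseteq> Gal K" using galois_group_mono[OF M(2)] .
  note m = min_poly[OF M a(1)]
  let ?p = "min_poly M a"
  let ?\<Phi> = "\<lambda>x. x [^]\<^bsub>k\<^esub> ?q"
  have \<Phi>: "?\<Phi> \<in> ring_hom k k" using residue.frobenius_hom[OF subfield_kappa[OF M(1)]] .
  interpret h: ring_hom_ring k k ?\<Phi> using ring_hom_ringI2[OF residue.ring_axioms residue.ring_axioms \<Phi>] .
  have setp: "set (map red ?p) \<subseteq> \<kappa> M" using m(1) unfolding residue_subfield_eq by auto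
  have setk: "set (map red ?p) \<subseteq> carrier k" using m(1) unfolding carrier_k by auto
  have eq: "map ?\<Phi> (map red ?p) = map red ?p"
    using setp residue.pow_card_subfield[OF subfield_kappa[OF M(1)]] by (intro map_idI) auto
  have "residue.eval (map red ?p) (?\<Phi> g) = ?\<Phi> (residue.eval (map red ?p) g)"
    using h.eval_hom'[OF g(1) setk, unfolded eq] by (rule sym)
  also have "residue.eval (map red ?p) g = \<zero>\<^bsub>k\<^esub>" using eval_red(1)[of ?p a] m(1,4) a red_zero by simp
  also have "?\<Phi> \<zero>\<^bsub>k\<^esub> = \<zero>\<^bsub>k\<^esub>" using h.hom_zero .
  finally have root: "residue.eval (map red ?p) (?\<Phi> g) = \<zero>\<^bsub>k\<^esub>" .
  \<comment> \<open>A lift of the Frobenius conjugate of \<open>g\<close>; the reduced equation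
    becomes \<open>eval ?p ?b \<in> \<mm>\<close>.\<close>
  let ?b = "a [^] ?q"
  have b: "?b \<in> \<O>" "red ?b = ?\<Phi> g" using red_pow[OF a(1)] a(2) by auto
  have bc: "?b \<in> carrier R" using ac by simp
  have "red (eval ?p ?b) = \<zero>\<^bsub>k\<^esub>" using root eval_red(1)[of ?p ?b] m(1) b by simp
  then have in_m: "eval ?p ?b \<in> \<mm>" using red_zero_iff eval_red(2)[of ?p ?b] m(1) b(1) by simp
  \<comment> \<open>\<open>eval ?p ?b\<close> is the product of these differences. The complement of
    \<open>\<mm>\<close> in \<open>\<O>\<close> is multiplicatively closed, so some factor must lie
    in \<open>\<mm>\<close>.\<close>
  have "\<exists>\<sigma>\<in>Gal M. ?b \<ominus> \<sigma> a \<in> \<mm>"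
  proof (rule ccontr)
    assume no: "\<not> ?thesis"
    have "finprod R (\<lambda>\<sigma>. ?b \<ominus> \<sigma> a) (Gal M) \<in> \<O> - \<mm>"
    proof (rule finprod_in_prime)
      show "finite (Gal M)" using finite_Gal'[OF M(2)] .
      fix \<sigma> assume \<sigma>: "\<sigma> \<in> Gal M"
      have sa: "\<sigma> a \<in> \<O>" using Gal_O[of \<sigma> a] \<sigma> MK a(1) by auto
      show "?b \<ominus> \<sigma> a \<in> carrier R" using bc sa O_carrier by auto
      have "?b \<ominus> \<sigma> a \<in> \<O>" using vge_diff b(1) sa unfolding O_iff by simp
      then show "?b \<ominus> \<sigma> a \<in> \<O> - \<mm>" using no \<sigma> by auto
    next
      show "\<one> \<in> \<O> - \<mm>" unfolding unit_O using v_one by simp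
      fix x y assume "x \<in> \<O> - \<mm>" "y \<in> \<O> - \<mm>"
      then show "x \<otimes> y \<in> \<O> - \<mm>" unfolding unit_O using val_mult[of x y] by (simp add: integral_iff)
    qed
    then show False using in_m m(5)[OF bc] by simp
  qed
  then obtain \<sigma> where \<sigma>: "\<sigma> \<in> Gal M" "?b \<ominus> \<sigma> a \<in> \<mm>" by blast
  have \<sigma>K: "\<sigma> \<in> Gal K" using \<sigma> MK by auto
  have "red (\<sigma> a) = ?\<Phi> g" using red_eq_iff[OF b(1) Gal_O[OF \<sigma>K a(1)]] \<sigma>(2) b(2) by simp
  then have "residue_map R v \<sigma> g = ?\<Phi> g" using residue_map_red[OF \<sigma>K a(1)] a(2) by simp
  moreover have "?q > 0" using residue.card_subfield_gt_1[OF subfield_kappa[OF M(1)]] by simp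
  ultimately have "residue_map R v \<sigma> c = ?\<Phi> c" if "c \<in> carrier k" for c
    using residue.hom_eq_on_generator[OF gen residue_map_hom[OF \<sigma>K]] that by blast
  then show ?thesis using \<sigma>(1) by blast
qed

end

section \<open>Inertia groups and unramified extensions\<close>

context valued_galois
begin

text \<open>The kernel of the action on the residue field. That it is the Galois group over the
  maximal unramified extension is proved in \<open>Gal_max_unramified\<close>.\<close>

definition "inertia = {\<sigma> \<in> Gal K. \<forall>c\<in>carrier k. residue_map R v \<sigma> c = c}"

lemma residue_map_mult:
  assumes "\<sigma> \<in> Gal K" "\<tau> \<in> Gal K" "c \<in> carrier k"
  shows "residue_map R v (\<sigma> \<otimes>\<^bsub>A\<^esub> \<tau>) c = residue_map R v \<sigma> (residue_map R v \<tau> c)"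
proof -
  interpret A: group A by (rule group_A)
  obtain x where x: "x \<in> \<O>" "c = red x" using assms(3) unfolding carrier_k by auto
  have "x \<in> carrier R" using x O_carrier by auto
  then show ?thesis
    unfolding x(2) using assms(1,2) x(1) by (simp add: residue_map_red mult_apply Gal_O)
qed

lemma residue_map_closed: "\<sigma> \<in> Gal K \<Longrightarrow> c \<in> carrier k \<Longrightarrow> residue_map R v \<sigma> c \<in> carrier k"
  using ring_hom_memE(1)[OF residue_map_hom] .

lemma residue_map_one: "c \<in> carrier k \<Longrightarrow> residue_map R v \<one>\<^bsub>A\<^esub> c = c"
proof -
  interpret A: group A by (rule group_A)
  assume "c \<in> carrier k"
  then obtain x where x: "x \<in> \<O>" "c = red x" unfolding carrier_k by auto
  then show ?thesis using residue_map_red[OF A.one_closed x(1)] one_apply[of x] O_carrier by auto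
qed

lemma residue_map_inv:
  assumes "\<sigma> \<in> Gal K" "c \<in> carrier k"
  shows "residue_map R v (inv\<^bsub>A\<^esub> \<sigma>) (residue_map R v \<sigma> c) = c"
    and "residue_map R v \<sigma> (residue_map R v (inv\<^bsub>A\<^esub> \<sigma>) c) = c"
proof -
  interpret A: group A by (rule group_A)
  show "residue_map R v (inv\<^bsub>A\<^esub> \<sigma>) (residue_map R v \<sigma> c) = c"
    using residue_map_mult[of "inv\<^bsub>A\<^esub> \<sigma>" \<sigma> c] residue_map_one assms by simp
  show "residue_map R v \<sigma> (residue_map R v (inv\<^bsub>A\<^esub> \<sigma>) c) = c"
    using residue_map_mult[of \<sigma> "inv\<^bsub>A\<^esub> \<sigma>" c] residue_map_one assms by simp
qed

lemma inertia_normal: "inertia \<lhd> A"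
proof -
  interpret A: group A by (rule group_A)
  have "subgroup inertia A"
  proof (rule A.subgroupI)
    show "inertia \<subseteq> carrier A" unfolding inertia_def by auto
    have "\<one>\<^bsub>A\<^esub> \<in> inertia" unfolding inertia_def using residue_map_one by simp
    then show "inertia \<noteq> {}" by blast
    show "inv\<^bsub>A\<^esub> \<sigma> \<in> inertia" if "\<sigma> \<in> inertia" for \<sigma>
      using that residue_map_inv(1)[of \<sigma>] unfolding inertia_def by auto
    show "\<sigma> \<otimes>\<^bsub>A\<^esub> \<tau> \<in> inertia" if "\<sigma> \<in> inertia" "\<tau> \<in> inertia" for \<sigma> \<tau>
      using that residue_map_mult[of \<sigma> \<tau>] unfolding inertia_def by auto
  qed
  moreover have "\<sigma> \<otimes>\<^bsub>A\<^esub> \<tau> \<otimes>\<^bsub>A\<^esub> inv\<^bsub>A\<^esub> \<sigma> \<in> inertia" if \<sigma>: "\<sigma> \<in> Gal K" and \<tau>: "\<tau> \<in> inertia" for \<sigma> \<tau>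
  proof -
    have \<tau>K: "\<tau> \<in> Gal K" using \<tau> unfolding inertia_def by auto
    have "residue_map R v (\<sigma> \<otimes>\<^bsub>A\<^esub> \<tau> \<otimes>\<^bsub>A\<^esub> inv\<^bsub>A\<^esub> \<sigma>) c = c" if c: "c \<in> carrier k" for c
    proof -
      have i: "residue_map R v (inv\<^bsub>A\<^esub> \<sigma>) c \<in> carrier k" using residue_map_closed \<sigma> c by simp
      have "residue_map R v (\<sigma> \<otimes>\<^bsub>A\<^esub> \<tau> \<otimes>\<^bsub>A\<^esub> inv\<^bsub>A\<^esub> \<sigma>) c
          = residue_map R v \<sigma> (residue_map R v \<tau> (residue_map R v (inv\<^bsub>A\<^esub> \<sigma>) c))"
        using residue_map_mult[of "\<sigma> \<otimes>\<^bsub>A\<^esub> \<tau>" "inv\<^bsub>A\<^esub> \<sigma>" c] residue_map_mult[OF \<sigma> \<tau>K i] \<sigma> \<tau>K c by simp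
      also have "\<dots> = residue_map R v \<sigma> (residue_map R v (inv\<^bsub>A\<^esub> \<sigma>) c)"
        using \<tau> i unfolding inertia_def by simp
      finally show ?thesis using residue_map_inv(2)[OF \<sigma> c] by simp
    qed
    then show ?thesis using \<sigma> \<tau>K unfolding inertia_def by simp
  qed
  ultimately show ?thesis using A.normal_inv_iff by blast
qed

lemma residue_map_pow:
  assumes "\<phi> \<in> Gal K" "\<And>c. c \<in> carrier k \<Longrightarrow> residue_map R v \<phi> c = c [^]\<^bsub>k\<^esub> q" "c \<in> carrier k"
  shows "residue_map R v (\<phi> [^]\<^bsub>A\<^esub> (n::nat)) c = c [^]\<^bsub>k\<^esub> ((q::nat) ^ n)"
proof -
  interpret A: group A by (rule group_A)
  show ?thesis
  proof (induction n)
    case 0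
    then show ?case using residue_map_one assms(3) by simp
  next
    case (Suc n)
    have "residue_map R v (\<phi> [^]\<^bsub>A\<^esub> Suc n) c = residue_map R v (\<phi> [^]\<^bsub>A\<^esub> n) (residue_map R v \<phi> c)"
      using residue_map_mult[of "\<phi> [^]\<^bsub>A\<^esub> n" \<phi> c] assms(1,3) by simp
    also have "\<dots> = residue_map R v (\<phi> [^]\<^bsub>A\<^esub> n) c [^]\<^bsub>k\<^esub> q"
    proof -
      interpret h: ring_hom_ring k k "residue_map R v (\<phi> [^]\<^bsub>A\<^esub> n)"
        using ring_hom_ringI2[OF residue.ring_axioms residue.ring_axioms residue_map_hom] assms(1) by simp
      show ?thesis using h.hom_nat_pow[OF assms(3)] assms(2,3) by simp
    qed
    finally show ?case using Suc assms(3) by (simp add: residue.nat_pow_pow mult.commute)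
  qed
qed

lemma Gal_fixes_kappa:
  assumes "\<sigma> \<in> Gal M" "K \<subseteq> M" "c \<in> \<kappa> M"
  shows "residue_map R v \<sigma> c = c"
proof -
  obtain x where x: "x \<in> M" "x \<in> \<O>" "c = red x" using assms(3) unfolding residue_subfield_eq by auto
  have "\<sigma> \<in> Gal K" using assms(1) galois_group_mono[OF assms(2)] by auto
  then show ?thesis using residue_map_red[OF _ x(2)] GalD(3)[OF assms(1) x(1)] x(3) by simp
qed

text \<open>The action of \<open>\<sigma>\<close> fixes the residue field of \<open>M\<close>, so it
  is a power of the Frobenius map, and \<open>\<phi>\<close> to that power acts in the same way. The
  bound \<open>n < f\<close> serves the count of cosets.\<close>

lemma Gal_cyclic_mod_inertia:
  assumes M: "subfield M R" "K \<subseteq> M" and f: "card (carrier k) = card (\<kappa> M) ^ f"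
    and \<phi>: "\<phi> \<in> Gal M" "\<And>c. c \<in> carrier k \<Longrightarrow> residue_map R v \<phi> c = c [^]\<^bsub>k\<^esub> card (\<kappa> M)"
    and \<sigma>: "\<sigma> \<in> Gal M"
  shows "\<exists>n<f. \<exists>i\<in>inertia \<inter> Gal M. \<sigma> = \<phi> [^]\<^bsub>A\<^esub> (n::nat) \<otimes>\<^bsub>A\<^esub> i"
proof -
  interpret A: group A by (rule group_A)
  have H: "subgroup (Gal M) A" using subgroup_Gal[OF M(2) subfieldE(3)[OF M(1)]] .
  have K': "\<sigma> \<in> Gal K" "\<phi> \<in> Gal K" using \<sigma> \<phi>(1) galois_group_mono[OF M(2)] by auto
  obtain n where n: "n < f" "\<forall>c\<in>carrier k. residue_map R v \<sigma> c = c [^]\<^bsub>k\<^esub> (card (\<kappa> M) ^ n)"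
    using residue.hom_fixing_subfield[OF subfield_kappa[OF M(1)] f residue_map_hom[OF K'(1)]]
      Gal_fixes_kappa[OF \<sigma> M(2)] by blast
  let ?p = "\<phi> [^]\<^bsub>A\<^esub> n"
  have p: "?p \<in> Gal M" using A.subgroup_nat_pow_closed[OF H \<phi>(1)] .
  have pK: "?p \<in> Gal K" using K' by simp
  let ?i = "inv\<^bsub>A\<^esub> ?p \<otimes>\<^bsub>A\<^esub> \<sigma>"
  have "residue_map R v ?i c = c" if c: "c \<in> carrier k" for c
    using residue_map_mult[of "inv\<^bsub>A\<^esub> ?p" \<sigma> c] residue_map_pow[OF K'(2) \<phi>(2) c, of n]
      residue_map_inv(1)[OF pK c] n(2) c K' pK by simp
  then have "?i \<in> inertia" using K' pK unfolding inertia_def by simp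
  moreover have "?i \<in> Gal M" using p \<sigma> subgroup.m_closed[OF H] subgroup.m_inv_closed[OF H] by simp
  moreover have "\<sigma> = ?p \<otimes>\<^bsub>A\<^esub> ?i" using K' pK by (simp add: A.m_assoc[symmetric])
  ultimately show ?thesis using n(1) by blast
qed

text \<open>The factorization into a power of \<open>\<phi>\<close> with exponent below
  \<open>f\<close> and an inertia element is unique, because distinct such exponents act differently
  on the residue field.\<close>

lemma card_Gal_eq:
  assumes M: "subfield M R" "K \<subseteq> M" and f: "card (carrier k) = card (\<kappa> M) ^ f"
  shows "card (Gal M) = f * card (inertia \<inter> Gal M)"
proof -
  interpret A: group A by (rule group_A)
  have H: "subgroup (Gal M) A" using subgroup_Gal[OF M(2) subfieldE(3)[OF M(1)]] .
  have MK: "Gal M \<subseteq> Gal K" using galois_group_mono[OF M(2)] .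
  obtain \<phi> where \<phi>: "\<phi> \<in> Gal M" "\<And>c. c \<in> carrier k \<Longrightarrow> residue_map R v \<phi> c = c [^]\<^bsub>k\<^esub> card (\<kappa> M)"
    using ex_frobenius[OF M] by blast
  have \<phi>K: "\<phi> \<in> Gal K" using \<phi>(1) MK by auto
  let ?F = "\<lambda>(n::nat, i). \<phi> [^]\<^bsub>A\<^esub> n \<otimes>\<^bsub>A\<^esub> i"
  let ?D = "{..<f} \<times> (inertia \<inter> Gal M)"
  have "?F ` ?D = Gal M"
  proof (intro subset_antisym subsetI)
    fix \<sigma> assume "\<sigma> \<in> ?F ` ?D"
    then show "\<sigma> \<in> Gal M"
      using A.subgroup_nat_pow_closed[OF H \<phi>(1)] subgroup.m_closed[OF H] by auto
  next
    fix \<sigma> assume "\<sigma> \<in> Gal M"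
    then obtain n i where "n < f" "i \<in> inertia \<inter> Gal M" "\<sigma> = \<phi> [^]\<^bsub>A\<^esub> (n::nat) \<otimes>\<^bsub>A\<^esub> i"
      using Gal_cyclic_mod_inertia[OF M f \<phi>] by blast
    then show "\<sigma> \<in> ?F ` ?D" by (intro image_eqI[of _ _ "(n, i)"]) auto
  qed
  moreover have "inj_on ?F ?D"
  proof (rule inj_onI)
    fix x y assume x: "x \<in> ?D" and y: "y \<in> ?D" and xy: "?F x = ?F y"
    obtain n i where n: "x = (n, i)" "n \<in> {..<f}" and i: "i \<in> inertia" using x by auto
    obtain m j where m: "y = (m, j)" "m \<in> {..<f}" and j: "j \<in> inertia" using y by auto
    have eq: "\<phi> [^]\<^bsub>A\<^esub> n \<otimes>\<^bsub>A\<^esub> i = \<phi> [^]\<^bsub>A\<^esub> m \<otimes>\<^bsub>A\<^esub> j" using xy n m by simp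
    have ij: "i \<in> Gal K" "j \<in> Gal K" using i j unfolding inertia_def by auto
    have "residue_map R v (\<phi> [^]\<^bsub>A\<^esub> n \<otimes>\<^bsub>A\<^esub> i) c = c [^]\<^bsub>k\<^esub> (card (\<kappa> M) ^ n)"
      if "c \<in> carrier k" "i \<in> inertia" for c n i
      using residue_map_mult[of "\<phi> [^]\<^bsub>A\<^esub> n" i c] residue_map_pow[OF \<phi>K \<phi>(2)] that \<phi>K
      unfolding inertia_def by simp
    then have "n = m"
      using residue.frobenius_powers_distinct[OF subfield_kappa[OF M(1)] f, of n m] n m i j eq by (metis lessThan_iff)
    moreover have "i = j" using eq \<open>n = m\<close> \<phi>K ij by simp
    ultimately show "x = y" using n m by simp
  qed
  ultimately have "card (Gal M) = card ?D" using card_image by metis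
  then show ?thesis by (simp add: card_cartesian_product)
qed

section \<open>Residue degrees and the maximal unramified extension\<close>

lemma card_k_eq:
  assumes "subfield M R" "K \<subseteq> M"
  shows "\<exists>f. card (carrier k) = card (\<kappa> M) ^ f"
  using residue.dim_eq[OF subfield_kappa[OF assms(1)] residue.carrier_is_subfield]
    subfieldE(3)[OF subfield_kappa[OF assms(1)]] by blast

lemma card_kappa_eq:
  assumes "subfield M R" "subfield E R" "M \<subseteq> E"
  shows "card (\<kappa> E) = card (\<kappa> M) ^ residue_degree R v M E"
  using residue.dim_eq[OF subfield_kappa[OF assms(1)] subfield_kappa[OF assms(2)] residue_subfield_mono[OF assms(3)]]
  unfolding residue_degree_def .

lemma totally_ramified_iff:
  assumes "subfield M R" "subfield E R" "M \<subseteq> E"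
  shows "totally_ramified R v M E \<longleftrightarrow> \<kappa> E = \<kappa> M"
  using residue.dim_one_iff[OF subfield_kappa[OF assms(1)] subfield_kappa[OF assms(2)] residue_subfield_mono[OF assms(3)]]
  unfolding totally_ramified_def residue_degree_def .

lemma card_Gal_tower:
  assumes M: "subfield M R" "K \<subseteq> M" and E: "subfield E R" "M \<subseteq> E"
  shows "card (Gal M) = (dim over M) E * card (Gal E)"
proof -
  have dM: "dimension (card (Gal M)) M (carrier R)" using degree_eq_card_Gal[OF infinite_K M] .
  have dE: "dimension (card (Gal E)) E (carrier R)" using degree_eq_card_Gal[OF infinite_K E(1)] M(2) E(2) by auto
  have "subalgebra M E R"
    unfolding subalgebra_def subalgebra_axioms_def
    using subring.axioms(1)[OF subfieldE(1)[OF E(1)]] subringE(6)[OF subfieldE(1)[OF E(1)]] E(2) by auto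
  then have "finite_dimension M E"
    using subalbegra_incl_imp_finite_dimension[OF M(1) finite_dimensionI[OF dM]] subfieldE(3)[OF E(1)] by blast
  then have "dimension ((dim over M) E) M E" using finite_dimensionE[OF M(1)] by blast
  then have "dimension ((dim over M) E * card (Gal E)) M (carrier R)"
    using telescopic_base[OF M(1) E(1) _ dE] by blast
  then show ?thesis using dimension_is_inj[OF M(1) dM] by blast
qed

lemma inertia_Int_Gal_subgroup:
  assumes "subfield M R" "K \<subseteq> M"
  shows "subgroup (inertia \<inter> Gal M) A"
proof -
  interpret A: group A by (rule group_A)
  show ?thesis
    using A.subgroups_Inter_pair[OF normal_imp_subgroup[OF inertia_normal]
        subgroup_Gal[OF assms(2) subfieldE(3)[OF assms(1)]]] .
qed

text \<open>The order of the Galois group over \<open>M\<close> is computed twice, by residue degree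
  and inertia and by the field degree of \<open>E\<close>. If the field degree of \<open>E\<close>
  over \<open>M\<close> equals the residue degree, the inertia groups over \<open>M\<close> and
  \<open>E\<close> have equal order.\<close>

lemma unramified_inertia:
  assumes M: "subfield M R" "K \<subseteq> M" and E: "subfield E R" "M \<subseteq> E" "unramified R v M E"
  shows "inertia \<inter> Gal M \<subseteq> Gal E"
proof -
  have KE: "K \<subseteq> E" using M E by auto
  \<comment> \<open>Here \<open>?e\<close> is the residue degree of \<open>E\<close> over
    \<open>M\<close>, not a ramification index; \<open>f\<close> is the residue degree of the
    ambient field over \<open>E\<close>.\<close>
  let ?e = "residue_degree R v M E"
  obtain f where f: "card (carrier k) = card (\<kappa> E) ^ f" using card_k_eq[OF E(1) KE] by blast
  have fM: "card (carrier k) = card (\<kappa> M) ^ (?e * f)"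
    unfolding f card_kappa_eq[OF M(1) E(1,2)] by (simp add: power_mult)
  have sub: "inertia \<inter> Gal E \<subseteq> inertia \<inter> Gal M" using galois_group_mono[OF E(2)] by auto
  have "?e * f * card (inertia \<inter> Gal M) = ?e * (f * card (inertia \<inter> Gal E))"
    using card_Gal_eq[OF M fM] card_Gal_eq[OF E(1) KE f] card_Gal_tower[OF M E(1,2)] E(3)
    unfolding unramified_def by (metis mult.assoc)
  moreover have "?e * f > 0"
  proof (rule ccontr)
    assume "\<not> ?thesis"
    then have "card (Gal M) = 0" using card_Gal_eq[OF M fM] by simp
    then show False using one_Gal[OF subfieldE(3)[OF M(1)] M(2)] finite_Gal'[OF M(2)] by auto
  qed
  ultimately have "card (inertia \<inter> Gal M) = card (inertia \<inter> Gal E)" by simp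
  then have "inertia \<inter> Gal E = inertia \<inter> Gal M"
    using card_subset_eq[OF _ sub] finite_Gal'[OF M(2)] by simp
  then show ?thesis by auto
qed

text \<open>The Galois group over \<open>E\<close> consists of inertia elements, so a Frobenius
  element over \<open>E\<close> acts trivially, which forces the residue field of \<open>E\<close>
  to be all of \<open>k\<close>. Counting then turns this into equality of field degree and residue
  degree.\<close>

lemma unramified_fixed_field:
  assumes M: "subfield M R" "K \<subseteq> M"
  defines "E \<equiv> {x \<in> carrier R. \<forall>\<sigma>\<in>inertia \<inter> Gal M. \<sigma> x = x}"
  shows "subfield E R" "M \<subseteq> E" "Gal E = inertia \<inter> Gal M" "unramified R v M E"
proof -
  note I = inertia_Int_Gal_subgroup[OF M]
  note E = Gal_fixed_field[OF infinite_K I, folded E_def]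
  show "subfield E R" "Gal E = inertia \<inter> Gal M" using E by auto
  show ME: "M \<subseteq> E" unfolding E_def using GalD(3) subfieldE(3)[OF M(1)] by blast
  obtain \<sigma> where \<sigma>: "\<sigma> \<in> Gal E" "\<And>c. c \<in> carrier k \<Longrightarrow> residue_map R v \<sigma> c = c [^]\<^bsub>k\<^esub> card (\<kappa> E)"
    using ex_frobenius[OF E(1,2)] by blast
  have "c \<in> \<kappa> E" if c: "c \<in> carrier k" for c
  proof -
    have "residue_map R v \<sigma> c = c" using \<sigma>(1) E(3) c unfolding inertia_def by auto
    then show ?thesis using residue.pow_card_subfield_iff[OF subfield_kappa[OF E(1)] c] \<sigma>(2)[OF c] by simp
  qed
  then have "\<kappa> E = carrier k" using subfieldE(3)[OF subfield_kappa[OF E(1)]] by auto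
  then have f: "card (carrier k) = card (\<kappa> M) ^ residue_degree R v M E"
    using card_kappa_eq[OF M(1) E(1) ME] by simp
  have "residue_degree R v M E * card (inertia \<inter> Gal M) = (dim over M) E * card (inertia \<inter> Gal M)"
    using card_Gal_eq[OF M f] card_Gal_tower[OF M E(1) ME] E(3) by metis
  moreover have "card (inertia \<inter> Gal M) \<noteq> 0"
    using subgroup.one_closed[OF I] finite_Gal'[OF M(2)] by auto
  ultimately show "unramified R v M E" unfolding unramified_def by simp
qed

text \<open>Inertia fixes every unramified extension, and the field fixed by it is itself one of
  them.\<close>

theorem Gal_max_unramified:
  assumes M: "subfield M R" "K \<subseteq> M"
  shows "Gal (max_unramified R v M) = inertia \<inter> Gal M"
proof -
  let ?U = "\<Union>{E. subfield E R \<and> M \<subseteq> E \<and> unramified R v M E}"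
  have Uc: "?U \<subseteq> carrier R" using subfieldE(3) by auto
  note E = unramified_fixed_field[OF M]
  have EU: "{x \<in> carrier R. \<forall>\<sigma>\<in>inertia \<inter> Gal M. \<sigma> x = x} \<subseteq> ?U" using E(1,2,4) by blast
  have UG: "?U \<subseteq> generate_field R ?U" by (auto intro: generate_field.incl)
  have "Gal (generate_field R ?U) \<subseteq> inertia \<inter> Gal M"
    using galois_group_mono[of _ "generate_field R ?U" R] EU UG E(3) by blast
  moreover have "\<sigma> \<in> Gal (generate_field R ?U)" if \<sigma>: "\<sigma> \<in> inertia \<inter> Gal M" for \<sigma>
  proof -
    have "\<forall>x\<in>?U. \<sigma> x = x" using unramified_inertia[OF M] \<sigma> GalD(3) by blast
    moreover have "\<sigma> \<in> Gal K" using \<sigma> galois_group_mono[OF M(2)] by auto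
    ultimately show ?thesis using Gal_generate_field[OF Uc] by blast
  qed
  ultimately show ?thesis unfolding max_unramified_def by blast
qed

end

section \<open>Exceptional extensions\<close>

context valued_galois
begin

lemma frob_set_iff:
  assumes "K \<subseteq> M"
  shows "\<sigma> \<in> frob_set R v K M \<longleftrightarrow>
    \<sigma> \<in> Gal M \<and> (\<forall>c\<in>carrier k. residue_map R v \<sigma> c = c [^]\<^bsub>k\<^esub> card (\<kappa> K))"
proof -
  have "residue_map R v \<sigma> = residue_frobenius R v K \<longleftrightarrow>
      (\<forall>c\<in>carrier k. residue_map R v \<sigma> c = c [^]\<^bsub>k\<^esub> card (\<kappa> K))"
    unfolding residue_map_def residue_frobenius_def by (auto simp: fun_eq_iff restrict_def)
  then show ?thesis using galois_group_mono[OF assms] unfolding frob_set_def by blast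
qed

lemma frob_set_Int: "K \<subseteq> M \<Longrightarrow> frob_set R v K M = frob_set R v K K \<inter> Gal M"
  using galois_group_mono[of K M R] frob_set_iff[of M] frob_set_iff[OF subset_refl] by blast

lemma frob_set_eq_coset:
  assumes \<phi>: "\<phi> \<in> frob_set R v K K"
  shows "frob_set R v K K = \<phi> <#\<^bsub>A\<^esub> inertia"
proof -
  interpret A: group A by (rule group_A)
  have \<phi>K: "\<phi> \<in> Gal K" and \<phi>q: "\<And>c. c \<in> carrier k \<Longrightarrow> residue_map R v \<phi> c = c [^]\<^bsub>k\<^esub> card (\<kappa> K)"
    using \<phi> frob_set_iff[OF subset_refl] by auto
  show ?thesis
  proof (intro subset_antisym subsetI)
    fix \<sigma> assume "\<sigma> \<in> frob_set R v K K"
    then have \<sigma>: "\<sigma> \<in> Gal K" "\<And>c. c \<in> carrier k \<Longrightarrow> residue_map R v \<sigma> c = residue_map R v \<phi> c"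
      using frob_set_iff[OF subset_refl] \<phi>q by auto
    have "residue_map R v (inv\<^bsub>A\<^esub> \<phi> \<otimes>\<^bsub>A\<^esub> \<sigma>) c = c" if c: "c \<in> carrier k" for c
      using residue_map_mult[of "inv\<^bsub>A\<^esub> \<phi>" \<sigma> c] residue_map_inv(1)[OF \<phi>K c] \<sigma> \<phi>K c by simp
    then have "inv\<^bsub>A\<^esub> \<phi> \<otimes>\<^bsub>A\<^esub> \<sigma> \<in> inertia" using \<sigma>(1) \<phi>K unfolding inertia_def by simp
    moreover have "\<sigma> = \<phi> \<otimes>\<^bsub>A\<^esub> (inv\<^bsub>A\<^esub> \<phi> \<otimes>\<^bsub>A\<^esub> \<sigma>)" using \<sigma>(1) \<phi>K by (simp add: A.m_assoc[symmetric])
    ultimately show "\<sigma> \<in> \<phi> <#\<^bsub>A\<^esub> inertia" unfolding l_coset_def by blast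
  next
    fix \<sigma> assume "\<sigma> \<in> \<phi> <#\<^bsub>A\<^esub> inertia"
    then obtain i where i: "i \<in> inertia" "\<sigma> = \<phi> \<otimes>\<^bsub>A\<^esub> i" unfolding l_coset_def by auto
    then show "\<sigma> \<in> frob_set R v K K"
      using \<phi>K \<phi>q residue_map_mult[OF \<phi>K] unfolding frob_set_iff[OF subset_refl] inertia_def by auto
  qed
qed

text \<open>If \<open>E\<close> and \<open>K\<close> have the same residue field, a Frobenius
  element over \<open>E\<close> is one for \<open>K\<close>. Conversely, an element fixing
  \<open>E\<close> that acts as the q-th power forces every residue of \<open>E\<close> to satisfy
  \<open>c^q = c\<close>, hence to come from \<open>K\<close>.\<close>

lemma totally_ramified_iff_frob:
  assumes E: "subfield E R" "K \<subseteq> E"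
  shows "totally_ramified R v K E \<longleftrightarrow> frob_set R v K E \<noteq> {}"
proof
  assume "totally_ramified R v K E"
  then have "\<kappa> E = \<kappa> K" using totally_ramified_iff[OF K E] by simp
  then obtain \<sigma> where "\<sigma> \<in> Gal E" "\<forall>c\<in>carrier k. residue_map R v \<sigma> c = c [^]\<^bsub>k\<^esub> card (\<kappa> K)"
    using ex_frobenius[OF E] by metis
  then have "\<sigma> \<in> frob_set R v K E" using frob_set_iff[OF E(2)] by blast
  then show "frob_set R v K E \<noteq> {}" by blast
next
  assume "frob_set R v K E \<noteq> {}"
  then obtain \<sigma> where "\<sigma> \<in> frob_set R v K E" by blast
  then have \<sigma>: "\<sigma> \<in> Gal E" "\<And>c. c \<in> carrier k \<Longrightarrow> residue_map R v \<sigma> c = c [^]\<^bsub>k\<^esub> card (\<kappa> K)"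
    using frob_set_iff[OF E(2)] by auto
  have "c \<in> \<kappa> K" if c: "c \<in> \<kappa> E" for c
  proof -
    have ck: "c \<in> carrier k" using c subfieldE(3)[OF subfield_kappa[OF E(1)]] by auto
    have "c [^]\<^bsub>k\<^esub> card (\<kappa> K) = c" using \<sigma>(2)[OF ck] Gal_fixes_kappa[OF \<sigma>(1) E(2) c] by simp
    then show ?thesis using residue.pow_card_subfield_iff[OF subfield_kappa[OF K] ck] by simp
  qed
  then have "\<kappa> E = \<kappa> K" using residue_subfield_mono[OF E(2)] by auto
  then show "totally_ramified R v K E" using totally_ramified_iff[OF K E] by simp
qed

text \<open>An automorphism fixes a compositum exactly when it fixes both factors, so the Frobenius
  set of the compositum is the intersection of the two Frobenius sets.\<close>

lemma exceptional_iff_frob_disjoint: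
  assumes L: "subfield L R" "K \<subseteq> L" and tot: "totally_ramified R v K L"
  shows "exceptional R v K L \<longleftrightarrow>
    (\<forall>\<sigma> \<in> Gal K - Gal L. frob_set R v K L \<inter> frob_set R v K (\<sigma> ` L) = {})"
proof -
  have "totally_ramified R v K (compositum R L (\<sigma> ` L)) \<longleftrightarrow>
      frob_set R v K L \<inter> frob_set R v K (\<sigma> ` L) \<noteq> {}" if \<sigma>: "\<sigma> \<in> Gal K" for \<sigma>
  proof -
    let ?E = "compositum R L (\<sigma> ` L)"
    have c: "L \<union> \<sigma> ` L \<subseteq> carrier R" using subfieldE(3)[OF L(1)] Gal_closed[OF \<sigma>] by auto
    have E: "subfield ?E R" unfolding compositum_def using generate_field_is_subfield[OF c] .
    have KE: "K \<subseteq> ?E" unfolding compositum_def using L(2) by (auto intro: generate_field.incl)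
    have K\<sigma>: "K \<subseteq> \<sigma> ` L" using GalD(3)[OF \<sigma>] L(2) by force
    have "\<tau> \<in> Gal ?E \<longleftrightarrow> \<tau> \<in> Gal L \<and> \<tau> \<in> Gal (\<sigma> ` L)" for \<tau>
    proof (cases "\<tau> \<in> Gal K")
      case True
      then show ?thesis
        unfolding compositum_def using Gal_generate_field[OF c True] unfolding galois_group_iff by blast
    next
      case False
      then show ?thesis using galois_group_mono[OF KE] galois_group_mono[OF L(2)] by blast
    qed
    then have "frob_set R v K ?E = frob_set R v K L \<inter> frob_set R v K (\<sigma> ` L)"
      using frob_set_iff[OF KE] frob_set_iff[OF L(2)] frob_set_iff[OF K\<sigma>] by blast
    then show ?thesis using totally_ramified_iff_frob[OF E KE] by simp
  qed
  then show ?thesis unfolding exceptional_def using tot by blast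
qed

lemma frob_set_image:
  assumes L: "L \<subseteq> carrier R" "K \<subseteq> L" and \<sigma>: "\<sigma> \<in> Gal K"
  shows "frob_set R v K (\<sigma> ` L) =
    frob_set R v K K \<inter> {\<tau>. inv\<^bsub>A\<^esub> \<sigma> \<otimes>\<^bsub>A\<^esub> \<tau> \<otimes>\<^bsub>A\<^esub> \<sigma> \<in> Gal L}"
proof -
  have K\<sigma>: "K \<subseteq> \<sigma> ` L" using GalD(3)[OF \<sigma>] L(2) by force
  have "frob_set R v K K \<subseteq> Gal K" using frob_set_iff[OF subset_refl] by blast
  then show ?thesis using frob_set_Int[OF K\<sigma>] Gal_conj_iff[OF \<sigma> _ L(1)] by blast
qed

text \<open>\<open>\<phi>\<close> fixes \<open>L\<close> and yet acts as the Frobenius map of the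
  residue field of \<open>K\<close>; thus it generates \<open>A\<close> modulo inertia from within
  the Galois group over \<open>L\<close>.\<close>

lemma cyclic_mod_normal_inertia:
  assumes L: "subfield L R" "K \<subseteq> L" and \<phi>: "\<phi> \<in> frob_set R v K L"
  shows "cyclic_mod_normal A inertia (Gal L) \<phi>"
proof (intro cyclic_mod_normal.intro cyclic_mod_normal_axioms.intro)
  show "group A" by (rule group_A)
  show "finite (carrier A)" by (rule finite_Gal)
  show "inertia \<lhd> A" by (rule inertia_normal)
  show "subgroup (Gal L) A" using subgroup_Gal[OF L(2) subfieldE(3)[OF L(1)]] .
  show "\<phi> \<in> Gal L" using \<phi> frob_set_iff[OF L(2)] by blast
  have "\<phi> \<in> frob_set R v K K" using \<phi> frob_set_Int[OF L(2)] by blast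
  then have \<phi>': "\<phi> \<in> Gal K" "\<And>c. c \<in> carrier k \<Longrightarrow> residue_map R v \<phi> c = c [^]\<^bsub>k\<^esub> card (\<kappa> K)"
    using frob_set_iff[OF subset_refl] by auto
  obtain f where "card (carrier k) = card (\<kappa> K) ^ f" using card_k_eq[OF K subset_refl] by blast
  then show "\<exists>n::nat. \<exists>i\<in>inertia. \<sigma> = \<phi> [^]\<^bsub>A\<^esub> n \<otimes>\<^bsub>A\<^esub> i" if "\<sigma> \<in> carrier A" for \<sigma>
    using Gal_cyclic_mod_inertia[OF K subset_refl _ \<phi>' that] by blast
qed

end

theorem theorem4p5:
  fixes N :: "('a, 'b) ring_scheme"
    and v :: "'a \<Rightarrow> int"
    and K L :: "'a set"
  defines "A \<equiv> galois_group N K"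
    and "G \<equiv> galois_group N (max_unramified N v K)"
    and "A1 \<equiv> galois_group N L"
    and "G1 \<equiv> galois_group N (max_unramified N v L)"
  defines "S \<equiv> lcosets\<^bsub>A\<^esub> (carrier A1)"
    and "act \<equiv> (\<lambda>\<sigma> c. \<sigma> <#\<^bsub>A\<^esub> c)"
    and "act2 \<equiv> (\<lambda>\<sigma> (c, d). (\<sigma> <#\<^bsub>A\<^esub> c, \<sigma> <#\<^bsub>A\<^esub> d))"
    and "Frob \<equiv> frob_set N v K"
  assumes N: "discretely_valued_field N v"
    and K: "subfield K N" "local_field (N\<lparr>carrier := K\<rparr>) v"
    and L: "subfield L N" "local_field (N\<lparr>carrier := L\<rparr>) v"
    and KL: "K \<subseteq> L" "ring.finite_dimension N K L" "ring.separable_extension N K L"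
    and closure: "ring.is_galois_closure N K L"
    and tot_ram: "totally_ramified N v K L"
  shows "(exceptional N v K L \<longleftrightarrow>
      orbits A1 S act \<inter> orbits G1 S act = {{carrier A1}}) \<and>
    (exceptional N v K L \<longleftrightarrow>
      orbits A (S \<times> S) act2 \<inter> orbits G (S \<times> S) act2 = {Id_on S}) \<and>
    (exceptional N v K L \<longleftrightarrow>
      (\<forall>\<sigma> \<in> carrier A - carrier A1. Frob L \<inter> Frob (\<sigma> ` L) = {})) \<and>
    (exceptional N v K L \<longleftrightarrow>
      Frob K = (\<Union>\<sigma> \<in> carrier A. Frob (\<sigma> ` L))) \<and>
    (exceptional N v K L \<longleftrightarrow>
      (\<forall>\<sigma> \<in> carrier A. carrier A = generate A (carrier G \<union> {\<sigma>}) \<longrightarrow> (\<exists>!c. c \<in> invariants S act \<sigma>))) \<and>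
    (exceptional N v K L \<longleftrightarrow>
      (\<forall>\<sigma> \<in> carrier A. carrier A = generate A (carrier G \<union> {\<sigma>}) \<longrightarrow> (\<exists>\<^sub>\<le>\<^sub>1c. c \<in> invariants S act \<sigma>))) \<and>
    (exceptional N v K L \<longleftrightarrow>
      (\<forall>\<sigma> \<in> carrier A. carrier A = generate A (carrier G \<union> {\<sigma>}) \<longrightarrow> (\<exists>c. c \<in> invariants S act \<sigma>))) \<and>
    (exceptional N v K L \<longleftrightarrow>
      (\<forall>\<sigma> \<in> Frob K. \<exists>!c. c \<in> invariants S act \<sigma>)) \<and>
    (exceptional N v K L \<longleftrightarrow>
      (\<forall>\<sigma> \<in> Frob K. \<exists>\<^sub>\<le>\<^sub>1c. c \<in> invariants S act \<sigma>)) \<and>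
    (exceptional N v K L \<longleftrightarrow>
      (\<forall>\<sigma> \<in> Frob K. \<exists>c. c \<in> invariants S act \<sigma>)) \<and>
    (exceptional N v K L \<longleftrightarrow>
      (\<forall>\<sigma> \<in> carrier A1. carrier A1 = generate A1 (carrier G1 \<union> {\<sigma>}) \<longrightarrow> (\<exists>!c. c \<in> invariants S act \<sigma>))) \<and>
    (exceptional N v K L \<longleftrightarrow>
      (\<forall>\<sigma> \<in> carrier A1. carrier A1 = generate A1 (carrier G1 \<union> {\<sigma>}) \<longrightarrow> (\<exists>\<^sub>\<le>\<^sub>1c. c \<in> invariants S act \<sigma>))) \<and>
    (exceptional N v K L \<longleftrightarrow>
      (\<forall>\<sigma> \<in> Frob L. \<exists>!c. c \<in> invariants S act \<sigma>)) \<and>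
    (exceptional N v K L \<longleftrightarrow>
      (\<forall>\<sigma> \<in> Frob L. \<exists>\<^sub>\<le>\<^sub>1c. c \<in> invariants S act \<sigma>))"
proof -
  interpret V: discretely_valued_field N v by (rule N)
  obtain rs where rs: "galois_ext N K rs"
    using V.galois_closure_galois_ext[OF K(1) L(1) KL closure] by blast
  interpret g: valued_galois N K rs v
    using rs N K(2) by (intro valued_galois.intro valued_galois_axioms.intro)
  \<comment> \<open>Total ramification enters here, by supplying a Frobenius element for
    \<open>K\<close> that fixes \<open>L\<close>.\<close>
  have "frob_set N v K L \<noteq> {}" using g.totally_ramified_iff_frob[OF L(1) KL(1)] tot_ram by simp
  then obtain \<phi> where \<phi>: "\<phi> \<in> frob_set N v K L" by blast
  interpret c: cyclic_mod_normal A g.inertia "carrier A1" \<phi>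
    unfolding A_def A1_def using g.cyclic_mod_normal_inertia[OF L(1) KL(1) \<phi>] .
  have Lc: "L \<subseteq> carrier N" using subfieldE(3)[OF L(1)] .
  have A1: "A1 = A\<lparr>carrier := carrier A1\<rparr>"
    unfolding A1_def A_def using g.galois_group_restrict .
  have cG: "carrier G = g.inertia"
    unfolding G_def using g.Gal_max_unramified[OF K(1) subset_refl] unfolding g.inertia_def by blast
  have G: "G = A\<lparr>carrier := g.inertia\<rparr>"
    using cG unfolding G_def A_def using g.galois_group_restrict by metis
  have cG1: "carrier G1 = g.inertia \<inter> carrier A1"
    unfolding G1_def A1_def using g.Gal_max_unramified[OF L(1) KL(1)] .
  have G1: "G1 = A\<lparr>carrier := g.inertia \<inter> carrier A1\<rparr>"
    using cG1 unfolding G1_def A_def using g.galois_group_restrict by metis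
  have S: "S = c.S" and act: "act = l_coset A" unfolding S_def act_def by auto
  have FK: "Frob K = c.F"
    unfolding Frob_def A_def
    using g.frob_set_eq_coset \<phi> g.frob_set_Int[OF KL(1)] by blast
  have FL: "Frob L = c.F \<inter> carrier A1"
    using FK g.frob_set_Int[OF KL(1)] unfolding Frob_def A1_def by simp
  have F\<sigma>: "Frob (\<sigma> ` L) = c.F \<inter> {\<tau>. inv\<^bsub>A\<^esub> \<sigma> \<otimes>\<^bsub>A\<^esub> \<tau> \<otimes>\<^bsub>A\<^esub> \<sigma> \<in> carrier A1}" if "\<sigma> \<in> carrier A" for \<sigma>
    using g.frob_set_image[OF Lc KL(1)] that FK unfolding Frob_def A_def A1_def by simp
  have four: "exceptional N v K L \<longleftrightarrow> (\<forall>\<sigma> \<in> carrier A - carrier A1. Frob L \<inter> Frob (\<sigma> ` L) = {})"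
    using g.exceptional_iff_frob_disjoint[OF L(1) KL(1) tot_ram] unfolding Frob_def A_def A1_def .
  \<comment> \<open>Field theory ends here: \<open>Frob\<close> has been expressed by cosets and
    conjugates, and disjointness becomes \<open>frob_unique\<close>.\<close>
  then have ex: "exceptional N v K L \<longleftrightarrow> c.frob_unique"
    unfolding c.frob_unique_disjoint FL using F\<sigma> by simp
  have gen: "carrier A = generate A (carrier G \<union> {\<sigma>}) \<longleftrightarrow> c.generates \<sigma>" for \<sigma>
    unfolding c.generates_def cG ..
  \<comment> \<open>The subgroup generated in \<open>A1\<close> is the one generated in
    \<open>A\<close>, as \<open>A1\<close> contains the generators.\<close>
  have gen1: "carrier A1 = generate A1 (carrier G1 \<union> {\<sigma>}) \<longleftrightarrow> c.generates_H \<sigma>"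
    if "\<sigma> \<in> carrier A1" for \<sigma>
    unfolding c.generates_H_def cG1 using c.generate_consistent[OF _ c.H] that A1 by (metis Int_lower2 Un_least empty_subsetI insert_subset)
  show ?thesis
  proof (intro conjI)
    show "exceptional N v K L \<longleftrightarrow> orbits A1 S act \<inter> orbits G1 S act = {{carrier A1}}"
      using c.frob_unique_orbits A1 unfolding ex S act G1 by metis
    show "exceptional N v K L \<longleftrightarrow> orbits A (S \<times> S) act2 \<inter> orbits G (S \<times> S) act2 = {Id_on S}"
      unfolding ex S G act2_def by (rule c.frob_unique_orbits_pairs)
    show "exceptional N v K L \<longleftrightarrow> Frob K = (\<Union>\<sigma> \<in> carrier A. Frob (\<sigma> ` L))"
      unfolding ex c.frob_unique_cover FK using F\<sigma> by simp
  qed (unfold ex S act FK FL gen, fact four[unfolded ex FL], fact c.frob_unique_generates_ex1,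
    fact c.frob_unique_generates, fact c.frob_unique_generates_ex, fact c.frob_unique_ex1,
    fact c.frob_unique_def, fact c.frob_unique_ex,
    use gen1 c.frob_unique_generates_H_ex1 in simp, use gen1 c.frob_unique_generates_H in simp,
    fact c.frob_unique_H_ex1, fact c.frob_unique_H_uniq)
qed

end
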